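(* Let $n \geq 1$ and let $t_n$ be the number of tree-rooted planar cubic maps with $2n$ vertices. Let $C_j = \frac{1}{j+1}\binom{2j}{j}$ denote the $j$-th Catalan number. Then, with $k, l$ denoting positive integers, $$(2n+2)\,t_n = \begin{cases} C_{n+1}C_{2n} + \frac{1}{2}(n+1)\,C_n\binom{2k}{k}, & \text{if } n+1 = 2k-1 \text{ and } n+1 \neq 3l,\\[3pt] C_{n+1}C_{2n} + (n+1)\,C_n\binom{2k}{k}, & \text{if } n+1 = 2k \text{ and } n+1 \neq 3l,\\[3pt] C_{n+1}C_{2n} + 4(2k-1)\,C_{4k-3}\binom{4k-2}{2k-1} + \frac{1}{2}(n+1)\,C_n\binom{6k-2}{3k-1}, & \text{if } n+1 = 3(2k-1),\\[3pt] C_{n+1}C_{2n} + 8k\,C_{4k-1}\binom{4k}{2k} + (n+1)\,C_n\binom{6k}{3k}, & \text{if } n+1 = 6k. \end{cases}$$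
   Context: A planar cubic map is a connected graph, all of whose vertices have degree $3$ (loops and multiple edges allowed), embedded in the oriented sphere, considered up to orientation-preserving homeomorphism of the sphere. A tree-rooted planar cubic map is a planar cubic map together with a distinguished spanning tree of its underlying graph; two tree-rooted maps are identified if there is an orientation-preserving homeomorphism of the sphere carrying one map onto the other and the distinguished spanning tree onto the distinguished spanning tree. (No edge or directed edge is marked.) *)

theory Defs
  imports
    Complex_Main
    "HOL-Combinatorics.Orbits"
    "Graph_Theory.Digraph_Component"
begin

text \<open>
  Maps on oriented surfaces are represented by rotation systems. Every edge consists of two
  darts (half-edges). The permutation \<open>rot\<close> sends a dart to the next dart, counterclockwise,
  around the vertex it leaves; the fixed-point-free involution \<open>opp\<close> sends a dart to the other
  half of its edge. Vertices, edges and faces are the orbits of \<open>rot\<close>, \<open>opp\<close> and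
  \<open>rot \<circ> opp\<close>. A connected map drawn on the oriented sphere is exactly a connected rotation
  system of Euler characteristic 2, and orientation-preserving homeomorphisms correspond to
  bijections of darts that commute with both permutations. Since orbits are taken of darts, a
  map without edges is not represented; it has no vertex of degree 3.
\<close>

record 'd cmap =
  darts :: "'d set"
  rot :: "'d \<Rightarrow> 'd"
  opp :: "'d \<Rightarrow> 'd"

definition is_cmap :: "'d cmap \<Rightarrow> bool" where
  "is_cmap M \<longleftrightarrow> finite (darts M) \<and> rot M permutes darts M \<and> opp M permutes darts M \<and>
     (\<forall>d\<in>darts M. opp M d \<noteq> d \<and> opp M (opp M d) = d)"

definition vertices :: "'d cmap \<Rightarrow> 'd set set" where
  "vertices M = orbit (rot M) ` darts M"

definition edges :: "'d cmap \<Rightarrow> 'd set set" where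
  "edges M = orbit (opp M) ` darts M"

definition faces :: "'d cmap \<Rightarrow> 'd set set" where
  "faces M = orbit (rot M \<circ> opp M) ` darts M"

text \<open>
  The subgraph of the underlying graph with all vertices and with edge set \<open>T\<close>, as a symmetric
  multidigraph whose arcs are the darts: each edge contributes two opposite arcs.
\<close>

definition edge_subgraph :: "'d cmap \<Rightarrow> 'd set set \<Rightarrow> ('d set, 'd) pre_digraph" where
  "edge_subgraph M T =
     \<lparr> verts = vertices M, arcs = \<Union>T,
       tail = (\<lambda>d. orbit (rot M) d), head = (\<lambda>d. orbit (rot M) (opp M d)) \<rparr>"

definition underlying_graph :: "'d cmap \<Rightarrow> ('d set, 'd) pre_digraph" where
  "underlying_graph M = edge_subgraph M (edges M)"

definition planar_map :: "'d cmap \<Rightarrow> bool" where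
  "planar_map M \<longleftrightarrow> is_cmap M \<and> Digraph_Component.connected (underlying_graph M) \<and>
     int (card (vertices M)) - int (card (edges M)) + int (card (faces M)) = 2"

text \<open>
  The degree of a vertex is its number of darts, so that a loop counts twice.
\<close>

definition planar_cubic_map :: "'d cmap \<Rightarrow> bool" where
  "planar_cubic_map M \<longleftrightarrow> planar_map M \<and> (\<forall>v\<in>vertices M. card v = 3)"

text \<open>
  A cycle of the undirected multigraph is a directed cycle of darts no two of which belong to
  the same edge. This excludes going back and forth along one edge, but admits loops and pairs
  of parallel edges. (The library's \<open>tree\<close> and \<open>forest\<close> forbid directed cycles, so they
  cannot be applied to a symmetric digraph.)
\<close>

definition is_spanning_tree :: "'d cmap \<Rightarrow> 'd set set \<Rightarrow> bool" where
  "is_spanning_tree M T \<longleftrightarrow> T \<subseteq> edges M \<and> Digraph_Component.connected (edge_subgraph M T) \<and>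
     \<not> (\<exists>p. pre_digraph.cycle (edge_subgraph M T) p \<and> distinct (map (orbit (opp M)) p))"

text \<open>
  As any finite map is isomorphic to one whose darts are natural numbers, it suffices to count
  isomorphism classes of those.
\<close>

definition tree_rooted_planar_cubic_maps :: "nat \<Rightarrow> (nat cmap \<times> nat set set) set" where
  "tree_rooted_planar_cubic_maps m =
     {(M, T). planar_cubic_map M \<and> card (vertices M) = m \<and> is_spanning_tree M T}"

definition tree_rooted_iso :: "'d cmap \<times> 'd set set \<Rightarrow> 'd cmap \<times> 'd set set \<Rightarrow> bool" where
  "tree_rooted_iso = (\<lambda>(M, T) (M', T'). \<exists>f. bij_betw f (darts M) (darts M') \<and>
     (\<forall>d\<in>darts M. f (rot M d) = rot M' (f d) \<and> f (opp M d) = opp M' (f d)) \<and>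
     (\<lambda>e. f ` e) ` T = T')"

definition tree_rooted_iso_rel ::
  "nat \<Rightarrow> ((nat cmap \<times> nat set set) \<times> (nat cmap \<times> nat set set)) set" where
  "tree_rooted_iso_rel m =
     {(X, Y). X \<in> tree_rooted_planar_cubic_maps m \<and> Y \<in> tree_rooted_planar_cubic_maps m \<and>
              tree_rooted_iso X Y}"

definition num_tree_rooted :: "nat \<Rightarrow> nat" where
  "num_tree_rooted n = card (tree_rooted_planar_cubic_maps (2 * n) // tree_rooted_iso_rel (2 * n))"

definition catalan :: "nat \<Rightarrow> real" where
  "catalan j = 1 / (real j + 1) * real ((2 * j) choose j)"

lemma edges_subset_darts:
  assumes "is_cmap M" "e \<in> edges M" shows "e \<subseteq> darts M"
proof -
  from assms obtain d where "opp M permutes darts M" "d \<in> darts M" "e = orbit (opp M) d"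
    by (auto simp: is_cmap_def edges_def)
  thus ?thesis by (simp add: permutes_orbit_subset)
qed

lemma equiv_tree_rooted_iso_rel:
  "equiv (tree_rooted_planar_cubic_maps m) (tree_rooted_iso_rel m)"
proof (rule equivI)
  show "tree_rooted_iso_rel m \<subseteq> tree_rooted_planar_cubic_maps m \<times> tree_rooted_planar_cubic_maps m"
    by (auto simp: tree_rooted_iso_rel_def)
  show "refl_on (tree_rooted_planar_cubic_maps m) (tree_rooted_iso_rel m)"
    by (auto simp: refl_on_def tree_rooted_iso_rel_def tree_rooted_iso_def intro!: exI[of _ id])
  show "sym (tree_rooted_iso_rel m)"
  proof (rule symI)
    fix X Y assume XY: "(X, Y) \<in> tree_rooted_iso_rel m"
    obtain M T M' T' where [simp]: "X = (M, T)" "Y = (M', T')" by (cases X, cases Y) blast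
    from XY obtain f where f: "bij_betw f (darts M) (darts M')"
        "\<And>d. d \<in> darts M \<Longrightarrow> f (rot M d) = rot M' (f d)"
        "\<And>d. d \<in> darts M \<Longrightarrow> f (opp M d) = opp M' (f d)"
        "(\<lambda>e. f ` e) ` T = T'"
      by (auto simp: tree_rooted_iso_rel_def tree_rooted_iso_def)
    from XY have M: "is_cmap M" "T \<subseteq> edges M"
      by (auto simp: tree_rooted_iso_rel_def tree_rooted_planar_cubic_maps_def
          planar_cubic_map_def planar_map_def is_spanning_tree_def)
    let ?g = "inv_into (darts M) f"
    have inj: "inj_on f (darts M)" and im: "f ` darts M = darts M'"
      using f(1) by (auto simp: bij_betw_def)
    have mem: "rot M d \<in> darts M" "opp M d \<in> darts M" if "d \<in> darts M" for d
      using M(1) that by (auto simp: is_cmap_def permutes_in_image)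
    have comm: "?g (rot M' d') = rot M (?g d') \<and> ?g (opp M' d') = opp M (?g d')"
      if "d' \<in> darts M'" for d'
    proof -
      obtain d where d: "d \<in> darts M" "d' = f d" using \<open>d' \<in> darts M'\<close> im by blast
      show ?thesis unfolding d(2) f(2,3)[OF d(1), symmetric]
        using d(1) mem[OF d(1)] by (simp only: inv_into_f_f[OF inj])
    qed
    have "?g ` (f ` e) = e" if "e \<in> T" for e
      using inv_into_image_cancel[OF inj edges_subset_darts[OF M(1)]] M(2) that by blast
    hence "(\<lambda>e. ?g ` (f ` e)) ` T = T" by simp
    hence "(\<lambda>e. ?g ` e) ` T' = T" unfolding f(4)[symmetric] image_image .
    hence "bij_betw ?g (darts M') (darts M) \<and>
        (\<forall>d\<in>darts M'. ?g (rot M' d) = rot M (?g d) \<and> ?g (opp M' d) = opp M (?g d)) \<and>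
        (\<lambda>e. ?g ` e) ` T' = T"
      using comm bij_betw_inv_into[OF f(1)] by blast
    hence "tree_rooted_iso Y X"
      unfolding tree_rooted_iso_def \<open>X = (M, T)\<close> \<open>Y = (M', T')\<close> prod.case by - (rule exI[of _ ?g])
    thus "(Y, X) \<in> tree_rooted_iso_rel m" using XY by (auto simp: tree_rooted_iso_rel_def)
  qed
  show "trans (tree_rooted_iso_rel m)"
  proof (rule transI)
    fix X Y Z assume XY: "(X, Y) \<in> tree_rooted_iso_rel m" and YZ: "(Y, Z) \<in> tree_rooted_iso_rel m"
    obtain M T M' T' M'' T'' where [simp]: "X = (M, T)" "Y = (M', T')" "Z = (M'', T'')"
      by (cases X, cases Y, cases Z) blast
    from XY obtain f where f: "bij_betw f (darts M) (darts M')"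
        "\<And>d. d \<in> darts M \<Longrightarrow> f (rot M d) = rot M' (f d)"
        "\<And>d. d \<in> darts M \<Longrightarrow> f (opp M d) = opp M' (f d)" "(\<lambda>e. f ` e) ` T = T'"
      by (auto simp: tree_rooted_iso_rel_def tree_rooted_iso_def)
    from YZ obtain g where g: "bij_betw g (darts M') (darts M'')"
        "\<And>d. d \<in> darts M' \<Longrightarrow> g (rot M' d) = rot M'' (g d)"
        "\<And>d. d \<in> darts M' \<Longrightarrow> g (opp M' d) = opp M'' (g d)" "(\<lambda>e. g ` e) ` T' = T''"
      by (auto simp: tree_rooted_iso_rel_def tree_rooted_iso_def)
    have "\<And>d. d \<in> darts M \<Longrightarrow> f d \<in> darts M'" using f(1) by (auto simp: bij_betw_def)
    moreover have "(\<lambda>e. (g \<circ> f) ` e) ` T = T''"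
      by (simp add: g(4)[symmetric] f(4)[symmetric] image_image)
    ultimately have "bij_betw (g \<circ> f) (darts M) (darts M'') \<and>
        (\<forall>d\<in>darts M. (g \<circ> f) (rot M d) = rot M'' ((g \<circ> f) d) \<and>
          (g \<circ> f) (opp M d) = opp M'' ((g \<circ> f) d)) \<and> (\<lambda>e. (g \<circ> f) ` e) ` T = T''"
      using f(2,3) g(2,3) bij_betw_trans[OF f(1) g(1)] by simp
    hence "tree_rooted_iso X Z"
      unfolding tree_rooted_iso_def \<open>X = (M, T)\<close> \<open>Z = (M'', T'')\<close> prod.case
      by - (rule exI[of _ "g \<circ> f"])
    thus "(X, Z) \<in> tree_rooted_iso_rel m" using XY YZ by (auto simp: tree_rooted_iso_rel_def)
  qed
qed

end

theory Submission
  imports Defs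
begin

text \<open>
  Following the contour of the spanning tree numbers the \<open>6 n\<close> darts cyclically. In this numbering
  the tree edges and the remaining edges form two noncrossing involutions: multiplying a
  permutation by a transposition merges or splits cycles, the spanning tree is characterised by
  only merging the vertices into a single cycle, and Euler's formula says that every further edge
  splits one, which is the same as not crossing. Isomorphism classes are therefore orbits of such
  pairs under rotation, and Burnside's lemma applies. A rotation fixing the tree fixes its centre,
  an edge (half-turn) or a vertex (third of a turn). Moving the centre, or for the identity a
  non-tree dart, to position 0 reduces each term to a number of binary trees times a number of
  noncrossing matchings. Matchings invariant under a proper rotation correspond to arbitrary
  subsets of half the points of a fundamental period, by matching parentheses cyclically.
\<close>

section \<open>Orbits of permutations and noncrossing involutions\<close>

text \<open>The summands have these sources. A cubic tree pairs \<open>4 * n - 2\<close> of the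
  \<open>6 * n\<close> darts and leaves \<open>2 * n + 2\<close> free. Hung from a free dart it is a
  binary tree with \<open>2 * n\<close> nodes, and the free darts have C_{n+1} noncrossing
  matchings. A half-turn leaves one branch of \<open>n\<close> nodes and \<open>n + 1\<close> free
  darts per period; if n + 1 = 3m, a third of a turn leaves one branch of 2m - 1 nodes and 2m free
  darts. The middle binomial coefficients count the possible sets of closing parentheses in a
  period; for odd \<open>n + 1\<close> one point per period is left over and is joined to the
  opposite one. The obstacle is that noncrossing is stated for the linear order of the labels while
  the labels are cyclic. Two devices bridge this: the number of orbits of
  \<open>rotation K \<circ> f\<close> characterises noncrossing independently of the cut, and
  symmetric matchings are unrolled to the integers. That a rotation has a centre is shown by
  counting: otherwise its order would divide both the number \<open>2 * n\<close> of vertices and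
  the number \<open>2 * n - 1\<close> of tree edges.\<close>

lemma orbit_permutes_self:
  assumes "finite D" "f permutes D" shows "x \<in> orbit f x"
proof -
  have "permutation f" unfolding permutation_permutes using assms by auto
  thus ?thesis by (rule permutation_self_in_orbit)
qed

lemma orbit_eq_if_in:
  assumes "finite D" "f permutes D" "y \<in> orbit f x" shows "orbit f y = orbit f x"
  using orbit_cyclic_eq3[OF cyclic_on_orbit[OF assms(2,1)] assms(3)] .

lemma orbit_subset_closed:
  assumes "x \<in> A" "\<And>y. y \<in> A \<Longrightarrow> f y \<in> A" shows "orbit f x \<subseteq> A"
proof
  fix y assume "y \<in> orbit f x"
  thus "y \<in> A" by induct (use assms in auto)
qed

text \<open>At \<open>a\<close> the composite continues as \<open>f\<close> does after
  \<open>b\<close>, and conversely, so it runs through the whole orbit of \<open>b\<close> before it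
  returns to that of \<open>a\<close>. All other orbits avoid both points.\<close>

lemma transpose_merge:
  assumes D: "finite D" "f permutes D" and ab: "a \<in> D" "b \<in> D" "b \<notin> orbit f a"
  shows orbit_merge: "orbit (f \<circ> transpose a b) a = orbit f a \<union> orbit f b"
    and orbit_merge_other: "\<And>x. x \<notin> orbit f a \<union> orbit f b \<Longrightarrow> orbit (f \<circ> transpose a b) x = orbit f x"
    and card_orbits_merge: "card (orbit f ` D) = Suc (card (orbit (f \<circ> transpose a b) ` D))"
proof -
  let ?g = "f \<circ> transpose a b"
  have g: "?g permutes D" using D ab by (simp add: permutes_compose permutes_swap_id)
  note self = orbit_permutes_self[OF D] and eqI = orbit_eq_if_in[OF D]
  note selfg = orbit_permutes_self[OF D(1) g] and eqIg = orbit_eq_if_in[OF D(1) g]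
  have ne: "a \<notin> orbit f b" "a \<noteq> b" using ab(3) self eqI by metis+
  have ga: "?g a = f b" and gb: "?g b = f a" and go: "\<And>y. y \<noteq> a \<Longrightarrow> y \<noteq> b \<Longrightarrow> ?g y = f y"
    by (auto simp: transpose_def)
  have 1: "orbit f b \<subseteq> orbit ?g a"
  proof
    fix x assume "x \<in> orbit f b"
    thus "x \<in> orbit ?g a"
    proof induct
      case base show ?case using orbit.base[of ?g a] ga by metis
    next
      case (step y)
      show ?case
      proof (cases "y = b")
        case True thus ?thesis using orbit.base[of ?g a] ga by metis
      next
        case False
        moreover have "y \<noteq> a" using step(1) ne by blast
        ultimately show ?thesis using orbit.step[OF step(2)] go by metis
      qed
    qed
  qed
  hence b: "b \<in> orbit ?g a" using self by blast
  have 2: "orbit f a \<subseteq> orbit ?g a"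
  proof
    fix x assume "x \<in> orbit f a"
    thus "x \<in> orbit ?g a"
    proof induct
      case base show ?case using orbit.step[OF b] gb by metis
    next
      case (step y)
      show ?case
      proof (cases "y = a")
        case True thus ?thesis using orbit.step[OF b] gb by metis
      next
        case False
        moreover have "y \<noteq> b" using step(1) ab(3) by blast
        ultimately show ?thesis using orbit.step[OF step(2)] go by metis
      qed
    qed
  qed
  have 3: "orbit ?g a \<subseteq> orbit f a \<union> orbit f b"
    by (rule orbit_subset_closed) (auto simp: self transpose_def intro: orbit.intros)
  show A: "orbit ?g a = orbit f a \<union> orbit f b" using 1 2 3 by blast
  show B: "orbit ?g x = orbit f x" if "x \<notin> orbit f a \<union> orbit f b" for x
  proof (rule orbit_cong)
    show "x \<in> orbit f x" by (rule self)
    fix s assume "s \<in> orbit f x"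
    hence "orbit f s = orbit f x" by (rule eqI)
    hence "s \<noteq> a" "s \<noteq> b" using that self by auto
    thus "?g s = f s" by (simp add: transpose_def)
  qed
  let ?R = "orbit f ` D - {orbit f a, orbit f b}"
  have e: "orbit ?g ` D = insert (orbit f a \<union> orbit f b) ?R"
  proof (rule set_eqI, rule iffI)
    fix X assume "X \<in> orbit ?g ` D"
    then obtain x where x: "x \<in> D" "X = orbit ?g x" by auto
    show "X \<in> insert (orbit f a \<union> orbit f b) ?R"
    proof (cases "x \<in> orbit f a \<union> orbit f b")
      case True
      hence "x \<in> orbit ?g a" using A by simp
      hence "X = orbit f a \<union> orbit f b" using A eqIg[of x a] x(2) by metis
      thus ?thesis by blast
    next
      case False
      hence "X = orbit f x" using B x by auto
      thus ?thesis using x False self by auto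
    qed
  next
    fix X assume "X \<in> insert (orbit f a \<union> orbit f b) ?R"
    thus "X \<in> orbit ?g ` D"
    proof
      assume "X = orbit f a \<union> orbit f b" thus ?thesis using A ab by auto
    next
      assume "X \<in> ?R"
      then obtain x where x: "x \<in> D" "X = orbit f x" "orbit f x \<noteq> orbit f a" "orbit f x \<noteq> orbit f b" by auto
      hence "x \<notin> orbit f a \<union> orbit f b" using eqI by auto
      hence "orbit ?g x = X" using B x(2) by simp
      thus ?thesis using x(1) by blast
    qed
  qed
  have n: "orbit f a \<union> orbit f b \<notin> ?R"
  proof
    assume "orbit f a \<union> orbit f b \<in> ?R"
    then obtain x where "orbit f a \<union> orbit f b = orbit f x" by auto
    hence "orbit f a = orbit f x" "orbit f b = orbit f x" using self eqI by blast+
    thus False using self ab(3) by auto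
  qed
  have c: "card S = Suc (card (insert U (S - {A, B})))"
    if "U \<notin> S - {A, B}" "A \<noteq> B" "finite S" "A \<in> S" "B \<in> S" for U A B :: "'a set" and S
  proof -
    have "S = insert A (insert B (S - {A, B}))" using that by auto
    hence "card S = card (insert A (insert B (S - {A, B})))" by (rule arg_cong)
    also have "\<dots> = Suc (Suc (card (S - {A, B})))" using that by (simp del: insert_Diff_single)
    finally show ?thesis using that by simp
  qed
  show "card (orbit f ` D) = Suc (card (orbit ?g ` D))"
    unfolding e
  proof (rule c[OF n])
    show "orbit f a \<noteq> orbit f b" using self[of b] ab(3) by blast
    show "finite (orbit f ` D)" using D(1) by simp
    show "orbit f a \<in> orbit f ` D" "orbit f b \<in> orbit f ` D" using ab(1,2) by simp_all
  qed
qed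

text \<open>The iterates of \<open>b\<close> from \<open>f b\<close> up to the first visit of
  \<open>a\<close> are closed under the composite, because \<open>a\<close> is now sent to
  \<open>f b\<close>; they do not contain \<open>b\<close>. The count is the merging lemma read
  backwards: a second multiplication by the transposition restores \<open>f\<close>.\<close>

lemma transpose_split:
  assumes D: "finite D" "f permutes D" and ab: "a \<in> D" "b \<in> orbit f a" "a \<noteq> b"
  shows orbit_split: "b \<notin> orbit (f \<circ> transpose a b) a"
    and card_orbits_split: "card (orbit (f \<circ> transpose a b) ` D) = Suc (card (orbit f ` D))"
proof -
  let ?g = "f \<circ> transpose a b"
  have bD: "b \<in> D" using permutes_orbit_subset[OF D(2) ab(1)] ab(2) by blast
  have g: "?g permutes D" using D ab bD by (simp add: permutes_compose permutes_swap_id)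
  have a: "a \<in> orbit f b" using orbit_eq_if_in[OF D ab(2)] orbit_permutes_self[OF D] by auto
  define m where "m = funpow_dist1 f b a"
  have m: "(f ^^ m) b = a" "0 < m" unfolding m_def using funpow_dist1_prop[OF a] by auto
  have least: "(f ^^ i) b \<noteq> a" if "0 < i" "i < m" for i
    using funpow_dist1_least[of i f b a] that unfolding m_def by blast
  have nb: "(f ^^ i) b \<noteq> b" if "0 < i" "i \<le> m" for i
  proof
    assume eq: "(f ^^ i) b = b"
    have "(f ^^ m) b = (f ^^ (m - i)) ((f ^^ i) b)"
      using that by (metis comp_apply funpow_add le_add_diff_inverse2)
    hence "(f ^^ (m - i)) b = a" using eq m by simp
    moreover have "i \<noteq> m" using eq m ab(3) by auto
    ultimately show False using least[of "m - i"] that by auto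
  qed
  let ?A = "{(f ^^ i) b | i. 0 < i \<and> i \<le> m}"
  have sub: "orbit ?g a \<subseteq> ?A"
  proof (rule orbit_subset_closed)
    show "a \<in> ?A" using m by force
    fix y assume "y \<in> ?A"
    then obtain i where i: "y = (f ^^ i) b" "0 < i" "i \<le> m" by auto
    show "?g y \<in> ?A"
    proof (cases "i = m")
      case True
      hence "?g y = (f ^^ 1) b" using i m by simp
      thus ?thesis using m by force
    next
      case False
      hence "?g y = (f ^^ Suc i) b" using i nb[of i] least[of i] by (simp add: transpose_def)
      moreover have "Suc i \<le> m" using i False by simp
      ultimately show ?thesis by blast
    qed
  qed
  show nb': "b \<notin> orbit ?g a"
  proof
    assume "b \<in> orbit ?g a"
    with sub have "b \<in> ?A" by (rule subsetD)
    then obtain i where "b = (f ^^ i) b" "0 < i" "i \<le> m" by blast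
    thus False using nb[of i] by simp
  qed
  have "?g \<circ> transpose a b = f" by (simp add: comp_assoc)
  thus "card (orbit ?g ` D) = Suc (card (orbit f ` D))"
    using card_orbits_merge[OF D(1) g ab(1) bD nb'] by simp
qed

section \<open>Matchings as fixed-point-free involutions\<close>

definition matching_on :: "'a set \<Rightarrow> ('a \<Rightarrow> 'a) \<Rightarrow> bool" where
  "matching_on A f \<longleftrightarrow> f permutes A \<and> (\<forall>x\<in>A. f x \<noteq> x \<and> f (f x) = x)"

lemma matching_onD:
  assumes "matching_on A f"
  shows "f permutes A" "f (f x) = x" "x \<in> A \<Longrightarrow> f x \<noteq> x" "f x \<in> A \<longleftrightarrow> x \<in> A" "x \<notin> A \<Longrightarrow> f x = x"
  using assms by (auto simp: matching_on_def permutes_in_image permutes_not_in)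

lemma matching_onI:
  assumes "\<And>x. x \<in> A \<Longrightarrow> f x \<in> A" "\<And>x. x \<in> A \<Longrightarrow> f x \<noteq> x" "\<And>x. x \<in> A \<Longrightarrow> f (f x) = x"
    "\<And>x. x \<notin> A \<Longrightarrow> f x = x"
  shows "matching_on A f"
proof -
  have "f permutes A" unfolding permutes_def
  proof (intro conjI allI impI)
    fix y show "\<exists>!x. f x = y" by (metis assms(1,3,4))
  qed (use assms in auto)
  thus ?thesis using assms by (auto simp: matching_on_def)
qed

lemma matching_on_restrict:
  assumes "matching_on A f" "B \<subseteq> A" "\<And>x. x \<in> B \<Longrightarrow> f x \<in> B"
  shows "matching_on B (perm_restrict f B)"
  by (rule matching_onI) (use assms matching_onD[OF assms(1)] in \<open>auto simp: perm_restrict_def\<close>)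

lemma even_card_matching:
  assumes "finite A" "matching_on A f" shows "even (card A)"
  using assms
proof (induction "card A" arbitrary: A f rule: less_induct)
  case less
  note M = matching_onD[OF less(3)]
  show ?case
  proof (cases "A = {}")
    case False
    then obtain a where a: "a \<in> A" by auto
    let ?B = "A - {a, f a}"
    have s: "{a, f a} \<subseteq> A" "f a \<noteq> a" using a M by auto
    hence c: "card ?B = card A - 2" "card A \<ge> 2"
      using less(2) card_mono[of A "{a, f a}"] by (auto simp: card_Diff_subset)
    have "matching_on ?B (perm_restrict f ?B)"
      by (rule matching_on_restrict[OF less(3)]) (use M(2)[of a] M(2) M(4) a in \<open>auto, metis\<close>)
    hence "even (card ?B)" using less(1)[of ?B] c less(2) by auto
    thus ?thesis using c by presburger
  qed simp
qed

text \<open>Adding one chord is multiplication by one transposition; this lets orbit counts be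
  computed chord by chord.\<close>

lemma perm_restrict_insert_pair:
  assumes "matching_on A f" "a \<in> A" "a \<notin> B" "\<And>x. x \<in> B \<Longrightarrow> f x \<in> B"
  shows "perm_restrict f (insert a (insert (f a) B)) = perm_restrict f B \<circ> transpose a (f a)"
proof
  note M = matching_onD[OF assms(1)]
  have "f a \<notin> B" using assms M by metis
  fix x show "perm_restrict f (insert a (insert (f a) B)) x = (perm_restrict f B \<circ> transpose a (f a)) x"
    using M assms \<open>f a \<notin> B\<close> by (auto simp: perm_restrict_def transpose_def)
qed

text \<open>Pairs are added in arbitrary order, and the start is any closed \<open>B\<close>, not
  only the empty set: this permits a prescribed subset of chords to be inserted first.\<close>

lemma matching_induct [consumes 5, case_names base step]:
  assumes "finite A" "matching_on E f" "A \<subseteq> E" "B \<subseteq> A" "\<And>x. x \<in> A \<Longrightarrow> f x \<in> A"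
    and "\<And>x. x \<in> B \<Longrightarrow> f x \<in> B" "P B"
    and "\<And>C a. B \<subseteq> C \<Longrightarrow> C \<subseteq> A \<Longrightarrow> (\<And>x. x \<in> C \<Longrightarrow> f x \<in> C) \<Longrightarrow> a \<in> A \<Longrightarrow> a \<notin> C \<Longrightarrow> f a \<notin> C \<Longrightarrow> f a \<noteq> a \<Longrightarrow> P C
       \<Longrightarrow> P (insert a (insert (f a) C))"
  shows "P A"
proof -
  note M = matching_onD[OF assms(2)]
  have "P A" if "P C" "B \<subseteq> C" "C \<subseteq> A" "\<And>x. x \<in> C \<Longrightarrow> f x \<in> C" for C
    using that
  proof (induction "card (A - C)" arbitrary: C rule: less_induct)
    case less
    note IH = less.hyps and PC = less.prems(1) and BC = less.prems(2) and CA = less.prems(3) and cl = less.prems(4)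
    show ?case
    proof (cases "C = A")
      case False
      then obtain a where a: "a \<in> A" "a \<notin> C" using CA by auto
      have fa: "f a \<notin> C" using a(2) cl[of "f a"] M(2)[of a] by auto
      have fa': "f a \<in> A" "f a \<noteq> a" using a(1) assms(3,5) M(3)[of a] by auto
      let ?C = "insert a (insert (f a) C)"
      have "P ?C" using assms(8)[OF BC CA cl a fa fa'(2) PC] .
      moreover have "card (A - ?C) < card (A - C)" using assms(1) a by (intro psubset_card_mono) auto
      moreover have "B \<subseteq> ?C" "?C \<subseteq> A" using BC CA a fa' by auto
      moreover have "f x \<in> ?C" if "x \<in> ?C" for x using that cl M(2)[of a] by auto
      ultimately show ?thesis using IH[of ?C] by blast
    qed (use PC in simp)
  qed
  thus ?thesis using assms(4,6,7) by blast
qed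

lemma permutes_comp_restrict:
  assumes "p permutes D" "matching_on E f" "E \<subseteq> D" "C \<subseteq> E" "\<And>x. x \<in> C \<Longrightarrow> f x \<in> C"
  shows "p \<circ> perm_restrict f C permutes D"
proof (rule permutes_compose[OF _ assms(1)])
  have "perm_restrict f C permutes C" using matching_onD(1)[OF matching_on_restrict[OF assms(2,4,5)]] .
  thus "perm_restrict f C permutes D" by (rule permutes_subset) (use assms in blast)
qed

text \<open>Each further chord changes the orbit count by exactly one, up or down. A chord has two
  points, hence the doubled count is compared with \<open>card (A - B)\<close>.\<close>

lemma card_orbits_restrict_le:
  assumes D: "finite D" "p permutes D" and f: "matching_on E f" "E \<subseteq> D"
    and BA: "A \<subseteq> E" "B \<subseteq> A" "\<And>x. x \<in> A \<Longrightarrow> f x \<in> A" "\<And>x. x \<in> B \<Longrightarrow> f x \<in> B"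
  defines "c \<equiv> \<lambda>B. card (orbit (p \<circ> perm_restrict f B) ` D)"
  shows "2 * c A \<le> 2 * c B + card (A - B)" "2 * c B \<le> 2 * c A + card (A - B)"
proof -
  note M = matching_onD[OF f(1)]
  have fin: "finite A" using D(1) f(2) BA(1) by (meson finite_subset)
  have "2 * c A \<le> 2 * c B + card (A - B) \<and> 2 * c B \<le> 2 * c A + card (A - B)"
  proof (rule matching_induct[OF fin f(1) BA, where P = "\<lambda>A. 2 * c A \<le> 2 * c B + card (A - B) \<and> 2 * c B \<le> 2 * c A + card (A - B)"])
    show "2 * c B \<le> 2 * c B + card (B - B) \<and> 2 * c B \<le> 2 * c B + card (B - B)" by simp
  next
    fix C a
    assume step: "B \<subseteq> C" "C \<subseteq> A" "\<And>x. x \<in> C \<Longrightarrow> f x \<in> C" "a \<in> A" "a \<notin> C" "f a \<notin> C" "f a \<noteq> a"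
      "2 * c C \<le> 2 * c B + card (C - B) \<and> 2 * c B \<le> 2 * c C + card (C - B)"
    let ?C = "insert a (insert (f a) C)" and ?q = "p \<circ> perm_restrict f C"
    have CE: "C \<subseteq> E" "a \<in> E" using step(2,4) BA(1) by auto
    have q: "?q permutes D" by (rule permutes_comp_restrict[OF D(2) f CE(1) step(3)])
    have r: "p \<circ> perm_restrict f ?C = ?q \<circ> transpose a (f a)"
      using perm_restrict_insert_pair[OF f(1) CE(2) step(5,3)] by (simp add: comp_assoc)
    have aD: "a \<in> D" "f a \<in> D" using CE f M by auto
    have "c ?C = Suc (c C) \<or> c C = Suc (c ?C)"
    proof (cases "f a \<in> orbit ?q a")
      case True
      thus ?thesis using card_orbits_split[OF D(1) q aD(1) True] step unfolding c_def r by auto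
    next
      case False
      thus ?thesis using card_orbits_merge[OF D(1) q aD False] unfolding c_def r by auto
    qed
    moreover have "?C - B = insert a (insert (f a) (C - B))" using step by auto
    moreover have "finite (C - B)" using finite_subset[OF step(2) fin] by simp
    ultimately show "2 * c ?C \<le> 2 * c B + card (?C - B) \<and> 2 * c B \<le> 2 * c ?C + card (?C - B)" using step by auto
  qed
  thus "2 * c A \<le> 2 * c B + card (A - B)" "2 * c B \<le> 2 * c A + card (A - B)" by (rule conjunct1, rule conjunct2)
qed

text \<open>For an involution every crossing is covered by taking \<open>x\<close> and
  \<open>y\<close> as the left ends of the two chords. That the four ends alternate does not depend
  on where the circle is cut.\<close>

definition noncrossing :: "('a::linorder \<Rightarrow> 'a) \<Rightarrow> bool" where
  "noncrossing f \<longleftrightarrow> (\<forall>x y. x < y \<longrightarrow> y < f x \<longrightarrow> f x < f y \<longrightarrow> False)"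

definition rotation :: "nat \<Rightarrow> nat \<Rightarrow> nat" where
  "rotation K x = (if x < K then Suc x mod K else x)"

lemma rotation_simps:
  "Suc x < K \<Longrightarrow> rotation K x = Suc x" "Suc x = K \<Longrightarrow> rotation K x = 0" "x \<ge> K \<Longrightarrow> rotation K x = x"
  by (auto simp: rotation_def)

lemma rotation_permutes: "rotation K permutes {..<K}"
proof -
  have "bij_betw (rotation K) {..<K} {..<K}"
  proof (rule bij_betw_byWitness[where f' = "\<lambda>x. if x = 0 then K - 1 else x - 1"])
  qed (auto simp: rotation_def mod_Suc split: if_splits)
  thus ?thesis by (rule bij_imp_permutes) (simp add: rotation_def)
qed

lemma funpow_rotation: "x < K \<Longrightarrow> (rotation K ^^ i) x = (x + i) mod K"
  by (induct i) (auto simp: rotation_def mod_Suc_eq)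

lemma orbit_rotation: "x < K \<Longrightarrow> orbit (rotation K) x = {..<K}"
proof
  assume x: "x < K"
  show "orbit (rotation K) x \<subseteq> {..<K}" using permutes_orbit_subset[OF rotation_permutes] x by blast
  show "{..<K} \<subseteq> orbit (rotation K) x"
  proof
    fix y assume y: "y \<in> {..<K}"
    have "(rotation K ^^ (y + K - x)) x = y" using x y by (simp add: funpow_rotation)
    thus "y \<in> orbit (rotation K) x" using x y unfolding orbit_altdef by (intro CollectI exI[of _ "y + K - x"]) auto
  qed
qed

lemma card_orbits_rotation: "K > 0 \<Longrightarrow> card (orbit (rotation K) ` {..<K}) = 1"
proof -
  assume "K > 0"
  hence "orbit (rotation K) ` {..<K} = {{..<K}}" using orbit_rotation by auto
  thus ?thesis by simp
qed

text \<open>This is genus zero: the orbits are the regions of the disc, and c noncrossing chords cut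
  it into c + 1 of them. A shortest chord encloses no other point, so before its insertion the
  permutation walks from one end straight to the other, and the insertion splits that orbit.\<close>

lemma noncrossing_card_orbits:
  assumes f: "matching_on A f" "A \<subseteq> {..<K}" "K > 0" "noncrossing f"
  shows "2 * card (orbit (rotation K \<circ> f) ` {..<K}) = 2 + card A"
  using f(1,2,4)
proof (induction "card A" arbitrary: A f rule: less_induct)
  case less
  note M = matching_onD[OF less(2)]
  have fin: "finite A" using less finite_subset by blast
  show ?case
  proof (cases "A = {}")
    case True
    hence "f = id" using M(5) by (auto simp: fun_eq_iff)
    thus ?thesis using True card_orbits_rotation[OF f(3)] by simp
  next
    case False
    have "{x \<in> A. x < f x} \<noteq> {}"
    proof -
      obtain a where "a \<in> A" using False by auto
      hence "a < f a \<or> f a < f (f a)" "f a \<in> A" using M(2)[of a] M(3)[of a] M(4)[of a] by auto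
      thus ?thesis using \<open>a \<in> A\<close> by blast
    qed
    then obtain a where a: "a \<in> A" "a < f a" and amin: "\<And>x. x \<in> A \<Longrightarrow> x < f x \<Longrightarrow> f a - a \<le> f x - x"
      using ex_has_least_nat[of "\<lambda>x. x \<in> A \<and> x < f x" _ "\<lambda>x. f x - x"] by (auto) blast
    \<comment> \<open>The chord of an enclosed point cannot leave the interval without crossing, so
      it would be shorter than the chosen one.\<close>
    have inner: "x \<notin> A" if "a < x" "x < f a" for x
    proof
      assume x: "x \<in> A"
      have nc: "\<not> (u < v \<and> v < f u \<and> f u < f v)" for u v using less(4) unfolding noncrossing_def by blast
      have "f x \<noteq> a" "f x \<noteq> f a" "f x \<noteq> x" using M(2)[of a] M(2)[of x] M(3)[of x] that x by auto
      moreover have "\<not> f a < f x" using nc[of a x] that by auto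
      moreover have "\<not> f x < a" using nc[of "f x" a] M(2) that by auto
      ultimately have fx: "a < f x" "f x < f a" "f x \<in> A" using M(4)[of x] x by auto
      show False using amin[of x] amin[of "f x"] fx that x M(2)[of x] \<open>f x \<noteq> x\<close> by (cases "x < f x") auto
    qed
    let ?B = "A - {a, f a}"
    let ?g = "perm_restrict f ?B" and ?r = "rotation K"
    have fa: "f a \<in> A" "f a \<noteq> a" using M a by auto
    have cl: "f x \<in> ?B" if "x \<in> ?B" for x using that M(2)[of x] M(2)[of a] M(4)[of x] by auto
    have g: "matching_on ?B ?g" using matching_on_restrict[OF less(2), of ?B] cl by auto
        have c: "card A = Suc (Suc (card ?B))"
    proof -
      have "A = insert a (insert (f a) ?B)" using fa a by auto
      also have "card \<dots> = Suc (Suc (card ?B))" using fa(2) fin by (subst card_insert_disjoint; simp)+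
      finally show ?thesis .
    qed
    have "noncrossing ?g"
      unfolding noncrossing_def
    proof (intro allI impI)
      fix x y assume H: "x < y" "y < ?g x" "?g x < ?g y"
      hence "x \<in> ?B" by (auto simp: perm_restrict_def split: if_splits)
      moreover have "y \<in> ?B"
      proof (rule ccontr)
        assume "y \<notin> ?B" hence "?g y = y" unfolding perm_restrict_def by argo
        thus False using H by auto
      qed
      ultimately show False using H less(4) unfolding noncrossing_def perm_restrict_def by auto
    qed
    hence IH: "2 * card (orbit (?r \<circ> ?g) ` {..<K}) = 2 + card ?B"
      using less(1)[of ?B ?g] g less(3) c by auto
    have feq: "f = ?g \<circ> transpose a (f a)"
    proof -
      have "insert a (insert (f a) ?B) = A" using fa a by auto
      moreover have "perm_restrict f A = f" using M(1) by simp
      moreover have "perm_restrict f (insert a (insert (f a) ?B)) = ?g \<circ> transpose a (f a)"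
        by (rule perm_restrict_insert_pair[OF less(2) a(1)]) (use cl in auto)
      ultimately show ?thesis by metis
    qed
    have q: "?r \<circ> ?g permutes {..<K}"
      by (rule permutes_compose[OF permutes_subset[OF matching_onD(1)[OF g]] rotation_permutes]) (use less(3) in blast)
    have aK: "a < K" "f a < K" using a fa less by auto
    \<comment> \<open>Neither \<open>a\<close> nor the points before \<open>f a\<close> belong to
      \<open>?B\<close>, so the permutation acts on them as \<open>rotation K\<close>.\<close>
    have "i \<le> f a - a \<Longrightarrow> ((?r \<circ> ?g) ^^ i) a = a + i" for i
    proof (induct i)
      case (Suc i)
      hence "a + i \<notin> ?B" using inner[of "a + i"] by (cases i) auto
      hence "?g (a + i) = a + i" unfolding perm_restrict_def by argo
      moreover have "Suc (a + i) < K" using Suc aK by auto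
      ultimately show ?case using Suc by (simp add: rotation_simps)
    qed simp
    from this[of "f a - a"] have fp: "((?r \<circ> ?g) ^^ (f a - a)) a = f a" "0 < f a - a" using a by simp_all
    have "f a \<in> orbit (?r \<circ> ?g) a" unfolding orbit_altdef
      by (intro CollectI exI[of _ "f a - a"] conjI) (rule fp(1)[symmetric], rule fp(2))
    note s = card_orbits_split[OF finite_lessThan q _ this]
    have "?r \<circ> ?g \<circ> transpose a (f a) = ?r \<circ> f" by (simp only: feq[symmetric] comp_assoc)
    hence "card (orbit (?r \<circ> f) ` {..<K}) = Suc (card (orbit (?r \<circ> ?g) ` {..<K}))"
      using s aK(1) a(2) by simp
    thus ?thesis using IH c by linarith
  qed
qed

text \<open>The stated count is the maximum and is reached only if every insertion splits, in any
  order. Insert two crossing chords first: one splits and the other merges, so the count is back at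
  1, and the remaining chords can add at most one each.\<close>

lemma noncrossing_if_card_orbits:
  assumes f: "matching_on A f" "A \<subseteq> {..<K}"
    and c: "2 * card (orbit (rotation K \<circ> f) ` {..<K}) = 2 + card A"
  shows "noncrossing f"
  unfolding noncrossing_def
proof (intro allI impI)
  fix x y assume H: "x < y" "y < f x" "f x < f y"
  note M = matching_onD[OF f(1)]
  let ?r = "rotation K"
  have A: "x \<in> A" "y \<in> A" using H M(5)[of x] M(5)[of y] by auto
  hence A': "f x \<in> A" "f y \<in> A" using M(4) by auto
  have K: "x < K" "y < K" "f x < K" "f y < K" using A A' f(2) by auto
  let ?B1 = "{x, f x}" and ?B2 = "{y, f y, x, f x}"
  have fin: "finite A" using f finite_subset by blast
  have e: "perm_restrict f ?B1 = transpose x (f x)"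
    using M(2) by (auto simp: perm_restrict_def transpose_def fun_eq_iff)
  have e2: "perm_restrict f ?B2 = transpose x (f x) \<circ> transpose y (f y)"
    using perm_restrict_insert_pair[OF f(1) A(2), of ?B1] H M(2) e by auto
  have c1: "card (orbit (?r \<circ> transpose x (f x)) ` {..<K}) = 2"
    using card_orbits_split[OF _ rotation_permutes[of K], of x "f x"] orbit_rotation[of x K] K H
      card_orbits_rotation[of K] by auto
  let ?q = "?r \<circ> transpose x (f x)"
  have q: "?q permutes {..<K}" using K by (intro permutes_compose permutes_swap_id rotation_permutes) auto
  \<comment> \<open>The first chord short-circuits the interval behind \<open>x\<close>: from
    \<open>f x\<close> the permutation returns to \<open>x + 1\<close>. Hence \<open>f y\<close>,
    beyond \<open>f x\<close>, lies on another orbit than \<open>y\<close>.\<close>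
  have "orbit ?q y \<subseteq> {x<..f x}"
  proof (rule orbit_subset_closed)
    fix z assume z: "z \<in> {x<..f x}"
    show "?q z \<in> {x<..f x}"
    proof (cases "z = f x")
      case True
      thus ?thesis using H K by (simp add: rotation_simps)
    next
      case False
      hence "?q z = Suc z" using z K by (simp add: rotation_simps transpose_def)
      thus ?thesis using z False by auto
    qed
  qed (use H in auto)
  hence ny: "f y \<notin> orbit ?q y" using H by auto
  have c2: "card (orbit (?r \<circ> perm_restrict f ?B2) ` {..<K}) = 1"
    using card_orbits_merge[OF _ q _ _ ny] K c1 e2 by (simp add: comp_assoc)
  have "2 * card (orbit (?r \<circ> perm_restrict f A) ` {..<K})
     \<le> 2 * card (orbit (?r \<circ> perm_restrict f ?B2) ` {..<K}) + card (A - ?B2)"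
    by (rule card_orbits_restrict_le(1)[OF _ rotation_permutes f]) (use A A' M(2,4) in auto)
  hence "2 * card (orbit (?r \<circ> f) ` {..<K}) \<le> 2 + card (A - ?B2)" unfolding c2 perm_restrict_id[OF M(1)] by simp
  moreover have "card (A - ?B2) + 4 = card A"
  proof -
    have "f y \<noteq> x" using H by auto
    hence "card ?B2 = 4" using H by auto
    moreover have "?B2 \<subseteq> A" using A A' by auto
    hence "card ?B2 \<le> card A" "card (A - ?B2) = card A - card ?B2"
      by (rule card_mono[OF fin], intro card_Diff_subset) auto
    ultimately show ?thesis by linarith
  qed
  ultimately show False using c by linarith
qed

section \<open>Spanning trees of rotation systems\<close>

lemma matching_opp: "is_cmap M \<Longrightarrow> matching_on (darts M) (opp M)"
  by (auto simp: is_cmap_def matching_on_def)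

lemma orbit_involution:
  assumes "f (f x) = x" shows "orbit f x = {x, f x}"
proof
  show "orbit f x \<subseteq> {x, f x}" by (rule orbit_subset_closed) (use assms in auto)
  have "f x \<in> orbit f x" by (rule orbit.base)
  moreover from orbit.step[OF this] have "x \<in> orbit f x" using assms by simp
  ultimately show "{x, f x} \<subseteq> orbit f x" by simp
qed

lemma orbits_disjoint:
  assumes "finite D" "f permutes D" "orbit f x \<noteq> orbit f y" shows "orbit f x \<inter> orbit f y = {}"
proof (rule ccontr)
  assume "orbit f x \<inter> orbit f y \<noteq> {}"
  then obtain z where "z \<in> orbit f x" "z \<in> orbit f y" by auto
  thus False using orbit_eq_if_in[OF assms(1,2)] assms(3) by metis
qed

lemma Union_orbits: "finite D \<Longrightarrow> f permutes D \<Longrightarrow> \<Union>(orbit f ` D) = D"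
  using orbit_permutes_self[of D f] permutes_orbit_subset[of f D] by blast

lemma card_orbits_mult:
  assumes "finite D" "f permutes D" "\<And>x. x \<in> D \<Longrightarrow> card (orbit f x) = k"
  shows "k * card (orbit f ` D) = card D"
proof -
  have "k * card (orbit f ` D) = card (\<Union>(orbit f ` D))"
    proof (rule card_partition)
    fix X Y assume "X \<in> orbit f ` D" "Y \<in> orbit f ` D" "X \<noteq> Y"
    thus "X \<inter> Y = {}" using orbits_disjoint[OF assms(1,2)] by blast
  qed (use assms Union_orbits[OF assms(1,2)] in auto)
  thus ?thesis using Union_orbits[OF assms(1,2)] by simp
qed

text \<open>Parametrised by darts instead of edges, so that the arcs are exactly the set on which
  \<open>opp\<close> is restricted.\<close>

definition dart_graph :: "'d cmap \<Rightarrow> 'd set \<Rightarrow> ('d set, 'd) pre_digraph" where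
  "dart_graph M A = \<lparr> verts = vertices M, arcs = A,
       tail = (\<lambda>d. orbit (rot M) d), head = (\<lambda>d. orbit (rot M) (opp M d)) \<rparr>"

lemma edge_subgraph_eq: "edge_subgraph M T = dart_graph M (\<Union>T)"
  by (simp add: edge_subgraph_def dart_graph_def)

lemma dart_graph_simps [simp]:
  "verts (dart_graph M A) = vertices M" "arcs (dart_graph M A) = A"
  "tail (dart_graph M A) = orbit (rot M)" "head (dart_graph M A) d = orbit (rot M) (opp M d)"
  by (simp_all add: dart_graph_def)

locale rotation_system =
  fixes M :: "'d cmap"
  assumes cmap: "is_cmap M"
begin

abbreviation "D \<equiv> darts M"
abbreviation "\<sigma> \<equiv> rot M"
abbreviation "\<alpha> \<equiv> opp M"
text \<open>Interpolates between vertices (\<open>A\<close> empty) and faces (\<open>A\<close> all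
  darts): it crosses the edge before turning on darts of \<open>A\<close> and only turns elsewhere.
  For a spanning tree its single orbit is the contour.\<close>

abbreviation "face_perm A \<equiv> \<sigma> \<circ> perm_restrict \<alpha> A"

lemma finD: "finite D" and rot_perm: "\<sigma> permutes D" and opp_perm: "\<alpha> permutes D"
  using cmap by (auto simp: is_cmap_def)

lemmas opp = matching_onD[OF matching_opp[OF cmap]]

definition opp_closed :: "'d set \<Rightarrow> bool" where
  "opp_closed A \<longleftrightarrow> A \<subseteq> D \<and> (\<forall>d\<in>A. \<alpha> d \<in> A)"

lemma face_perm: "opp_closed A \<Longrightarrow> face_perm A permutes D"
  unfolding opp_closed_def by (rule permutes_comp_restrict[OF rot_perm matching_opp[OF cmap]]) auto

lemma face_perm_empty: "face_perm {} = \<sigma>"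
  by (auto simp: perm_restrict_def)

lemma wf_dart_graph: "opp_closed A \<Longrightarrow> wf_digraph (dart_graph M A)"
  by unfold_locales (auto simp: opp_closed_def vertices_def)

lemma symmetric_dart_graph: "opp_closed A \<Longrightarrow> symmetric (dart_graph M A)"
proof -
  assume A: "opp_closed A"
  interpret wf_digraph "dart_graph M A" by (rule wf_dart_graph[OF A])
  show ?thesis unfolding symmetric_conv
  proof
    fix d assume "d \<in> arcs (dart_graph M A)"
    thus "\<exists>e\<in>arcs (dart_graph M A). tail (dart_graph M A) d = head (dart_graph M A) e
        \<and> head (dart_graph M A) d = tail (dart_graph M A) e"
      using A opp(2) by (intro bexI[of _ "\<alpha> d"]) (auto simp: opp_closed_def)
  qed
qed

lemma connected_dart_graph:
  assumes A: "opp_closed A"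
  shows "Digraph_Component.connected (dart_graph M A) \<longleftrightarrow>
    vertices M \<noteq> {} \<and> (\<forall>u\<in>vertices M. \<forall>v\<in>vertices M. reachable (dart_graph M A) u v)"
proof -
  interpret wf_digraph "dart_graph M A" by (rule wf_dart_graph[OF A])
  show ?thesis unfolding connected_def strongly_connected_def
    by (simp add: reachable_mk_symmetric_eq[OF symmetric_dart_graph[OF A]])
qed

lemma dominates_dart_graph: "d \<in> A \<Longrightarrow> (orbit \<sigma> d, orbit \<sigma> (\<alpha> d)) \<in> arcs_ends (dart_graph M A)"
  unfolding arcs_ends_conv by force

text \<open>Each step of \<open>face_perm A\<close> stays at a vertex or crosses an edge of
  \<open>A\<close>, so an orbit traces a walk of the subgraph.\<close>

lemma reachable_if_face_orbit:
  assumes A: "opp_closed A" and d: "d \<in> D" "e \<in> orbit (face_perm A) d"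
  shows "reachable (dart_graph M A) (orbit \<sigma> d) (orbit \<sigma> e)"
proof -
  interpret wf_digraph "dart_graph M A" by (rule wf_dart_graph[OF A])
  have step: "reachable (dart_graph M A) (orbit \<sigma> e) (orbit \<sigma> (face_perm A e))" if "e \<in> D" for e
  proof -
    have "perm_restrict \<alpha> A e \<in> D" using that opp by (auto simp: perm_restrict_def)
    hence "orbit \<sigma> (face_perm A e) = orbit \<sigma> (perm_restrict \<alpha> A e)"
      using orbit_eq_if_in[OF finD rot_perm orbit.base[of \<sigma> "perm_restrict \<alpha> A e"]] by simp
    thus ?thesis using that dominates_dart_graph[of e A]
      by (cases "e \<in> A") (auto simp: perm_restrict_def vertices_def)
  qed
  have "e \<in> D \<and> reachable (dart_graph M A) (orbit \<sigma> d) (orbit \<sigma> e)"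
    using d(2)
  proof induct
    case base
    show ?case using step[OF d(1)] d(1) permutes_in_image[OF face_perm[OF A]] by simp
  next
    case (step e)
    show ?case using \<open>e \<in> D \<and> _\<close> \<open>\<And>e. e \<in> D \<Longrightarrow> _\<close>[of e] permutes_in_image[OF face_perm[OF A], of e] reachable_trans by blast
  qed
  thus ?thesis by blast
qed

lemma reachable_closed:
  assumes A: "opp_closed A" and r: "reachable (dart_graph M A) u v"
    and X: "\<And>x. x \<in> X \<Longrightarrow> \<sigma> x \<in> X" "\<And>x. x \<in> X \<Longrightarrow> x \<in> A \<Longrightarrow> \<alpha> x \<in> X" and u: "u \<subseteq> X"
  shows "v \<subseteq> X"
proof -
  interpret wf_digraph "dart_graph M A" by (rule wf_dart_graph[OF A])
  show ?thesis using r
  proof (induct rule: reachable_induct)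
    case (step x y)
    then obtain d where d: "d \<in> A" "x = orbit \<sigma> d" "y = orbit \<sigma> (\<alpha> d)" by (auto simp: arcs_ends_conv)
    hence "d \<in> X" using step orbit_permutes_self[OF finD rot_perm] by blast
    hence "\<alpha> d \<in> X" using X d by blast
    thus ?case using d X(1) orbit_subset_closed[of "\<alpha> d" X \<sigma>] by blast
  qed (use u in simp)
qed

lemma opp_closed_insert: "opp_closed A \<Longrightarrow> a \<in> D \<Longrightarrow> opp_closed (insert a (insert (\<alpha> a) A))"
  using opp by (auto simp: opp_closed_def)

lemma face_perm_insert:
  assumes "opp_closed A" "a \<in> D" "a \<notin> A"
  shows "face_perm (insert a (insert (\<alpha> a) A)) = face_perm A \<circ> transpose a (\<alpha> a)"
  using perm_restrict_insert_pair[OF matching_opp[OF cmap] assms(2,3)] assms(1)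
  by (auto simp: opp_closed_def comp_assoc)

text \<open>The signature of a forest: both sides of an edge lie on the same contour. It is the
  invariant that makes contours coincide with components.\<close>

definition orbits_opp_closed :: "'d set \<Rightarrow> bool" where
  "orbits_opp_closed A \<longleftrightarrow> (\<forall>x\<in>A. \<alpha> x \<in> orbit (face_perm A) x)"

text \<open>A merge only enlarges orbits, so earlier edges keep their two darts together, and the
  new edge has both darts in the merged orbit.\<close>

lemma orbits_opp_closed_step:
  assumes A: "opp_closed A" "orbits_opp_closed A" and a: "a \<in> D" "a \<notin> A" "\<alpha> a \<notin> orbit (face_perm A) a"
  shows "orbits_opp_closed (insert a (insert (\<alpha> a) A))"
  unfolding orbits_opp_closed_def face_perm_insert[OF A(1) a(1,2)]
proof
  let ?p = "face_perm A" and ?q = "face_perm A \<circ> transpose a (\<alpha> a)"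
  have aD: "\<alpha> a \<in> D" using a opp by auto
  have p: "?p permutes D" by (rule face_perm[OF A(1)])
  have q: "?q permutes D" using face_perm[OF opp_closed_insert[OF A(1) a(1)]] face_perm_insert[OF A(1) a(1,2)] by simp
  note self = orbit_permutes_self[OF finD p]
  note m = orbit_merge[OF finD p a(1) aD a(3)] orbit_merge_other[OF finD p a(1) aD a(3)]
  have in_q: "y \<in> orbit ?q x" if "y \<in> orbit ?p x" for x y
  proof (cases "x \<in> orbit ?p a \<union> orbit ?p (\<alpha> a)")
    case True
    hence "y \<in> orbit ?q a" using that m(1) orbit_eq_if_in[OF finD p] by blast
    moreover have "orbit ?q x = orbit ?q a" using True m(1) orbit_eq_if_in[OF finD q] by blast
    ultimately show ?thesis by simp
  next
    case False
    thus ?thesis using m(2) that by simp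
  qed
  fix x assume "x \<in> insert a (insert (\<alpha> a) A)"
  then consider "x = a" | "x = \<alpha> a" | "x \<in> A" by auto
  thus "\<alpha> x \<in> orbit ?q x"
  proof cases
    case 1 thus ?thesis using m(1) self by auto
  next
    case 2
    have "\<alpha> a \<in> orbit ?q a" using m(1) self by auto
    hence "orbit ?q (\<alpha> a) = orbit ?q a" by (rule orbit_eq_if_in[OF finD q])
    moreover have "a \<in> orbit ?q a" using m(1) self by auto
    ultimately show ?thesis using 2 opp(2) by simp
  next
    case 3
    thus ?thesis using A(2) in_q unfolding orbits_opp_closed_def by blast
  qed
qed

text \<open>For \<open>y\<close> in \<open>A\<close>, the orbit contains \<open>\<alpha> y\<close>,
  and \<open>face_perm A\<close> sends that dart to \<open>\<sigma> y\<close>. Thus the orbit is a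
  union of vertices that no edge of \<open>A\<close> leaves, which confines everything reachable
  from it.\<close>

lemma orbit_opp_closedD:
  assumes A: "opp_closed A" "orbits_opp_closed A" and y: "y \<in> orbit (face_perm A) x" "x \<in> D"
  shows "\<sigma> y \<in> orbit (face_perm A) x" "y \<in> A \<Longrightarrow> \<alpha> y \<in> orbit (face_perm A) x"
proof -
  note p = face_perm[OF A(1)]
  note eq = orbit_eq_if_in[OF finD p]
  have 1: "\<alpha> y \<in> orbit (face_perm A) x" if "y \<in> A" "y \<in> orbit (face_perm A) x" for y
    using that A(2) eq[of y x] unfolding orbits_opp_closed_def by auto
  show "y \<in> A \<Longrightarrow> \<alpha> y \<in> orbit (face_perm A) x" using 1 y(1) by blast
  show "\<sigma> y \<in> orbit (face_perm A) x"
  proof (cases "y \<in> A")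
    case True
    hence "\<alpha> y \<in> orbit (face_perm A) x" using 1 y by blast
    from orbit.step[OF this] show ?thesis using True A(1) opp(2) by (simp add: perm_restrict_def opp_closed_def)
  next
    case False
    thus ?thesis using orbit.step[OF y(1)] by (simp add: perm_restrict_def)
  qed
qed

text \<open>If the first edge occurred again, in either direction, the rest of the path would
  revisit the starting vertex.\<close>

lemma apath_distinct_edges:
  assumes A: "opp_closed A" and p: "pre_digraph.apath (dart_graph M A) u p v"
  shows "distinct (map (orbit \<alpha>) p)"
proof -
  interpret wf_digraph "dart_graph M A" by (rule wf_dart_graph[OF A])
  show ?thesis using p
  proof (induct p arbitrary: u)
    case (Cons d q)
    have d: "apath (orbit \<sigma> (\<alpha> d)) q v" "u = orbit \<sigma> d" "u \<notin> set (awalk_verts (orbit \<sigma> (\<alpha> d)) q)"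
      using Cons(2) by (auto simp: apath_Cons_iff)
    have "orbit \<alpha> d \<noteq> orbit \<alpha> e" if e: "e \<in> set q" for e
    proof
      assume "orbit \<alpha> d = orbit \<alpha> e"
      hence "{d, \<alpha> d} = {e, \<alpha> e}" using orbit_involution opp(2) by metis
      hence "e = d \<or> \<alpha> e = d" by (auto simp: doubleton_eq_iff)
      moreover have "orbit \<sigma> e \<in> set (awalk_verts (orbit \<sigma> (\<alpha> d)) q)"
          "orbit \<sigma> (\<alpha> e) \<in> set (awalk_verts (orbit \<sigma> (\<alpha> d)) q)"
        using set_awalk_verts[of "orbit \<sigma> (\<alpha> d)" q v] d(1) e by (auto simp: apath_def awalk_def)
      ultimately show False using d by auto
    qed
    thus ?case using Cons(1)[OF d(1)] by auto
  qed simp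
qed

lemma cas_dart_graph: "pre_digraph.cas (dart_graph M A) u p v \<longleftrightarrow> pre_digraph.cas (dart_graph M B) u p v"
  by (induct p arbitrary: u) (auto simp: pre_digraph.cas.simps)

lemma awalk_verts_dart_graph: "pre_digraph.awalk_verts (dart_graph M A) u p = pre_digraph.awalk_verts (dart_graph M B) u p"
  by (induct p arbitrary: u) (auto simp: pre_digraph.awalk_verts.simps)

text \<open>The walk inside \<open>C\<close> is shortened to a path and closed up by
  \<open>a\<close>. Its darts lie in \<open>C\<close>, hence none of them belongs to the edge of
  \<open>a\<close>.\<close>

lemma cycle_if_reachable:
  assumes A: "opp_closed A" and C: "opp_closed C" "C \<subseteq> A" and a: "a \<in> A" "a \<notin> C"
    and r: "reachable (dart_graph M C) (orbit \<sigma> (\<alpha> a)) (orbit \<sigma> a)"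
  shows "\<exists>p. pre_digraph.cycle (dart_graph M A) p \<and> distinct (map (orbit \<alpha>) p)"
proof -
  interpret C: wf_digraph "dart_graph M C" by (rule wf_dart_graph[OF C(1)])
  interpret A: wf_digraph "dart_graph M A" by (rule wf_dart_graph[OF A])
  obtain q where "C.awalk (orbit \<sigma> (\<alpha> a)) q (orbit \<sigma> a)" using r C.reachable_awalk by blast
  then obtain p where p: "C.apath (orbit \<sigma> (\<alpha> a)) p (orbit \<sigma> a)" using C.apath_awalk_to_apath by blast
  have pC: "set p \<subseteq> C" "C.cas (orbit \<sigma> (\<alpha> a)) p (orbit \<sigma> a)" "distinct (C.awalk_verts (orbit \<sigma> (\<alpha> a)) p)"
    using p by (auto simp: C.apath_def C.awalk_def)
  have aD: "a \<in> D" using a A by (auto simp: opp_closed_def)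
  have "A.cycle (a # p)"
    unfolding A.cycle_def
  proof (intro exI[of _ "orbit \<sigma> a"] conjI)
    show "A.awalk (orbit \<sigma> a) (a # p) (orbit \<sigma> a)"
      unfolding A.awalk_def using pC C(2) a aD cas_dart_graph[of C _ p _ A] by (auto simp: vertices_def)
    show "distinct (tl (A.awalk_verts (orbit \<sigma> a) (a # p)))"
      using pC(3) awalk_verts_dart_graph[of C _ p A] by simp
  qed simp
  moreover have "orbit \<alpha> a \<notin> orbit \<alpha> ` set p"
  proof
    assume "orbit \<alpha> a \<in> orbit \<alpha> ` set p"
    then obtain e where "e \<in> C" "orbit \<alpha> a = orbit \<alpha> e" using pC(1) by auto
    hence "{a, \<alpha> a} = {e, \<alpha> e}" using orbit_involution opp(2) by metis
    hence "a = e \<or> a = \<alpha> e" by (auto simp: doubleton_eq_iff)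
    thus False using \<open>e \<in> C\<close> C(1) a(2) by (auto simp: opp_closed_def)
  qed
  ultimately show ?thesis using apath_distinct_edges[OF C(1) p] by (intro exI[of _ "a # p"]) auto
qed

text \<open>Both sides express that every edge of \<open>A\<close> merges two contours. In a tree a
  splitting edge is impossible, as the contour joining its ends would close a cycle. Conversely the
  prescribed number of edges just suffices to reduce the vertices to one orbit, so no insertion
  order contains a split.\<close>

lemma spanning_tree_iff_aux:
  assumes A: "opp_closed A" and ne: "D \<noteq> {}"
  defines "acyc \<equiv> \<not> (\<exists>p. pre_digraph.cycle (dart_graph M A) p \<and> distinct (map (orbit \<alpha>) p))"
  shows "Digraph_Component.connected (dart_graph M A) \<and> acyc \<longleftrightarrow>
    card (orbit (face_perm A) ` D) = 1 \<and> card A + 2 = 2 * card (vertices M)"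
proof
  assume L: "Digraph_Component.connected (dart_graph M A) \<and> acyc"
  have AD: "A \<subseteq> D" "\<And>x. x \<in> A \<Longrightarrow> \<alpha> x \<in> A" using A by (auto simp: opp_closed_def)
  have finA: "finite A" using AD finD finite_subset by blast
  have AE: "\<And>x. x \<in> {} \<Longrightarrow> \<alpha> x \<in> {}" by simp
  have "orbits_opp_closed A \<and> 2 * card (orbit (face_perm A) ` D) + card A = 2 * card (vertices M)"
  proof (rule matching_induct[OF finA matching_opp[OF cmap] AD(1) empty_subsetI AD(2) AE,
      where P = "\<lambda>A. orbits_opp_closed A \<and> 2 * card (orbit (face_perm A) ` D) + card A = 2 * card (vertices M)"])
    show "orbits_opp_closed {} \<and> 2 * card (orbit (face_perm {}) ` D) + card ({} :: 'd set) = 2 * card (vertices M)"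
      unfolding face_perm_empty by (simp add: orbits_opp_closed_def vertices_def)
  next
    fix C a
    assume C: "C \<subseteq> A" "\<And>x. x \<in> C \<Longrightarrow> \<alpha> x \<in> C" "a \<in> A" "a \<notin> C" "\<alpha> a \<notin> C" "\<alpha> a \<noteq> a"
      and IH: "orbits_opp_closed C \<and> 2 * card (orbit (face_perm C) ` D) + card C = 2 * card (vertices M)"
    have cC: "opp_closed C" using C AD by (auto simp: opp_closed_def)
    have aD: "a \<in> D" "\<alpha> a \<in> D" using C AD by auto
    have no: "\<alpha> a \<notin> orbit (face_perm C) a"
    proof
      assume "\<alpha> a \<in> orbit (face_perm C) a"
      hence "a \<in> orbit (face_perm C) (\<alpha> a)"
        using orbit_eq_if_in[OF finD face_perm[OF cC]] orbit_permutes_self[OF finD face_perm[OF cC]] by metis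
      from cycle_if_reachable[OF A cC C(1,3,4) reachable_if_face_orbit[OF cC aD(2) this]]
      show False using L unfolding acyc_def by blast
    qed
    have "card (insert a (insert (\<alpha> a) C)) = card C + 2"
      using C finite_subset[OF C(1) finA] by simp
    thus "orbits_opp_closed (insert a (insert (\<alpha> a) C)) \<and>
       2 * card (orbit (face_perm (insert a (insert (\<alpha> a) C))) ` D) + card (insert a (insert (\<alpha> a) C)) = 2 * card (vertices M)"
      using orbits_opp_closed_step[OF cC _ aD(1) C(4) no] IH
        card_orbits_merge[OF finD face_perm[OF cC] aD no] face_perm_insert[OF cC aD(1) C(4)] by simp
  qed
  hence P: "orbits_opp_closed A" "2 * card (orbit (face_perm A) ` D) + card A = 2 * card (vertices M)" by auto
  obtain d where d: "d \<in> D" using ne by auto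
  have "x \<in> orbit (face_perm A) d" if x: "x \<in> D" for x
  proof -
    let ?X = "orbit (face_perm A) d"
    have "reachable (dart_graph M A) (orbit \<sigma> d) (orbit \<sigma> x)"
      using L d x connected_dart_graph[OF A] by (auto simp: vertices_def)
    hence "orbit \<sigma> x \<subseteq> ?X"
    proof (rule reachable_closed[OF A])
      show cl: "\<And>y. y \<in> ?X \<Longrightarrow> \<sigma> y \<in> ?X" "\<And>y. y \<in> ?X \<Longrightarrow> y \<in> A \<Longrightarrow> \<alpha> y \<in> ?X"
        using orbit_opp_closedD[OF A P(1) _ d] by blast+
      show "orbit \<sigma> d \<subseteq> ?X"
        by (rule orbit_subset_closed[OF orbit_permutes_self[OF finD face_perm[OF A]] cl(1)])
    qed
    thus ?thesis using orbit_permutes_self[OF finD rot_perm] by blast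
  qed
  hence "orbit (face_perm A) ` D = {orbit (face_perm A) d}"
    using d orbit_eq_if_in[OF finD face_perm[OF A]] by blast
  thus "card (orbit (face_perm A) ` D) = 1 \<and> card A + 2 = 2 * card (vertices M)" using P(2) by simp
next
  assume R: "card (orbit (face_perm A) ` D) = 1 \<and> card A + 2 = 2 * card (vertices M)"
  have AD: "A \<subseteq> D" "\<And>x. x \<in> A \<Longrightarrow> \<alpha> x \<in> A" using A by (auto simp: opp_closed_def)
  have finA: "finite A" using AD finD finite_subset by blast
  obtain X where X: "orbit (face_perm A) ` D = {X}" using R by (meson card_1_singletonE)
  have conn: "Digraph_Component.connected (dart_graph M A)"
    unfolding connected_dart_graph[OF A]
  proof (intro conjI ballI)
    show "vertices M \<noteq> {}" using ne by (auto simp: vertices_def)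
    fix u v assume "u \<in> vertices M" "v \<in> vertices M"
    then obtain x y where xy: "x \<in> D" "y \<in> D" "u = orbit \<sigma> x" "v = orbit \<sigma> y" by (auto simp: vertices_def)
    have "orbit (face_perm A) x = orbit (face_perm A) y" using xy(1,2) X by blast
    hence "y \<in> orbit (face_perm A) x" using orbit_permutes_self[OF finD face_perm[OF A]] by simp
    thus "reachable (dart_graph M A) u v" using reachable_if_face_orbit[OF A xy(1)] xy by simp
  qed
  \<comment> \<open>There are just enough tree edges to reach a single orbit, so in any order each of them merges two.\<close>
  have tight: "2 * card (orbit (face_perm C) ` D) + card C = 2 * card (vertices M)"
    if C: "opp_closed C" "C \<subseteq> A" for C
  proof -
    have cl: "\<And>x. x \<in> C \<Longrightarrow> \<alpha> x \<in> C" using C by (auto simp: opp_closed_def)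
    have "2 * card (orbit (face_perm C) ` D) \<le> 2 * card (orbit (face_perm A) ` D) + card (A - C)"
      by (rule card_orbits_restrict_le(2)[OF finD rot_perm matching_opp[OF cmap] subset_refl AD(1) C(2) AD(2) cl])
    moreover have "2 * card (orbit (face_perm {}) ` D) \<le> 2 * card (orbit (face_perm C) ` D) + card (C - {})"
      by (rule card_orbits_restrict_le(2)[OF finD rot_perm matching_opp[OF cmap] subset_refl _ empty_subsetI cl])
        (use C AD in auto)
    moreover have "card (A - C) = card A - card C" "card C \<le> card A"
      using card_Diff_subset[OF finite_subset[OF C(2) finA] C(2)] card_mono[OF finA C(2)] by auto
    ultimately show ?thesis using conjunct1[OF R] conjunct2[OF R] unfolding face_perm_empty vertices_def Diff_empty by linarith
  qed
  \<comment> \<open>An edge within one orbit would raise the orbit count, where \<open>tight\<close>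
    requires it to fall.\<close>
  have sep: "\<alpha> a \<notin> orbit (face_perm C) a"
    if C: "opp_closed C" "C \<subseteq> A" and a: "a \<in> A" "a \<notin> C" for C a
  proof
    assume in': "\<alpha> a \<in> orbit (face_perm C) a"
    have aD: "a \<in> D" "\<alpha> a \<noteq> a" using a AD opp(3) by auto
    have ac: "\<alpha> a \<notin> C" using C(1) a(2) opp(2)[of a] by (auto simp: opp_closed_def)
    let ?C = "insert a (insert (\<alpha> a) C)"
    have "card (orbit (face_perm ?C) ` D) = Suc (card (orbit (face_perm C) ` D))"
      using card_orbits_split[OF finD face_perm[OF C(1)] aD(1) in'] aD(2) face_perm_insert[OF C(1) aD(1) a(2)] by simp
    moreover have "card ?C = card C + 2" using finite_subset[OF C(2) finA] a(2) ac aD(2) by simp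
    moreover have "?C \<subseteq> A" using C(2) a AD by auto
    ultimately show False using tight[OF C] tight[OF opp_closed_insert[OF C(1) aD(1)]] by simp
  qed
  have oc: "orbits_opp_closed C" if C: "opp_closed C" "C \<subseteq> A" for C
  proof -
    have cl: "\<And>x. x \<in> C \<Longrightarrow> \<alpha> x \<in> C" and CD: "C \<subseteq> D" using C by (auto simp: opp_closed_def)
    have AE: "\<And>x. x \<in> {} \<Longrightarrow> \<alpha> x \<in> {}" by simp
    show ?thesis
    proof (rule matching_induct[OF finite_subset[OF C(2) finA] matching_opp[OF cmap] CD empty_subsetI cl AE,
        where P = orbits_opp_closed])
      show "orbits_opp_closed {}" by (simp add: orbits_opp_closed_def)
    next
      fix B a
      assume B: "B \<subseteq> C" "\<And>x. x \<in> B \<Longrightarrow> \<alpha> x \<in> B" "a \<in> C" "a \<notin> B" "orbits_opp_closed B"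
      have "opp_closed B" "B \<subseteq> A" "a \<in> A" "a \<in> D" using B C CD by (auto simp: opp_closed_def)
      thus "orbits_opp_closed (insert a (insert (\<alpha> a) B))"
        using orbits_opp_closed_step B sep by blast
    qed
  qed
  have acyc
    unfolding acyc_def
  proof
    assume "\<exists>p. pre_digraph.cycle (dart_graph M A) p \<and> distinct (map (orbit \<alpha>) p)"
    then obtain p where p: "pre_digraph.cycle (dart_graph M A) p" "distinct (map (orbit \<alpha>) p)" by blast
    interpret A: wf_digraph "dart_graph M A" by (rule wf_dart_graph[OF A])
    obtain u where u: "A.awalk u p u" "p \<noteq> []" using p(1) A.cycle_def by blast
    then obtain a q where aq: "p = a # q" by (cases p) auto
    have a: "a \<in> A" "u = orbit \<sigma> a" "set q \<subseteq> A" "A.cas (orbit \<sigma> (\<alpha> a)) q u"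
      using u(1) aq by (auto simp: A.awalk_def)
    \<comment> \<open>Without its first edge the cycle still joins the two ends of that edge. Orbits
      being closed under the remaining edges, both darts of the removed edge lie on one orbit,
      against \<open>sep\<close>.\<close>
    let ?C = "A - {a, \<alpha> a}"
    have C: "opp_closed ?C" using A opp(2) by (auto simp: opp_closed_def) (metis opp(2))
    interpret C: wf_digraph "dart_graph M ?C" by (rule wf_dart_graph[OF C])
    have "e \<noteq> a \<and> e \<noteq> \<alpha> a" if "e \<in> set q" for e
    proof -
      have "orbit \<alpha> a \<noteq> orbit \<alpha> e" using p(2) aq that by auto
      hence "{a, \<alpha> a} \<noteq> {e, \<alpha> e}" using orbit_involution opp(2) by metis
      thus ?thesis using opp(2) by auto
    qed
    hence qC: "set q \<subseteq> ?C" using a by auto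
    have aD: "a \<in> D" "\<alpha> a \<in> D" using a AD by auto
    have "C.awalk (orbit \<sigma> (\<alpha> a)) q u"
      unfolding C.awalk_def using qC a(4) cas_dart_graph[of A _ q _ ?C] aD by (auto simp: vertices_def)
    hence r: "reachable (dart_graph M ?C) (orbit \<sigma> (\<alpha> a)) u" using C.reachable_awalk by blast
    let ?X = "orbit (face_perm ?C) (\<alpha> a)"
    have P: "orbits_opp_closed ?C" by (rule oc[OF C]) auto
    have cl: "\<And>y. y \<in> ?X \<Longrightarrow> \<sigma> y \<in> ?X" "\<And>y. y \<in> ?X \<Longrightarrow> y \<in> ?C \<Longrightarrow> \<alpha> y \<in> ?X"
      using orbit_opp_closedD[OF C P _ aD(2)] by blast+
    have "orbit \<sigma> (\<alpha> a) \<subseteq> ?X"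
      by (rule orbit_subset_closed[OF orbit_permutes_self[OF finD face_perm[OF C]] cl(1)])
    hence "u \<subseteq> ?X" using reachable_closed[OF C r cl] by blast
    hence "a \<in> ?X" using a(2) orbit_permutes_self[OF finD rot_perm] by blast
    hence "\<alpha> a \<in> orbit (face_perm ?C) a"
      using orbit_eq_if_in[OF finD face_perm[OF C]] orbit_permutes_self[OF finD face_perm[OF C]] by metis
    thus False using sep[OF C _ a(1)] by auto
  qed
  thus "Digraph_Component.connected (dart_graph M A) \<and> acyc" using conn by blast
qed

lemma connected_mono:
  assumes A: "opp_closed A" and B: "opp_closed B" "A \<subseteq> B" and c: "Digraph_Component.connected (dart_graph M A)"
  shows "Digraph_Component.connected (dart_graph M B)"
proof -
  have "reachable (dart_graph M B) u v" if "reachable (dart_graph M A) u v" for u v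
  proof -
    have "arcs_ends (dart_graph M A) \<subseteq> arcs_ends (dart_graph M B)" using B(2) by (auto simp: arcs_ends_conv)
    thus ?thesis using that unfolding reachable_def by (auto intro: rtrancl_on_mono)
  qed
  thus ?thesis using c connected_dart_graph[OF A] connected_dart_graph[OF B(1)] by blast
qed

end

text \<open>Turns all conditions into orbit counts on the darts. With \<open>m\<close> vertices of
  degree 3 there are 3m/2 edges, so Euler's formula asks for 2 + m/2 faces; the map inherits
  connectedness from its spanning tree.\<close>

lemma tree_rooted_iff:
  fixes M :: "nat cmap"
  assumes m: "m > 0"
  shows "(M, T) \<in> tree_rooted_planar_cubic_maps m \<longleftrightarrow>
     is_cmap M \<and> T \<subseteq> edges M \<and> (\<forall>v\<in>vertices M. card v = 3) \<and> card (darts M) = 3 * m \<and>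
     card (orbit (rot M \<circ> perm_restrict (opp M) (\<Union>T)) ` darts M) = 1 \<and>
     card (\<Union>T) + 2 = 2 * m \<and> 2 * card (orbit (rot M \<circ> opp M) ` darts M) = m + 4" (is "?L \<longleftrightarrow> ?R")
proof -
  consider (bad) "\<not> is_cmap M \<or> \<not> T \<subseteq> edges M \<or> \<not> (\<forall>v\<in>vertices M. card v = 3)" |
    (ok) "is_cmap M" "T \<subseteq> edges M" "\<forall>v\<in>vertices M. card v = 3" by blast
  thus ?thesis
  proof cases
    case bad
    thus ?thesis by (auto simp: tree_rooted_planar_cubic_maps_def planar_cubic_map_def planar_map_def is_spanning_tree_def)
  next
    case ok
    interpret rotation_system M by unfold_locales (rule ok)
    have edge: "orbit \<alpha> d = {d, \<alpha> d}" for d using orbit_involution[of \<alpha> d] opp(2) by simp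
    have D3: "3 * card (vertices M) = card D"
      unfolding vertices_def by (rule card_orbits_mult[OF finD rot_perm]) (use ok(3) in \<open>auto simp: vertices_def\<close>)
    have E2: "2 * card (edges M) = card D"
      unfolding edges_def by (rule card_orbits_mult[OF finD opp_perm]) (simp add: edge opp(3)[symmetric])
    have T: "e \<subseteq> D \<and> \<alpha> d \<in> e" if "e \<in> T" "d \<in> e" for e d
    proof -
      have "e \<in> (\<lambda>d. {d, \<alpha> d}) ` D" using that(1) subsetD[OF ok(2)] unfolding edges_def edge by blast
      then obtain x where "x \<in> D" "e = {x, \<alpha> x}" by blast
      thus ?thesis using that(2) opp(2,4) by auto
    qed
    have cT: "opp_closed (\<Union>T)" using T unfolding opp_closed_def by blast
    have cD: "opp_closed D" using opp by (auto simp: opp_closed_def)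
    have UD: "\<Union>(edges M) = D" unfolding edges_def by (rule Union_orbits[OF finD opp_perm])
    have tree: "is_spanning_tree M T \<longleftrightarrow> card (orbit (face_perm (\<Union>T)) ` D) = 1 \<and> card (\<Union>T) + 2 = 2 * card (vertices M)"
      if "D \<noteq> {}"
      unfolding is_spanning_tree_def edge_subgraph_eq using spanning_tree_iff_aux[OF cT that] ok(2) by simp
    have conn: "Digraph_Component.connected (underlying_graph M)" if "is_spanning_tree M T"
      unfolding underlying_graph_def edge_subgraph_eq UD
      by (rule connected_mono[OF cT cD]) (use that in \<open>auto simp: is_spanning_tree_def edge_subgraph_eq cT[unfolded opp_closed_def]\<close>)
    have ne: "D \<noteq> {}" if "card (vertices M) = m \<or> card D = 3 * m" using that m by (auto simp: vertices_def)
    have euler: "int (card (vertices M)) - int (card (edges M)) + int (card (faces M)) = 2 \<longleftrightarrow>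
        2 * card (orbit (\<sigma> \<circ> \<alpha>) ` D) = m + 4" if "card (vertices M) = m"
      using that D3 E2 unfolding faces_def by linarith
    show ?thesis
    proof
      assume L: ?L
      hence V: "card (vertices M) = m" by (simp add: tree_rooted_planar_cubic_maps_def)
      show ?R using L ok tree[OF ne] V D3 euler[OF V]
        by (auto simp: tree_rooted_planar_cubic_maps_def planar_cubic_map_def planar_map_def)
    next
      assume R: ?R
      hence V: "card (vertices M) = m" using D3 by auto
      hence t: "is_spanning_tree M T" using R tree[OF ne] by auto
      thus ?L using R ok V D3 euler[OF V] conn
        by (auto simp: tree_rooted_planar_cubic_maps_def planar_cubic_map_def planar_map_def)
    qed
  qed
qed

section \<open>Contour labelling\<close>

lemma cyclic_labelling:
  assumes D: "finite D" "f permutes D" and d: "d \<in> D" "orbit f d = D"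
  shows "\<exists>e. bij_betw e {..<card D} D \<and> (\<forall>i<card D. e (rotation (card D) i) = f (e i))"
proof -
  define N where "N = funpow_dist1 f d d"
  have self: "d \<in> orbit f d" using d by simp
  let ?e = "\<lambda>i. (f ^^ i) d"
  have im: "D = ?e ` {0..<N}" using orbit_conv_funpow_dist1[OF self] d(2) by (simp add: N_def)
  have inj: "inj_on ?e {0..<N}" using inj_on_funpow_dist1[OF self] by (simp add: N_def)
  have N: "card D = N" using card_image[OF inj] im by simp
  have fN: "(f ^^ N) d = d" unfolding N_def by (rule funpow_dist1_prop[OF self])
  show ?thesis unfolding N
  proof (intro exI[of _ ?e] conjI allI impI)
    show "bij_betw ?e {..<N} D" using inj im by (simp add: bij_betw_def lessThan_atLeast0)
    fix i assume i: "i < N"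
    show "?e (rotation N i) = f (?e i)"
    proof (cases "Suc i = N")
      case True
      hence "f (?e i) = d" using fN by auto
      thus ?thesis using True by (simp add: rotation_simps)
    next
      case False
      thus ?thesis using i by (simp add: rotation_simps)
    qed
  qed
qed

lemma orbit_card_3:
  assumes "finite D" "f permutes D" "card (orbit f x) = 3"
  shows "f x \<noteq> x" "f (f (f x)) = x"
proof -
  have self: "x \<in> orbit f x" by (rule orbit_permutes_self[OF assms(1,2)])
  show "f x \<noteq> x" using assms(3) orbit_eq_singleton_iff[of f x] by auto
  have "card (orbit f x) = funpow_dist1 f x x"
    using orbit_conv_funpow_dist1[OF self] card_image[OF inj_on_funpow_dist1[OF self]] by simp
  hence "(f ^^ 3) x = x" using funpow_dist1_prop[OF self] assms(3) by simp
  thus "f (f (f x)) = x" by (simp add: numeral_3_eq_3)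
qed

lemma card_orbit_3:
  assumes "f x \<noteq> x" "f (f (f x)) = x" shows "card (orbit f x) = 3"
proof -
  have "orbit f x = {x, f x, f (f x)}"
  proof
    show "orbit f x \<subseteq> {x, f x, f (f x)}" by (rule orbit_subset_closed) (use assms in auto)
    have "f x \<in> orbit f x" by (rule orbit.base)
    moreover from orbit.step[OF this] have "f (f x) \<in> orbit f x" .
    moreover from orbit.step[OF this] have "x \<in> orbit f x" using assms by simp
    ultimately show "{x, f x, f (f x)} \<subseteq> orbit f x" by simp
  qed
  moreover have "f (f x) \<noteq> x" using assms by metis
  moreover have "f (f x) \<noteq> f x" using assms by metis
  ultimately show ?thesis using assms(1) by auto
qed

lemma card_orbits_conj:
  assumes e: "bij_betw e A D" and f: "\<And>i. i \<in> A \<Longrightarrow> f i \<in> A" "\<And>i. i \<in> A \<Longrightarrow> e (f i) = g (e i)"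
    and self: "\<And>i. i \<in> A \<Longrightarrow> i \<in> orbit f i"
  shows "card (orbit g ` D) = card (orbit f ` A)"
proof -
  have sub: "orbit f i \<subseteq> A" if "i \<in> A" for i using orbit_subset_closed[of i A f] that f(1) by blast
  have "orbit g (e i) = e ` orbit f i" if i: "i \<in> A" for i
  proof (rule orbit_inverse[OF self[OF i], symmetric])
    fix x assume "x \<in> orbit f i"
    hence "x \<in> A" using sub[OF i] by blast
    thus "g (e x) = e (f x)" using f(2) by simp
  qed
  hence "orbit g ` D = (\<lambda>X. e ` X) ` (orbit f ` A)"
    unfolding bij_betw_imp_surj_on[OF e, symmetric] image_image by (rule image_cong[OF refl])
  moreover have "inj_on (\<lambda>X. e ` X) (orbit f ` A)"
    by (rule inj_on_subset[OF inj_on_image_Pow[OF bij_betw_imp_inj_on[OF e]]]) (use sub in auto)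
  ultimately show ?thesis by (simp add: card_image)
qed

definition relabel :: "('a \<Rightarrow> 'b) \<Rightarrow> 'a set \<Rightarrow> ('b \<Rightarrow> 'b) \<Rightarrow> 'a \<Rightarrow> 'a" where
  "relabel e A f i = (if i \<in> A then inv_into A e (f (e i)) else i)"

lemma relabel:
  assumes e: "bij_betw e A D" and f: "matching_on S f" "S \<subseteq> D"
  shows "i \<in> A \<Longrightarrow> relabel e A f i \<in> A" "i \<in> A \<Longrightarrow> e (relabel e A f i) = f (e i)"
    "matching_on {i \<in> A. e i \<in> S} (relabel e A f)" "card {i \<in> A. e i \<in> S} = card S"
proof -
  note M = matching_onD[OF f(1)]
  have inD: "f (e i) \<in> D" if "i \<in> A" for i
  proof (cases "e i \<in> S")
    case True
    thus ?thesis using M(4)[of "e i"] f(2) by blast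
  next
    case False
    thus ?thesis using M(5)[of "e i"] bij_betwE[OF e] that by simp
  qed
  show 1: "relabel e A f i \<in> A" if "i \<in> A" for i
    using inD[OF that] bij_betwE[OF bij_betw_inv_into[OF e]] that by (simp add: relabel_def)
  show 2: "e (relabel e A f i) = f (e i)" if "i \<in> A" for i
    using bij_betw_inv_into_right[OF e inD[OF that]] that by (simp add: relabel_def)
  have inj: "e i = e j \<Longrightarrow> i \<in> A \<Longrightarrow> j \<in> A \<Longrightarrow> i = j" for i j
    using bij_betw_imp_inj_on[OF e] by (auto dest: inj_onD)
  show "matching_on {i \<in> A. e i \<in> S} (relabel e A f)"
  proof (rule matching_onI)
    fix i assume i: "i \<in> {i \<in> A. e i \<in> S}"
    hence iA: "i \<in> A" "e i \<in> S" by auto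
    show "relabel e A f i \<in> {i \<in> A. e i \<in> S}" using 1[OF iA(1)] 2[OF iA(1)] M(4)[of "e i"] iA(2) by simp
    show "relabel e A f i \<noteq> i" using 2[OF iA(1)] M(3)[OF iA(2)] by metis
    show "relabel e A f (relabel e A f i) = i"
    proof (rule inj)
      show "e (relabel e A f (relabel e A f i)) = e i"
        unfolding 2[OF 1[OF iA(1)]] 2[OF iA(1)] by (rule M(2))
      show "relabel e A f (relabel e A f i) \<in> A" by (rule 1[OF 1[OF iA(1)]])
    qed (rule iA(1))
  next
    fix i assume i: "i \<notin> {i \<in> A. e i \<in> S}"
    show "relabel e A f i = i"
    proof (cases "i \<in> A")
      case True
      hence "e (relabel e A f i) = e i" using 2[OF True] M(5)[of "e i"] i by simp
      thus ?thesis by (rule inj[OF _ 1[OF True] True])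
    qed (simp add: relabel_def)
  qed
  have "e ` {i \<in> A. e i \<in> S} = S" using bij_betw_imp_surj_on[OF e] f(2) by auto
  moreover have "inj_on e {i \<in> A. e i \<in> S}"
    by (rule inj_on_subset[OF bij_betw_imp_inj_on[OF e]]) blast
  ultimately show "card {i \<in> A. e i \<in> S} = card S" using card_image by metis
qed

text \<open>
  The tree darts and the other darts carry one involution each. Going around the tree numbers the
  darts by \<open>{..<K}\<close>, which turns the contour of the tree into \<open>rotation K\<close>.
\<close>

definition cubic_trees :: "nat \<Rightarrow> (nat \<Rightarrow> nat) set" where
  "cubic_trees K = {f. (\<exists>A\<subseteq>{..<K}. matching_on A f) \<and> noncrossing f \<and>
     (\<forall>x<K. rotation K (f x) \<noteq> x \<and> rotation K (f (rotation K (f (rotation K (f x))))) = x)}"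

definition diagrams :: "nat \<Rightarrow> ((nat \<Rightarrow> nat) \<times> (nat \<Rightarrow> nat)) set" where
  "diagrams K = {(f, g). f \<in> cubic_trees K \<and> matching_on {x. x < K \<and> f x = x} g \<and> noncrossing g}"

text \<open>\<open>f\<close> and \<open>g\<close> move disjoint sets of darts, so
  \<open>f \<circ> g\<close> is the edge involution. The contour is the vertex rotation after
  \<open>f\<close>; as \<open>f\<close> is an involution, composing the contour with
  \<open>f\<close> recovers the vertex rotation.\<close>

definition diagram_map :: "nat \<Rightarrow> (nat \<Rightarrow> nat) \<times> (nat \<Rightarrow> nat) \<Rightarrow> nat cmap \<times> nat set set" where
  "diagram_map K = (\<lambda>(f, g). (\<lparr> darts = {..<K}, rot = rotation K \<circ> f, opp = f \<circ> g \<rparr>,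
     (\<lambda>x. {x, f x}) ` {x. x < K \<and> f x \<noteq> x}))"

lemma cubic_treesD:
  assumes "f \<in> cubic_trees K"
  shows "f permutes {..<K}" "f (f x) = x" "f x < K \<longleftrightarrow> x < K" "x \<ge> K \<Longrightarrow> f x = x" "noncrossing f"
    "x < K \<Longrightarrow> rotation K (f x) \<noteq> x"
    "x < K \<Longrightarrow> rotation K (f (rotation K (f (rotation K (f x))))) = x"
    "matching_on {x. x < K \<and> f x \<noteq> x} f"
proof -
  obtain A where A: "A \<subseteq> {..<K}" "matching_on A f" using assms by (auto simp: cubic_trees_def)
  note M = matching_onD[OF A(2)]
  have "A = {x. x < K \<and> f x \<noteq> x}" using A(1) M(3,5) by auto
  thus "matching_on {x. x < K \<and> f x \<noteq> x} f" using A by simp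
  show p: "f permutes {..<K}" using M(1) A(1) permutes_subset by blast
  show "f (f x) = x" by (rule M(2))
  show "f x < K \<longleftrightarrow> x < K" using permutes_in_image[OF p, of x] by simp
  show "x \<ge> K \<Longrightarrow> f x = x" using permutes_not_in[OF p, of x] by simp
  have *: "noncrossing f" "\<forall>x<K. rotation K (f x) \<noteq> x \<and> rotation K (f (rotation K (f (rotation K (f x))))) = x"
    using assms unfolding cubic_trees_def by blast+
  show "noncrossing f" "x < K \<Longrightarrow> rotation K (f x) \<noteq> x"
    "x < K \<Longrightarrow> rotation K (f (rotation K (f (rotation K (f x))))) = x"
    using * by blast+
qed

lemma diagramsD:
  assumes "(f, g) \<in> diagrams K"
  shows "f \<in> cubic_trees K" "matching_on {x. x < K \<and> f x = x} g" "noncrossing g"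
    "g (g x) = x" "x < K \<Longrightarrow> f x = x \<Longrightarrow> g x < K \<and> f (g x) = g x \<and> g x \<noteq> x"
    "f x \<noteq> x \<Longrightarrow> g x = x" "x \<ge> K \<Longrightarrow> g x = x" "g x < K \<longleftrightarrow> x < K"
proof -
  show *: "f \<in> cubic_trees K" "matching_on {x. x < K \<and> f x = x} g" "noncrossing g"
    using assms unfolding diagrams_def by blast+
  note M = matching_onD[OF *(2)]
  show "g (g x) = x" by (rule M(2))
  show "x < K \<Longrightarrow> f x = x \<Longrightarrow> g x < K \<and> f (g x) = g x \<and> g x \<noteq> x" using M(3)[of x] M(4)[of x] by blast
  show "f x \<noteq> x \<Longrightarrow> g x = x" "x \<ge> K \<Longrightarrow> g x = x" using M(5)[of x] by (blast, simp)
  show "g x < K \<longleftrightarrow> x < K"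
  proof (cases "x < K \<and> f x = x")
    case True thus ?thesis using M(4)[of x] by simp
  next
    case False thus ?thesis using M(5)[of x] by simp
  qed
qed

text \<open>The vertices are counted twice: as \<open>6 * n\<close> darts in triples, and as the
  regions cut out by the noncrossing tree chords. Comparison gives the number of tree darts.\<close>

lemma card_cubic_tree:
  assumes f: "f \<in> cubic_trees (6 * n)" and n: "n \<ge> 1"
  shows "card {x. x < 6 * n \<and> f x \<noteq> x} + 2 = 4 * n" "card {x. x < 6 * n \<and> f x = x} = 2 * n + 2"
proof -
  let ?K = "6 * n" and ?A = "{x. x < 6 * n \<and> f x \<noteq> x}"
  note F = cubic_treesD[OF f]
  have "3 * card (orbit (rotation ?K \<circ> f) ` {..<?K}) = card {..<?K}"
  proof (rule card_orbits_mult)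
    show "rotation ?K \<circ> f permutes {..<?K}" by (rule permutes_compose[OF F(1) rotation_permutes])
  next
    fix x assume "x \<in> {..<?K}"
    hence x: "x < ?K" by simp
    show "card (orbit (rotation ?K \<circ> f) x) = 3"
      by (rule card_orbit_3) (use F(6)[OF x] F(7)[OF x] in simp_all)
  qed simp
  moreover have "2 * card (orbit (rotation ?K \<circ> f) ` {..<?K}) = 2 + card ?A"
    by (rule noncrossing_card_orbits[OF F(8) _ _ F(5)]) (use n in auto)
  ultimately show 1: "card ?A + 2 = 4 * n" by simp
  have "card {x. x < ?K \<and> f x = x} = card ({..<?K} - ?A)" by (rule arg_cong[where f = card]) auto
  also have "\<dots> = card {..<?K} - card ?A" by (rule card_Diff_subset) auto
  finally show "card {x. x < 6 * n \<and> f x = x} = 2 * n + 2" using 1 by simp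
qed

lemma diagram_map_tree_rooted:
  assumes S: "S \<in> diagrams (6 * n)" and n: "n \<ge> 1"
  shows "diagram_map (6 * n) S \<in> tree_rooted_planar_cubic_maps (2 * n)"
proof -
  obtain f g where fg: "S = (f, g)" by (cases S)
  note G = diagramsD[OF S[unfolded fg]]
  note F = cubic_treesD[OF G(1)]
  let ?K = "6 * n"
  let ?M = "\<lparr> darts = {..<?K}, rot = rotation ?K \<circ> f, opp = f \<circ> g \<rparr>"
  let ?T = "(\<lambda>x. {x, f x}) ` {x. x < ?K \<and> f x \<noteq> x}"
  have UT: "\<Union>?T = {x. x < ?K \<and> f x \<noteq> x}"
  proof (intro equalityI subsetI)
    fix x assume "x \<in> \<Union>?T"
    then obtain y where y: "y < ?K" "f y \<noteq> y" "x = y \<or> x = f y" by blast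
    moreover have "f (f y) \<noteq> f y" "f y < ?K" using F(2)[of y] F(3)[of y] y by metis+
    ultimately show "x \<in> {x. x < ?K \<and> f x \<noteq> x}" by auto
  next
    fix x assume "x \<in> {x. x < ?K \<and> f x \<noteq> x}"
    thus "x \<in> \<Union>?T" by (intro UnionI[of "{x, f x}"] imageI) simp_all
  qed
  have opp1: "(f \<circ> g) x = f x" if "f x \<noteq> x" for x using G(6)[OF that] by simp
  have opp2: "(f \<circ> g) x = g x" if "f x = x" "x < ?K" for x using G(5)[OF that(2,1)] by simp
  have opp: "matching_on {..<?K} (f \<circ> g)"
  proof (rule matching_onI)
    fix x assume "x \<in> {..<?K}" hence x: "x < ?K" by simp
    show "(f \<circ> g) x \<in> {..<?K}" using F(3) G(8) x by simp
    show "(f \<circ> g) x \<noteq> x" 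
    proof (cases "f x = x")
      case True thus ?thesis using opp2[OF True x] G(5)[OF x True] by simp
    next
      case False thus ?thesis using opp1[OF False] by simp
    qed
    show "(f \<circ> g) ((f \<circ> g) x) = x"
    proof (cases "f x = x")
      case True
      hence "(f \<circ> g) x = g x" "f (g x) = g x" "g x < ?K" using opp2 x G(5) by auto
      thus ?thesis using opp2[of "g x"] G(4) by simp
    next
      case False
      hence "f (f x) \<noteq> f x" using F(2)[of x] by metis
      thus ?thesis using opp1[OF False] opp1[of "f x"] F(2)[of x] by simp
    qed
  next
    fix x assume "x \<notin> {..<?K}"
    thus "(f \<circ> g) x = x" using F(4) G(7) by simp
  qed
  have rp: "rotation ?K \<circ> f permutes {..<?K}" by (rule permutes_compose[OF F(1) rotation_permutes])
  have cm: "is_cmap ?M" unfolding is_cmap_def using opp rp by (auto simp: matching_on_def)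
  have orb: "orbit (f \<circ> g) x = {x, (f \<circ> g) x}" for x by (rule orbit_involution) (rule matching_onD(2)[OF opp])
  have TE: "?T \<subseteq> edges ?M" 
  proof
    fix e assume "e \<in> ?T"
    then obtain x where x: "x < ?K" "f x \<noteq> x" "e = {x, f x}" by blast
    hence "e = orbit (f \<circ> g) x" using orb[of x] opp1 by simp
    thus "e \<in> edges ?M" using x(1) unfolding edges_def by simp
  qed
  have r: "perm_restrict (f \<circ> g) (\<Union>?T) = f" unfolding UT
  proof
    fix x show "perm_restrict (f \<circ> g) {x. x < ?K \<and> f x \<noteq> x} x = f x"
      using opp1[of x] F(4)[of x] by (cases "x < ?K") (auto simp: perm_restrict_def)
  qed
  have rf: "rotation ?K \<circ> f \<circ> f = rotation ?K" using F(2) by (auto simp: fun_eq_iff)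
  \<comment> \<open>The tree involution cancels: the faces are the regions cut out by the chords of
    \<open>g\<close> alone, \<open>n + 2\<close> in number.\<close>
  have faces: "rotation ?K \<circ> f \<circ> (f \<circ> g) = rotation ?K \<circ> g" using F(2) by (auto simp: fun_eq_iff)
  have "2 * card (orbit (rotation ?K \<circ> g) ` {..<?K}) = 2 + card {x. x < ?K \<and> f x = x}"
    by (rule noncrossing_card_orbits[OF G(2) _ _ G(3)]) (use n in auto)
  hence "2 * card (orbit (rotation ?K \<circ> g) ` {..<?K}) = 2 * n + 4" using card_cubic_tree(2)[OF G(1) n] by simp
  note fc = this
  have one: "card (orbit (rotation ?K) ` {..<?K}) = 1" by (rule card_orbits_rotation) (use n in simp)
  have v3: "card v = 3" if v: "v \<in> vertices ?M" for v
  proof -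
    obtain x where x: "x < ?K" "v = orbit (rotation ?K \<circ> f) x" using v unfolding vertices_def by auto
    show ?thesis unfolding x(2) by (rule card_orbit_3) (use F(6)[OF x(1)] F(7)[OF x(1)] in simp_all)
  qed
  have pos: "0 < 2 * n" using n by simp
  have "(?M, ?T) \<in> tree_rooted_planar_cubic_maps (2 * n)"
    unfolding tree_rooted_iff[OF pos] cmap.simps r rf faces fc one
  proof (intro conjI)
    show "is_cmap ?M" by (rule cm)
    show "?T \<subseteq> edges ?M" by (rule TE)
    show "\<forall>v\<in>vertices ?M. card v = 3" using v3 by blast
    show "card (\<Union>?T) + 2 = 2 * (2 * n)" unfolding UT using card_cubic_tree(1)[OF G(1) n] by simp
  qed simp_all
  thus ?thesis by (simp add: diagram_map_def fg)
qed

text \<open>Label the darts along the contour. Both relabelled involutions then attain the maximal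
  orbit count, one through the number of vertices and the other through the number of faces, and are
  therefore noncrossing.\<close>

lemma diagram_exists:
  assumes MT: "(M, T) \<in> tree_rooted_planar_cubic_maps (2 * n)" and n: "n \<ge> 1"
  shows "\<exists>S\<in>diagrams (6 * n). tree_rooted_iso (diagram_map (6 * n) S) (M, T)"
proof -
  let ?K = "6 * n" and ?A = "\<Union>T"
  have "0 < 2 * n" using n by simp
  note tr = MT[unfolded tree_rooted_iff[OF this]]
  interpret rotation_system M by unfold_locales (use tr in blast)
  have cK: "card D = ?K" using tr by simp
  have edge: "orbit \<alpha> d = {d, \<alpha> d}" for d using orbit_involution[of \<alpha> d] opp(2) by simp
  have Tform: "\<exists>x\<in>D. e = {x, \<alpha> x}" if "e \<in> T" for e
  proof -
    have "e \<in> edges M" using tr that by blast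
    thus ?thesis unfolding edges_def edge by blast
  qed
  have T: "d \<in> D \<and> e = {d, \<alpha> d}" if "e \<in> T" "d \<in> e" for e d
    using Tform[OF that(1)] that(2) opp(2,4) by auto
  have cA: "opp_closed ?A" unfolding opp_closed_def using T by blast
  have AD: "?A \<subseteq> D" "\<And>x. x \<in> ?A \<Longrightarrow> \<alpha> x \<in> ?A" using cA by (auto simp: opp_closed_def)
  let ?f = "perm_restrict \<alpha> ?A" and ?g = "perm_restrict \<alpha> (D - ?A)"
  have mf: "matching_on ?A ?f" by (rule matching_on_restrict[OF matching_opp[OF cmap]]) (use AD in auto)
  have mg: "matching_on (D - ?A) ?g"
  proof (rule matching_on_restrict[OF matching_opp[OF cmap]])
    fix x assume "x \<in> D - ?A"
    thus "\<alpha> x \<in> D - ?A" using AD(2)[of "\<alpha> x"] opp(2,4) by auto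
  qed simp
  have "D \<noteq> {}" using cK n by auto
  then obtain d where d: "d \<in> D" by auto
  have one: "card (orbit (face_perm ?A) ` D) = 1" using tr by blast
  then obtain X where X: "orbit (face_perm ?A) ` D = {X}" by (rule card_1_singletonE)
  have "orbit (face_perm ?A) d = D"
  proof
    show "orbit (face_perm ?A) d \<subseteq> D" by (rule permutes_orbit_subset[OF face_perm[OF cA] d])
    show "D \<subseteq> orbit (face_perm ?A) d"
    proof
      fix x assume "x \<in> D"
      hence "orbit (face_perm ?A) x = orbit (face_perm ?A) d" using X d by blast
      thus "x \<in> orbit (face_perm ?A) d" using orbit_permutes_self[OF finD face_perm[OF cA]] by blast
    qed
  qed
  from cyclic_labelling[OF finD face_perm[OF cA] d this] obtain e where
    e: "bij_betw e {..<?K} D" "\<And>i. i < ?K \<Longrightarrow> e (rotation ?K i) = face_perm ?A (e i)"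
    unfolding cK by blast
  have inj: "e i = e j \<Longrightarrow> i < ?K \<Longrightarrow> j < ?K \<Longrightarrow> i = j" for i j
    using bij_betw_imp_inj_on[OF e(1)] by (auto dest: inj_onD)
  have eD: "e i \<in> D" if "i < ?K" for i using bij_betwE[OF e(1)] that by auto
  define f g where "f = relabel e {..<?K} ?f" and "g = relabel e {..<?K} ?g"
  note rf = relabel[OF e(1) mf AD(1), folded f_def] and rg = relabel[OF e(1) mg Diff_subset, folded g_def]
  let ?r = "rotation ?K"
  have rK: "?r i < ?K" if "i < ?K" for i using permutes_in_image[OF rotation_permutes[of ?K], of i] that by simp
  have fK: "f i < ?K" "e (f i) = ?f (e i)" if "i < ?K" for i using rf(1,2)[of i] that by auto
  have gK: "g i < ?K" "e (g i) = ?g (e i)" if "i < ?K" for i using rg(1,2)[of i] that by auto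
  have es: "e (?r (f i)) = \<sigma> (e i)" if "i < ?K" for i
    using e(2)[OF fK(1)[OF that]] fK(2)[OF that] matching_onD(2)[OF mf] by simp
  have eg: "e (?r (g i)) = (\<sigma> \<circ> \<alpha>) (e i)" if "i < ?K" for i
  proof -
    have "?f (?g (e i)) = \<alpha> (e i)" using AD(2)[of "\<alpha> (e i)"] opp(2) opp(4) eD[OF that]
      by (auto simp: perm_restrict_def)
    thus ?thesis using e(2)[OF gK(1)[OF that]] gK(2)[OF that] by simp
  qed
  have fp: "f permutes {..<?K}" by (rule permutes_subset[OF matching_onD(1)[OF rf(3)]]) auto
  have gp: "g permutes {..<?K}" by (rule permutes_subset[OF matching_onD(1)[OF rg(3)]]) auto
  have rfp: "?r \<circ> f permutes {..<?K}" and rgp: "?r \<circ> g permutes {..<?K}"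
    using permutes_compose[OF fp rotation_permutes] permutes_compose[OF gp rotation_permutes] by auto
  have V: "card (orbit \<sigma> ` D) = card (orbit (?r \<circ> f) ` {..<?K})"
    by (rule card_orbits_conj[OF e(1)]) (use rfp orbit_permutes_self[OF _ rfp] es in \<open>auto simp: permutes_in_image fK rK\<close>)
  have F: "card (orbit (\<sigma> \<circ> \<alpha>) ` D) = card (orbit (?r \<circ> g) ` {..<?K})"
    by (rule card_orbits_conj[OF e(1)]) (use rgp orbit_permutes_self[OF _ rgp] eg in \<open>auto simp: permutes_in_image gK rK\<close>)
  have card3: "card (orbit \<sigma> x) = 3" if "x \<in> D" for x using tr that unfolding vertices_def by blast
  have V3: "3 * card (orbit \<sigma> ` D) = ?K" using card_orbits_mult[OF finD rot_perm card3] cK by simp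
  have cA': "card ?A + 2 = 4 * n" using tr by simp
  have cDA: "card (D - ?A) = 2 * n + 2"
    using card_Diff_subset[OF finite_subset[OF AD(1) finD] AD(1)] cA' cK by simp
  have ncf: "noncrossing f"
    by (rule noncrossing_if_card_orbits[OF rf(3)]) (use V V3 rf(4) cA' in auto)
  have ncg: "noncrossing g"
  proof (rule noncrossing_if_card_orbits[OF rg(3)])
    have "2 * card (orbit (\<sigma> \<circ> \<alpha>) ` D) = 2 * n + 4" using tr by simp
    thus "2 * card (orbit (?r \<circ> g) ` {..<?K}) = 2 + card {i \<in> {..<?K}. e i \<in> D - ?A}"
      using F rg(4) cDA by simp
  qed auto
  have fne: "f i \<noteq> i \<longleftrightarrow> e i \<in> ?A" if "i < ?K" for i
    using matching_onD(3,5)[OF rf(3), of i] that by auto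
  have fct: "f \<in> cubic_trees ?K"
    unfolding cubic_trees_def
  proof (intro CollectI conjI allI impI)
    show "\<exists>A\<subseteq>{..<?K}. matching_on A f" using rf(3) by (intro exI[of _ "{i \<in> {..<?K}. e i \<in> ?A}"]) auto
    fix i assume i: "i < ?K"
    note o3 = orbit_card_3[OF finD rot_perm card3[OF eD[OF i]]]
    show "?r (f i) \<noteq> i" using es[OF i] o3(1) by auto
    show "?r (f (?r (f (?r (f i))))) = i"
    proof (rule inj)
      show "e (?r (f (?r (f (?r (f i)))))) = e i" using es fK rK i o3(2) by simp
    qed (use fK rK i in auto)
  qed (rule ncf)
  have "{i \<in> {..<?K}. e i \<in> D - ?A} = {x. x < ?K \<and> f x = x}" using fne eD by auto
  hence S: "(f, g) \<in> diagrams ?K" using fct rg(3) ncg by (simp add: diagrams_def)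
  have "tree_rooted_iso (diagram_map ?K (f, g)) (M, T)"
    unfolding tree_rooted_iso_def diagram_map_def prod.case
  proof (intro exI[of _ e] conjI ballI)
    show "bij_betw e (darts \<lparr>darts = {..<?K}, rot = ?r \<circ> f, opp = f \<circ> g\<rparr>) D" using e(1) by simp
    fix i assume "i \<in> darts \<lparr>darts = {..<?K}, rot = ?r \<circ> f, opp = f \<circ> g\<rparr>"
    hence i: "i < ?K" by simp
    show "e (rot \<lparr>darts = {..<?K}, rot = ?r \<circ> f, opp = f \<circ> g\<rparr> i) = \<sigma> (e i)" using es[OF i] by simp
    have "?f (?g (e i)) = \<alpha> (e i)" using AD(2)[of "\<alpha> (e i)"] opp(2) opp(4) eD[OF i]
      by (auto simp: perm_restrict_def)
    thus "e (opp \<lparr>darts = {..<?K}, rot = ?r \<circ> f, opp = f \<circ> g\<rparr> i) = \<alpha> (e i)"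
      using fK(2)[OF gK(1)[OF i]] gK(2)[OF i] by simp
  next
    have im: "e ` {x, f x} = {e x, \<alpha> (e x)}" if "x < ?K" "f x \<noteq> x" for x
      using fK(2)[OF that(1)] fne[OF that(1)] that by (simp add: perm_restrict_def)
    show "(`) e ` (\<lambda>x. {x, f x}) ` {x. x < ?K \<and> f x \<noteq> x} = T"
    proof (intro equalityI subsetI)
      fix X assume "X \<in> (`) e ` (\<lambda>x. {x, f x}) ` {x. x < ?K \<and> f x \<noteq> x}"
      then obtain x where x: "x < ?K" "f x \<noteq> x" "X = {e x, \<alpha> (e x)}" using im by auto
      then obtain Y where "Y \<in> T" "e x \<in> Y" using fne by auto
      thus "X \<in> T" using T x(3) by metis
    next
      fix X assume X: "X \<in> T"
      then obtain y where y: "y \<in> D" "X = {y, \<alpha> y}" using Tform by blast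
      then obtain x where x: "x < ?K" "y = e x" using bij_betw_imp_surj_on[OF e(1)] by auto
      have "f x \<noteq> x" using fne[OF x(1)] X y x(2) by blast
      thus "X \<in> (`) e ` (\<lambda>x. {x, f x}) ` {x. x < ?K \<and> f x \<noteq> x}" using im x y by (auto simp: image_image)
    qed
  qed
  thus ?thesis using S by blast
qed

section \<open>Rotations and Burnside's lemma\<close>

locale cyclic_action =
  fixes X :: "'a set" and K :: nat and A :: "nat \<Rightarrow> 'a \<Rightarrow> 'a"
  assumes fin: "finite X" and K: "K > 0"
    and act: "\<And>r x. x \<in> X \<Longrightarrow> A r x \<in> X"
    and act0: "\<And>x. x \<in> X \<Longrightarrow> A 0 x = x"
    and actK: "\<And>x. x \<in> X \<Longrightarrow> A K x = x"
    and act_add: "\<And>r s x. x \<in> X \<Longrightarrow> A r (A s x) = A (r + s) x"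
begin

lemma act_mult: "x \<in> X \<Longrightarrow> A r x = x \<Longrightarrow> A (r * m) x = x"
  by (induct m) (simp_all add: act0 act_add[symmetric])

lemma act_mod: "x \<in> X \<Longrightarrow> A (r mod K) x = A r x"
proof -
  assume x: "x \<in> X"
  have "A r x = A (r mod K + K * (r div K)) x" by simp
  also have "\<dots> = A (r mod K) (A (K * (r div K)) x)" by (simp only: act_add[OF x])
  also have "A (K * (r div K)) x = x" by (rule act_mult[OF x actK[OF x]])
  finally show ?thesis ..
qed

lemma bij_act: "bij_betw (A r) X X"
proof -
  have "A r (A (K - r mod K) x) = x" if x: "x \<in> X" for x
  proof -
    have "(r + (K - r mod K)) mod K = (r mod K + (K - r mod K)) mod K" by (simp add: mod_add_left_eq)
    also have "\<dots> = 0" using K by simp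
    finally show ?thesis using act_mod[OF x, of "r + (K - r mod K)"] act0[OF x] by (simp add: act_add[OF x])
  qed
  hence "X \<subseteq> A r ` X" using act by (metis image_eqI subsetI)
  moreover have "A r ` X \<subseteq> X" using act by auto
  ultimately have "A r ` X = X" by blast
  thus ?thesis using fin by (simp add: bij_betw_def eq_card_imp_inj_on)
qed

text \<open>Starting at \<open>A s x\<close> instead of \<open>x\<close> merely permutes the
  exponents cyclically.\<close>

lemma card_shift: "x \<in> X \<Longrightarrow> card {r. r < K \<and> P (A r (A s x))} = card {r. r < K \<and> P (A r x)}"
proof -
  assume x: "x \<in> X"
  let ?f = "\<lambda>r. (r + s) mod K" and ?g = "\<lambda>r. (r + (K - s mod K)) mod K"
  have gf: "?g (?f r) = r" "?f (?g r) = r" if "r < K" for r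
  proof -
    have "s mod K < K" using K by simp
    hence e: "s + (K - s mod K) = K * (s div K + 1)" using mult_div_mod_eq[of K s] by (simp only: distrib_left mult_1_right)
    have "?g (?f r) = (r + (s + (K - s mod K))) mod K" by (simp only: add.assoc[symmetric] mod_add_left_eq)
    thus "?g (?f r) = r" unfolding e using that by (simp only: mod_mult_self2 mod_less)
    have "?f (?g r) = (r + (K - s mod K) + s) mod K" by (simp only: mod_add_left_eq)
    also have "r + (K - s mod K) + s = r + (s + (K - s mod K))" by simp
    finally show "?f (?g r) = r" unfolding e using that by (simp only: mod_mult_self2 mod_less)
  qed
  have ax: "A (?f r) x = A r (A s x)" for r unfolding act_mod[OF x] act_add[OF x] ..
  have "bij_betw ?f {r. r < K \<and> P (A r (A s x))} {r. r < K \<and> P (A r x)}"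
  proof (rule bij_betw_byWitness[where f' = ?g])
    show "?f ` {r. r < K \<and> P (A r (A s x))} \<subseteq> {r. r < K \<and> P (A r x)}" using ax K by auto
    show "?g ` {r. r < K \<and> P (A r x)} \<subseteq> {r. r < K \<and> P (A r (A s x))}"
    proof
      fix q assume "q \<in> ?g ` {r. r < K \<and> P (A r x)}"
      then obtain r where r: "r < K" "P (A r x)" "q = ?g r" by auto
      have "P (A (?f q) x)" using r gf(2)[OF r(1)] by simp
      thus "q \<in> {r. r < K \<and> P (A r (A s x))}" using ax[of q] r(3) K by simp
    qed
  qed (use gf in auto)
  thus ?thesis by (rule bij_betw_same_card)
qed

text \<open>The orbits enter as the fibres of a map \<open>\<Phi>\<close>, which will send a diagram
  to the isomorphism class of its map; thus classes of maps are counted without forming a quotient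
  of the diagrams.\<close>

lemma burnside:
  assumes \<Phi>: "\<And>x y. x \<in> X \<Longrightarrow> y \<in> X \<Longrightarrow> \<Phi> x = \<Phi> y \<longleftrightarrow> (\<exists>r<K. y = A r x)"
  shows "(\<Sum>r<K. card {x \<in> X. A r x = x}) = K * card (\<Phi> ` X)"
proof -
  have "(\<Sum>r<K. card {x \<in> X. A r x = x}) = (\<Sum>r<K. \<Sum>x\<in>X. if A r x = x then 1 else 0)"
    using fin by (simp add: sum.If_cases Int_def)
  also have "\<dots> = (\<Sum>x\<in>X. \<Sum>r<K. if A r x = x then 1 else 0)" by (rule sum.swap)
  also have "\<dots> = (\<Sum>x\<in>X. card {r. r < K \<and> A r x = x})"
    by (simp add: sum.If_cases Int_def)
  also have "\<dots> = (\<Sum>q\<in>\<Phi> ` X. \<Sum>x\<in>{x \<in> X. \<Phi> x = q}. card {r. r < K \<and> A r x = x})"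
    by (rule sum.image_gen[OF fin])
  also have "\<dots> = (\<Sum>q\<in>\<Phi> ` X. K)"
  proof (rule sum.cong[OF refl])
    fix q assume "q \<in> \<Phi> ` X"
    then obtain z where z: "z \<in> X" "q = \<Phi> z" by auto
    let ?F = "{x \<in> X. \<Phi> x = q}"
    have F: "?F = (\<lambda>r. A r z) ` {..<K}" 
    proof (intro equalityI subsetI)
      fix x assume "x \<in> ?F"
      hence "x \<in> X" "\<Phi> z = \<Phi> x" using z(2) by auto
      thus "x \<in> (\<lambda>r. A r z) ` {..<K}" using \<Phi>[OF z(1)] by blast
    next
      fix x assume "x \<in> (\<lambda>r. A r z) ` {..<K}"
      then obtain r where r: "r < K" "x = A r z" by auto
      hence "x \<in> X" using act[OF z(1)] by simp
      moreover have "\<Phi> z = \<Phi> x" using \<Phi>[OF z(1) \<open>x \<in> X\<close>] r by blast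
      ultimately show "x \<in> ?F" using z(2) by simp
    qed
    \<comment> \<open>After a shift of exponents the stabiliser of \<open>x\<close> has the size of
      the set of exponents taking \<open>z\<close> to \<open>x\<close>; over the orbit these sets
      partition all \<open>K\<close> exponents.\<close>
    have "(\<Sum>x\<in>?F. card {r. r < K \<and> A r x = x}) = (\<Sum>x\<in>?F. card {r. r < K \<and> A r z = x})"
    proof (rule sum.cong[OF refl])
      fix x assume "x \<in> ?F"
      then obtain s where "x = A s z" using F by auto
      thus "card {r. r < K \<and> A r x = x} = card {r. r < K \<and> A r z = x}"
        using card_shift[OF z(1), of "\<lambda>y. y = x" s] by simp
    qed
    also have "\<dots> = (\<Sum>x\<in>?F. \<Sum>r\<in>{r \<in> {..<K}. A r z = x}. 1)" by simp
    also have "\<dots> = (\<Sum>r<K. 1)" unfolding F by (rule sum.image_gen[symmetric]) simp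
    finally show "(\<Sum>x\<in>?F. card {r. r < K \<and> A r x = x}) = K" by simp
  qed
  finally show ?thesis by (simp add: mult.commute)
qed

text \<open>Double counting of the pairs \<open>(r, x)\<close> with \<open>P (A r x)\<close>, each
  \<open>A r\<close> being a bijection. It trades counting all of \<open>X\<close> for counting the
  elements whose distinguished place sits at position 0.\<close>

lemma average:
  assumes c: "\<And>x. x \<in> X \<Longrightarrow> card {r. r < K \<and> P (A r x)} = c"
  shows "c * card X = K * card {x \<in> X. P x}"
proof -
  have "c * card X = (\<Sum>x\<in>X. card {r. r < K \<and> P (A r x)})" using c by simp
  also have "\<dots> = (\<Sum>x\<in>X. \<Sum>r<K. if P (A r x) then 1 else 0)"
    by (simp add: sum.If_cases Int_def)
  also have "\<dots> = (\<Sum>r<K. \<Sum>x\<in>X. if P (A r x) then 1 else 0)" by (rule sum.swap)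
  also have "\<dots> = (\<Sum>r<K. \<Sum>x\<in>X. if P x then 1 else 0)"
    by (rule sum.cong[OF refl sum.reindex_bij_betw[OF bij_act]])
  also have "\<dots> = K * card {x \<in> X. P x}" using fin by (simp add: sum.If_cases Int_def)
  finally show ?thesis .
qed

end

section \<open>Rotation of diagrams\<close>

definition rotate_by :: "nat \<Rightarrow> nat \<Rightarrow> (nat \<Rightarrow> nat) \<Rightarrow> nat \<Rightarrow> nat" where
  "rotate_by K r f = (rotation K ^^ r) \<circ> f \<circ> inv (rotation K ^^ r)"

definition rotate_diagram :: "nat \<Rightarrow> nat \<Rightarrow> (nat \<Rightarrow> nat) \<times> (nat \<Rightarrow> nat) \<Rightarrow> (nat \<Rightarrow> nat) \<times> (nat \<Rightarrow> nat)" where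
  "rotate_diagram K r = map_prod (rotate_by K r) (rotate_by K r)"

lemma rotation_pow_permutes: "(rotation K ^^ r) permutes {..<K}"
  
proof (induct r)
  case 0 show ?case by (simp only: funpow.simps permutes_id)
next
  case (Suc r) thus ?case using permutes_compose[OF Suc rotation_permutes] by (simp only: funpow.simps)
qed

lemma bij_rotation_pow: "bij (rotation K ^^ r)"
  by (rule permutes_bij[OF rotation_pow_permutes])

lemma rotation_pow_outside: "x \<ge> K \<Longrightarrow> (rotation K ^^ r) x = x"
  using permutes_not_in[OF rotation_pow_permutes] by simp

lemma rotate_by_apply: "rotate_by K r f ((rotation K ^^ r) x) = (rotation K ^^ r) (f x)"
  using bij_rotation_pow[of r K] by (simp add: rotate_by_def bij_is_inj)

lemma rotate_by_eqI:
  assumes "\<And>x. g ((rotation K ^^ r) x) = (rotation K ^^ r) (f x)"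
  shows "rotate_by K r f = g"
proof
  fix y obtain x where "y = (rotation K ^^ r) x" using bij_rotation_pow[of r K] by (metis bij_pointE)
  thus "rotate_by K r f y = g y" using assms rotate_by_apply by simp
qed

lemma rotate_by_0: "rotate_by K 0 f = f"
  by (rule rotate_by_eqI) simp

lemma rotate_by_K: "rotate_by K K f = f"
proof -
  have "(rotation K ^^ K) x = x" for x
    by (cases "x < K") (simp_all add: funpow_rotation rotation_pow_outside)
  thus ?thesis by (intro rotate_by_eqI) simp
qed

lemma rotate_by_add: "rotate_by K r (rotate_by K s f) = rotate_by K (r + s) f"
proof (rule sym, rule rotate_by_eqI)
  fix x show "rotate_by K r (rotate_by K s f) ((rotation K ^^ (r + s)) x) = (rotation K ^^ (r + s)) (f x)"
    by (simp add: funpow_add rotate_by_apply)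
qed

lemma rotate_by_matching:
  assumes "matching_on S f" shows "matching_on ((rotation K ^^ r) ` S) (rotate_by K r f)"
proof -
  note M = matching_onD[OF assms]
  let ?p = "rotation K ^^ r"
  have inj: "inj ?p" by (rule bij_is_inj[OF bij_rotation_pow])
  show ?thesis
  proof (rule matching_onI)
    fix y assume "y \<in> ?p ` S"
    then obtain x where x: "x \<in> S" "y = ?p x" by auto
    show "rotate_by K r f y \<in> ?p ` S" using x M(4)[of x] by (auto simp: rotate_by_apply)
    show "rotate_by K r f y \<noteq> y" using x M(3)[of x] inj by (auto simp: rotate_by_apply dest: injD)
    show "rotate_by K r f (rotate_by K r f y) = y" using x M(2)[of x] by (simp add: rotate_by_apply)
  next
    fix y assume y: "y \<notin> ?p ` S"
    obtain x where x: "y = ?p x" using bij_rotation_pow[of r K] by (metis bij_pointE)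
    show "rotate_by K r f y = y" using x y M(5)[of x] by (metis imageI rotate_by_apply)
  qed
qed

lemma rotation_pow_commute: "rotation K ((rotation K ^^ r) x) = (rotation K ^^ r) (rotation K x)"
  by (simp add: funpow_swap1)

text \<open>The characterisation by the number of orbits spares the case distinctions on wrapping chords.\<close>

lemma noncrossing_rotate:
  assumes f: "matching_on S f" "S \<subseteq> {..<K}" "noncrossing f"
  shows "noncrossing (rotate_by K r f)"
proof (cases "K = 0")
  case True
  hence "S = {}" using f by simp
  hence "f = id" using matching_onD(5)[OF f(1)] by (auto simp: fun_eq_iff)
  hence "rotate_by K r f = id" by (intro rotate_by_eqI) simp
  thus ?thesis by (simp add: noncrossing_def)
next
  case False
  let ?p = "rotation K ^^ r"
  have fp: "f permutes {..<K}" using permutes_subset[OF matching_onD(1)[OF f(1)] f(2)] .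
  have rp: "rotation K \<circ> f permutes {..<K}" by (rule permutes_compose[OF fp rotation_permutes])
  show ?thesis
  proof (rule noncrossing_if_card_orbits[OF rotate_by_matching[OF f(1)]])
    show "?p ` S \<subseteq> {..<K}" using permutes_in_image[OF rotation_pow_permutes] f(2) by blast
    have b: "bij_betw ?p {..<K} {..<K}" by (rule permutes_imp_bij[OF rotation_pow_permutes])
    have "card (orbit (rotation K \<circ> rotate_by K r f) ` {..<K}) = card (orbit (rotation K \<circ> f) ` {..<K})"
    proof (rule card_orbits_conj[OF b])
      fix i assume i: "i \<in> {..<K}"
      show "(rotation K \<circ> f) i \<in> {..<K}" using permutes_in_image[OF rp, of i] i by (simp only:)
      show "?p ((rotation K \<circ> f) i) = (rotation K \<circ> rotate_by K r f) (?p i)"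
        unfolding comp_apply rotate_by_apply rotation_pow_commute ..
      show "i \<in> orbit (rotation K \<circ> f) i" by (rule orbit_permutes_self[OF finite_lessThan rp])
    qed
    note e1 = this
    have e2: "card (?p ` S) = card S"
      by (rule card_image) (rule inj_on_subset[OF bij_is_inj[OF bij_rotation_pow] subset_UNIV])
    show "2 * card (orbit (rotation K \<circ> rotate_by K r f) ` {..<K}) = 2 + card (?p ` S)"
      unfolding e1 e2 by (rule noncrossing_card_orbits[OF f(1,2) _ f(3)]) (use False in simp)
  qed
qed

lemma rotate_diagram_in:
  assumes S: "S \<in> diagrams K" shows "rotate_diagram K r S \<in> diagrams K"
proof -
  obtain f g where fg: "S = (f, g)" by (cases S)
  note G = diagramsD[OF S[unfolded fg]]
  note F = cubic_treesD[OF G(1)]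
  let ?p = "rotation K ^^ r" and ?f = "rotate_by K r f" and ?g = "rotate_by K r g"
  have inj: "inj ?p" by (rule bij_is_inj[OF bij_rotation_pow])
  have pK: "?p x < K \<longleftrightarrow> x < K" for x using permutes_in_image[OF rotation_pow_permutes] by auto
  have pre: "\<exists>x. y = ?p x" for y using bij_rotation_pow[of r K] by (metis bij_pointE)
  have "?f \<in> cubic_trees K"
    unfolding cubic_trees_def
  proof (intro CollectI conjI allI impI)
    show "\<exists>A\<subseteq>{..<K}. matching_on A ?f"
    proof (intro exI conjI)
      show "matching_on (?p ` {x. x < K \<and> f x \<noteq> x}) ?f" by (rule rotate_by_matching[OF F(8)])
      show "?p ` {x. x < K \<and> f x \<noteq> x} \<subseteq> {..<K}" using pK by blast
    qed
    show "noncrossing ?f" by (rule noncrossing_rotate[OF F(8) _ F(5)]) blast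
    fix y assume y: "y < K"
    obtain x where x: "y = ?p x" using pre by blast
    hence xK: "x < K" using y pK by simp
    show "rotation K (?f y) \<noteq> y"
      unfolding x rotate_by_apply rotation_pow_commute using F(6)[OF xK] inj by (auto dest: injD)
    show "rotation K (?f (rotation K (?f (rotation K (?f y))))) = y"
      unfolding x rotate_by_apply rotation_pow_commute using F(7)[OF xK] by simp
  qed
  moreover have "?p ` {x. x < K \<and> f x = x} = {y. y < K \<and> ?f y = y}"
  proof (intro equalityI subsetI)
    fix y assume "y \<in> ?p ` {x. x < K \<and> f x = x}"
    then obtain x where x: "x < K" "f x = x" "y = ?p x" by blast
    show "y \<in> {y. y < K \<and> ?f y = y}" unfolding x(3) mem_Collect_eq rotate_by_apply x(2) pK using x(1) by blast
  next
    fix y assume y: "y \<in> {y. y < K \<and> ?f y = y}"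
    obtain x where x: "y = ?p x" using pre by blast
    have "?p (f x) = ?p x" "x < K" using y unfolding x mem_Collect_eq rotate_by_apply pK by blast+
    hence "f x = x" using injD[OF inj] by blast
    thus "y \<in> ?p ` {x. x < K \<and> f x = x}" using x \<open>x < K\<close> by blast
  qed
  moreover have "noncrossing ?g" by (rule noncrossing_rotate[OF G(2) _ G(3)]) blast
  ultimately show ?thesis using rotate_by_matching[OF G(2), of r K]
    by (simp add: diagrams_def rotate_diagram_def fg)
qed

lemma finite_diagrams: "finite (diagrams K)"
proof (rule finite_subset)
  show "diagrams K \<subseteq> {f. f permutes {..<K}} \<times> {f. f permutes {..<K}}"
  proof
    fix S assume S: "S \<in> diagrams K"
    obtain f g where fg: "S = (f, g)" by (cases S)
    note G = diagramsD[OF S[unfolded fg]]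
    have "g permutes {..<K}" by (rule permutes_subset[OF matching_onD(1)[OF G(2)]]) auto
    thus "S \<in> {f. f permutes {..<K}} \<times> {f. f permutes {..<K}}" using cubic_treesD(1)[OF G(1)] fg by simp
  qed
  show "finite ({f. f permutes {..<K}} \<times> {f. f permutes {..<K}})"
    by (intro finite_cartesian_product finite_permutations) simp_all
qed

lemma cyclic_action_diagrams: "K > 0 \<Longrightarrow> cyclic_action (diagrams K) K (rotate_diagram K)"
  by unfold_locales
    (simp_all add: finite_diagrams rotate_diagram_in, auto simp: rotate_diagram_def rotate_by_0 rotate_by_K rotate_by_add)

text \<open>An isomorphism respects the tree, so it commutes with \<open>f\<close> and
  \<open>g\<close> separately and hence with \<open>rotation K\<close>. A bijection commuting with a
  full cycle is a power of it, determined by the image of 0.\<close>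

lemma iso_diagram_map:
  assumes S: "S \<in> diagrams K" and S': "S' \<in> diagrams K" and K: "K > 0"
  shows "tree_rooted_iso (diagram_map K S) (diagram_map K S') \<longleftrightarrow> (\<exists>r<K. S' = rotate_diagram K r S)"
proof -
  obtain f g f' g' where fg: "S = (f, g)" "S' = (f', g')" by (cases S, cases S')
  note G = diagramsD[OF S[unfolded fg]] and G' = diagramsD[OF S'[unfolded fg]]
  note F = cubic_treesD[OF G(1)] and F' = cubic_treesD[OF G'(1)]
  let ?r = "rotation K"
  have rK: "?r x < K \<longleftrightarrow> x < K" for x using permutes_in_image[OF rotation_permutes[of K], of x] by simp
  have iso: "tree_rooted_iso (diagram_map K S) (diagram_map K S') \<longleftrightarrow>
    (\<exists>h. bij_betw h {..<K} {..<K} \<and>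
      (\<forall>d\<in>{..<K}. h (?r (f d)) = ?r (f' (h d)) \<and> h (f (g d)) = f' (g' (h d))) \<and>
      (\<lambda>e. h ` e) ` (\<lambda>x. {x, f x}) ` {x. x < K \<and> f x \<noteq> x} = (\<lambda>x. {x, f' x}) ` {x. x < K \<and> f' x \<noteq> x})"
    unfolding fg diagram_map_def tree_rooted_iso_def prod.case cmap.simps comp_apply ..
  have neq: "f (f x) \<noteq> f x \<longleftrightarrow> f x \<noteq> x" "f' (f' x) \<noteq> f' x \<longleftrightarrow> f' x \<noteq> x" for x using F(2) F'(2) by metis+
  show ?thesis
  proof
    assume "tree_rooted_iso (diagram_map K S) (diagram_map K S')"
    then obtain h where h: "bij_betw h {..<K} {..<K}"
      and hr: "\<And>d. d < K \<Longrightarrow> h (?r (f d)) = ?r (f' (h d))" and ho: "\<And>d. d < K \<Longrightarrow> h (f (g d)) = f' (g' (h d))"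
      and hT: "(\<lambda>e. h ` e) ` (\<lambda>x. {x, f x}) ` {x. x < K \<and> f x \<noteq> x} = (\<lambda>x. {x, f' x}) ` {x. x < K \<and> f' x \<noteq> x}"
      unfolding iso by auto
    have hK: "h x < K" if "x < K" for x using bij_betwE[OF h] that by auto
    have inj: "h x = h y \<Longrightarrow> x < K \<Longrightarrow> y < K \<Longrightarrow> x = y" for x y
      using bij_betw_imp_inj_on[OF h] by (auto dest: inj_onD)
    have moved: "f x \<noteq> x \<longleftrightarrow> f' (h x) \<noteq> h x" if x: "x < K" for x
    proof
      assume "f x \<noteq> x"
      hence "h ` {x, f x} \<in> (\<lambda>x. {x, f' x}) ` {x. x < K \<and> f' x \<noteq> x}" unfolding hT[symmetric] using x by blast
      then obtain y where y: "f' y \<noteq> y" "h ` {x, f x} = {y, f' y}" by blast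
      have "h x \<in> {y, f' y}" unfolding y(2)[symmetric] by simp
      hence "h x = y \<or> h x = f' y" "f' y \<noteq> y" using y(1) by simp_all
      thus "f' (h x) \<noteq> h x" using neq(2) by metis
    next
      assume "f' (h x) \<noteq> h x"
      hence "{h x, f' (h x)} \<in> (\<lambda>e. h ` e) ` (\<lambda>x. {x, f x}) ` {x. x < K \<and> f x \<noteq> x}" unfolding hT using hK x by blast
      then obtain y where y: "y < K" "f y \<noteq> y" "{h x, f' (h x)} = h ` {y, f y}" by blast
      have "h x \<in> h ` {y, f y}" unfolding y(3)[symmetric] by simp
      hence "h x = h y \<or> h x = h (f y)" by simp
      hence "x = y \<or> x = f y" using inj x y F(3) by metis
      thus "f x \<noteq> x" using y(2) neq(1) by metis
    qed
    \<comment> \<open>The edge involution acts as \<open>f\<close> on tree darts and as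
      \<open>g\<close> on the others; \<open>moved\<close> says that \<open>h\<close> respects this
      distinction, so the one condition on \<open>opp\<close> splits into two.\<close>
    have hf: "h (f x) = f' (h x)" if x: "x < K" for x
    proof (cases "f x = x")
      case True
      thus ?thesis using moved[OF x] by simp
    next
      case False
      hence "f' (h x) \<noteq> h x" using moved[OF x] by simp
      thus ?thesis using ho[OF x] G(6)[OF False] G'(6) by simp
    qed
    have hg: "h (g x) = g' (h x)" if x: "x < K" for x
    proof (cases "f x = x")
      case True
      hence "f' (h x) = h x" using moved[OF x] by simp
      hence "f' (g' (h x)) = g' (h x)" using G'(5)[OF hK[OF x]] by simp
      moreover have "f (g x) = g x" using G(5)[OF x True] by simp
      ultimately show ?thesis using ho[OF x] by simp
    next
      case False
      hence "f' (h x) \<noteq> h x" using moved[OF x] by simp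
      thus ?thesis using G(6)[OF False] G'(6) by simp
    qed
    have hrot: "h (?r x) = ?r (h x)" if x: "x < K" for x
      using hr[of "f x"] hf[OF x] F(2,3) F'(2) x by simp
    define r where "r = h 0"
    have r: "r < K" unfolding r_def by (rule hK[OF K])
    have hp: "h x = (?r ^^ r) x" if "x < K" for x
    proof -
      have "h ((?r ^^ x) 0) = (?r ^^ x) (h 0)" for x
      proof (induct x)
        case (Suc x)
        have "(?r ^^ x) 0 < K" using K by (simp add: funpow_rotation)
        thus ?case using Suc hrot by simp
      qed simp
      from this[of x] show ?thesis using that K r unfolding r_def[symmetric]
        by (simp add: funpow_rotation add.commute)
    qed
    have "f' = rotate_by K r f" "g' = rotate_by K r g"
    proof (rule rotate_by_eqI[symmetric])
      fix x show "f' ((?r ^^ r) x) = (?r ^^ r) (f x)"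
      proof (cases "x < K")
        case True thus ?thesis using hf[OF True] hp[OF True] hp[of "f x"] F(3) by simp
      next
        case False thus ?thesis by (simp add: rotation_pow_outside F(4) F'(4))
      qed
    next
      show "g' = rotate_by K r g"
      proof (rule rotate_by_eqI[symmetric])
        fix x show "g' ((?r ^^ r) x) = (?r ^^ r) (g x)"
        proof (cases "x < K")
          case True thus ?thesis using hg[OF True] hp[OF True] hp[of "g x"] G(8) by simp
        next
          case False thus ?thesis by (simp add: rotation_pow_outside G(7) G'(7))
        qed
      qed
    qed
    thus "\<exists>r<K. S' = rotate_diagram K r S" using r by (intro exI[of _ r]) (simp add: fg rotate_diagram_def)
  next
    assume "\<exists>r<K. S' = rotate_diagram K r S"
    then obtain r where r: "f' = rotate_by K r f" "g' = rotate_by K r g" by (auto simp: fg rotate_diagram_def)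
    let ?p = "?r ^^ r"
    have pf: "f' (?p x) = ?p (f x)" "g' (?p x) = ?p (g x)" for x unfolding r by (rule rotate_by_apply)+
    have injp: "?p x = ?p y \<longleftrightarrow> x = y" for x y using bij_is_inj[OF bij_rotation_pow[of r K]] by (auto dest: injD)
    have pK: "?p x < K \<longleftrightarrow> x < K" for x using permutes_in_image[OF rotation_pow_permutes[of r K], of x] by simp
    show "tree_rooted_iso (diagram_map K S) (diagram_map K S')"
      unfolding iso
    proof (intro exI[of _ ?p] conjI ballI)
      show "bij_betw ?p {..<K} {..<K}" by (rule permutes_imp_bij[OF rotation_pow_permutes])
      fix d show "?p (?r (f d)) = ?r (f' (?p d))" unfolding pf by (rule rotation_pow_commute[symmetric])
      show "?p (f (g d)) = f' (g' (?p d))" unfolding pf ..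
    next
      have "{x. x < K \<and> f' x \<noteq> x} = ?p ` {x. x < K \<and> f x \<noteq> x}"
      proof (intro equalityI subsetI)
        fix y assume y: "y \<in> {x. x < K \<and> f' x \<noteq> x}"
        obtain x where x: "y = ?p x" using bij_rotation_pow[of r K] by (metis bij_pointE)
        show "y \<in> ?p ` {x. x < K \<and> f x \<noteq> x}" using y unfolding x by (auto simp: pf injp pK)
      qed (auto simp: pf injp pK)
      thus "(\<lambda>e. ?p ` e) ` (\<lambda>x. {x, f x}) ` {x. x < K \<and> f x \<noteq> x} = (\<lambda>x. {x, f' x}) ` {x. x < K \<and> f' x \<noteq> x}"
        by (simp add: image_image pf)
    qed
  qed
qed

lemma num_tree_rooted_burnside:
  assumes n: "n \<ge> 1"
  shows "6 * n * num_tree_rooted n = (\<Sum>r<6 * n. card {S \<in> diagrams (6 * n). rotate_diagram (6 * n) r S = S})"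
proof -
  let ?K = "6 * n" and ?R = "tree_rooted_iso_rel (2 * n)" and ?X = "tree_rooted_planar_cubic_maps (2 * n)"
  have K: "?K > 0" using n by simp
  interpret cyclic_action "diagrams ?K" ?K "rotate_diagram ?K" by (rule cyclic_action_diagrams[OF K])
  note eqv = equiv_tree_rooted_iso_rel[of "2 * n"]
  let ?\<Phi> = "\<lambda>S. ?R `` {diagram_map ?K S}"
  have "?\<Phi> x = ?\<Phi> y \<longleftrightarrow> (\<exists>r<?K. y = rotate_diagram ?K r x)" if "x \<in> diagrams ?K" "y \<in> diagrams ?K" for x y
  proof -
    have m: "diagram_map ?K x \<in> ?X" "diagram_map ?K y \<in> ?X" using that diagram_map_tree_rooted n by blast+
    have "?\<Phi> x = ?\<Phi> y \<longleftrightarrow> (diagram_map ?K x, diagram_map ?K y) \<in> ?R" by (rule eq_equiv_class_iff[OF eqv m])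
    also have "\<dots> \<longleftrightarrow> tree_rooted_iso (diagram_map ?K x) (diagram_map ?K y)"
      using m by (simp add: tree_rooted_iso_rel_def)
    finally show ?thesis using iso_diagram_map[OF that K] by simp
  qed
  from burnside[of ?\<Phi>, OF this]
  have "(\<Sum>r<?K. card {S \<in> diagrams ?K. rotate_diagram ?K r S = S}) = ?K * card (?\<Phi> ` diagrams ?K)" by blast
  also have "?\<Phi> ` diagrams ?K = ?X // ?R"
  proof (intro equalityI subsetI)
    fix Q assume "Q \<in> ?\<Phi> ` diagrams ?K"
    thus "Q \<in> ?X // ?R" using diagram_map_tree_rooted[OF _ n] by (auto intro: quotientI)
  next
    fix Q assume "Q \<in> ?X // ?R"
    then obtain M T where MT: "(M, T) \<in> ?X" "Q = ?R `` {(M, T)}" by (auto elim!: quotientE)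
    obtain S where S: "S \<in> diagrams ?K" "tree_rooted_iso (diagram_map ?K S) (M, T)"
      using diagram_exists[OF MT(1) n] by blast
    hence "(diagram_map ?K S, (M, T)) \<in> ?R"
      using MT(1) diagram_map_tree_rooted[OF S(1) n] by (simp add: tree_rooted_iso_rel_def)
    hence "?\<Phi> S = Q" using equiv_class_eq[OF eqv] MT(2) by blast
    thus "Q \<in> ?\<Phi> ` diagrams ?K" using S(1) by blast
  qed
  finally show ?thesis by (simp add: num_tree_rooted_def)
qed

section \<open>Symmetries of a cubic tree\<close>

lemma rotate_by_fixed:
  assumes "rotate_by K g f = f" "x < K" "f x < K"
  shows "f ((x + g) mod K) = (f x + g) mod K"
  using rotate_by_apply[of K g f x] assms by (simp add: funpow_rotation)

lemma rotate_by_fixed_mult: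
  assumes "rotate_by K g f = f" shows "rotate_by K (g * m) f = f"
  by (induct m) (simp_all add: rotate_by_0 rotate_by_add[symmetric] assms)

lemma rotate_by_mod: "rotate_by K (r mod K) f = rotate_by K r f"
proof -
  have "rotate_by K r f = rotate_by K (r mod K + K * (r div K)) f" by simp
  also have "\<dots> = rotate_by K (r mod K) f"
    unfolding rotate_by_add[symmetric] by (simp only: rotate_by_fixed_mult[OF rotate_by_K])
  finally show ?thesis ..
qed

text \<open>By Bezout a multiple of \<open>r\<close> equals \<open>gcd r K\<close> modulo
  \<open>K\<close>. The period may then be assumed to divide \<open>K\<close>.\<close>

lemma rotate_by_fixed_gcd:
  assumes "rotate_by K r f = f" "K > 0" "r > 0" shows "rotate_by K (gcd r K) f = f"
proof -
  obtain x y where "r * x = K * y + gcd r K" using bezout_nat[of r K] assms(3) by auto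
  hence "rotate_by K (r * x) f = rotate_by K (gcd r K + K * y) f" by (simp add: add.commute)
  also have "\<dots> = rotate_by K (gcd r K) f"
    unfolding rotate_by_add[symmetric] by (simp only: rotate_by_fixed_mult[OF rotate_by_K])
  finally show ?thesis using rotate_by_fixed_mult[OF assms(1)] by simp
qed

text \<open>Rotation by \<open>i\<close> brings position \<open>K - i\<close> to 0, so the rotations
  that show the required chord at 0 correspond to the positions \<open>z\<close> whose chord
  advances by \<open>c\<close>.\<close>

lemma card_rotations_chord:
  assumes f: "f permutes {..<K}" and c: "c < K"
  shows "card {i. i < K \<and> rotate_by K i f 0 = c} = card {z. z < K \<and> f z = (z + c) mod K}"
proof -
  let ?h = "\<lambda>i. (K - i) mod K"
  have K: "K > 0" using c by simp
  have hh: "?h (?h i) = i" if "i < K" for i using that by (cases "i = 0") auto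
  have eq: "rotate_by K i f 0 = c \<longleftrightarrow> f (?h i) = (?h i + c) mod K" if i: "i < K" for i
  proof -
    have z: "?h i < K" "f (?h i) < K" using K permutes_in_image[OF f, of "?h i"] by auto
    have z0: "(?h i + i) mod K = 0" using i by (cases "i = 0") auto
    have "rotate_by K i f 0 = (f (?h i) + i) mod K"
      using rotate_by_apply[of K i f "?h i"] z z0 by (simp add: funpow_rotation)
    moreover have "(f (?h i) + i) mod K = c \<longleftrightarrow> f (?h i) = (?h i + c) mod K"
    proof
      assume "(f (?h i) + i) mod K = c"
      hence "(?h i + c) mod K = (?h i + (f (?h i) + i)) mod K" by (metis mod_add_right_eq)
      also have "\<dots> = (f (?h i) + (?h i + i) mod K) mod K" by (metis add.left_commute mod_add_right_eq)
      finally show "f (?h i) = (?h i + c) mod K" using z0 z by simp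
    next
      assume "f (?h i) = (?h i + c) mod K"
      hence "(f (?h i) + i) mod K = (c + (?h i + i) mod K) mod K"
        by (metis add.commute add.left_commute mod_add_left_eq)
      thus "(f (?h i) + i) mod K = c" using z0 c by simp
    qed
    ultimately show ?thesis by simp
  qed
  have "bij_betw ?h {i. i < K \<and> rotate_by K i f 0 = c} {z. z < K \<and> f z = (z + c) mod K}"
  proof (rule bij_betw_byWitness[where f' = ?h])
    show "?h ` {i. i < K \<and> rotate_by K i f 0 = c} \<subseteq> {z. z < K \<and> f z = (z + c) mod K}"
      using eq K by auto
    show "?h ` {z. z < K \<and> f z = (z + c) mod K} \<subseteq> {i. i < K \<and> rotate_by K i f 0 = c}"
    proof
      fix i assume "i \<in> ?h ` {z. z < K \<and> f z = (z + c) mod K}"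
      then obtain z where z: "z < K" "f z = (z + c) mod K" "i = ?h z" by auto
      have iK: "i < K" using z(3) K by simp
      have "?h i = z" using hh[OF z(1)] z(3) by simp
      hence "rotate_by K i f 0 = c" using eq[OF iK] z(2) by simp
      thus "i \<in> {i. i < K \<and> rotate_by K i f 0 = c}" using iK by simp
    qed
  qed (use hh in auto)
  thus ?thesis by (rule bij_betw_same_card)
qed

lemma card_periodic_set:
  fixes B :: "nat set"
  assumes B: "B \<subseteq> {..<q * g}" and per: "\<And>x. x + g < q * g \<Longrightarrow> x + g \<in> B \<longleftrightarrow> x \<in> B"
  shows "card B = q * card (B \<inter> {..<g})"
proof -
  have mem: "x + g * m \<in> B \<longleftrightarrow> x \<in> B" if "x < g" "m < q" for x m
    using that(2)
  proof (induct m)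
    case (Suc m)
    have "x + g * m + g < g + g * m + g" using that(1) by simp
    also have "\<dots> = Suc (Suc m) * g" by simp
    also have "\<dots> \<le> q * g" by (rule mult_le_mono1) (use Suc in simp)
    finally show ?case using per[of "x + g * m"] Suc by (simp add: ac_simps)
  qed simp
  have "bij_betw (\<lambda>(x, m). x + g * m) ((B \<inter> {..<g}) \<times> {..<q}) B"
  proof (rule bij_betw_byWitness[where f' = "\<lambda>y. (y mod g, y div g)"])
    show "(\<lambda>y. (y mod g, y div g)) ` B \<subseteq> (B \<inter> {..<g}) \<times> {..<q}"
    proof
      fix p assume "p \<in> (\<lambda>y. (y mod g, y div g)) ` B"
      then obtain y where y: "y \<in> B" "p = (y mod g, y div g)" by auto
      have yq: "y < q * g" using y(1) B by auto
      hence "g > 0" by (cases g) auto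
      hence *: "y mod g < g" "y div g < q" using yq by (auto simp: div_less_iff_less_mult)
      have "y mod g \<in> B" using mem[OF *] y(1) by simp
      thus "p \<in> (B \<inter> {..<g}) \<times> {..<q}" using * y(2) by simp
    qed
  qed (use mem in auto)
  from bij_betw_same_card[OF this] show ?thesis by (simp add: card_cartesian_product mult.commute)
qed

locale cubic_tree =
  fixes n :: nat and f :: "nat \<Rightarrow> nat"
  assumes n: "n \<ge> 1" and tree: "f \<in> cubic_trees (6 * n)"
begin

abbreviation "K \<equiv> 6 * n"
abbreviation "\<sigma> x \<equiv> rotation K (f x)"

lemmas F = cubic_treesD[OF tree]

lemma no_crossing: "x < y \<Longrightarrow> y < f x \<Longrightarrow> f x < f y \<Longrightarrow> False"
  using F(5) unfolding noncrossing_def by blast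

lemma sigma_lt: "x < K \<Longrightarrow> \<sigma> x < K"
  using permutes_in_image[OF rotation_permutes[of K], of "f x"] F(3)[of x] by simp

lemma sigma_eq: "x < K \<Longrightarrow> \<sigma> x = (f x + 1) mod K"
  using F(3)[of x] by (simp add: rotation_def)

text \<open>Half of the circle is \<open>3 * n\<close>: these darts lie on an edge that a half-turn
  could reverse.\<close>

definition "diameters = {z. z < K \<and> f z = (z + 3 * n) mod K}"

lemma diameter_rep:
  assumes "z \<in> diameters" shows "\<exists>a<3 * n. f a = a + 3 * n \<and> (z = a \<or> z = a + 3 * n)"
proof (cases "z < 3 * n")
  case True
  thus ?thesis using assms by (intro exI[of _ z]) (auto simp: diameters_def)
next
  case False
  hence z: "z < K" "f z = z - 3 * n" using assms by (auto simp: diameters_def mod_if)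
  hence "f (z - 3 * n) = z" using F(2)[of z] by simp
  thus ?thesis using z False by (intro exI[of _ "z - 3 * n"]) auto
qed

text \<open>Two distinct diameters would cross.\<close>

lemma diameters_eq:
  assumes a: "a < 3 * n" "f a = a + 3 * n"
  shows "diameters = {a, a + 3 * n}"
proof
  show "{a, a + 3 * n} \<subseteq> diameters"
    using a F(2)[of a] by (auto simp: diameters_def mod_if)
  show "diameters \<subseteq> {a, a + 3 * n}"
  proof
    fix z assume "z \<in> diameters"
    from diameter_rep[OF this] obtain b where b: "b < 3 * n" "f b = b + 3 * n" "z = b \<or> z = b + 3 * n" by blast
    have "a = b"
    proof (rule ccontr)
      assume "a \<noteq> b"
      thus False using no_crossing[of a b] no_crossing[of b a] a b by (cases "a < b") auto
    qed
    thus "z \<in> {a, a + 3 * n}" using b by auto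
  qed
qed

lemma card_diameters: "diameters \<noteq> {} \<Longrightarrow> card diameters = 2"
proof -
  assume "diameters \<noteq> {}"
  then obtain a where a: "a < 3 * n" "f a = a + 3 * n" using diameter_rep by blast
  show ?thesis unfolding diameters_eq[OF a] using n by simp
qed

end

section \<open>The quotient of a tree by a rotation\<close>

locale periodic_cubic_tree = cubic_tree +
  fixes g q :: nat
  assumes g: "0 < g" "6 * n = q * g" "q > 1" and per: "rotate_by K g f = f"
begin

lemma shift: "x < K \<Longrightarrow> f ((x + g) mod K) = (f x + g) mod K"
  using rotate_by_fixed[OF per] F(3) by simp

lemma shift_mult: "x < K \<Longrightarrow> f ((x + g * m) mod K) = (f x + g * m) mod K"
  using rotate_by_fixed[OF rotate_by_fixed_mult[OF per]] F(3) by simp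

lemma sigma_shift_mult: "x < K \<Longrightarrow> \<sigma> ((x + g * m) mod K) = (\<sigma> x + g * m) mod K"
proof -
  assume x: "x < K"
  have "\<sigma> ((x + g * m) mod K) = ((f x + g * m) mod K + 1) mod K"
    using sigma_eq[of "(x + g * m) mod K"] shift_mult[OF x] n by simp
  also have "\<dots> = ((f x + 1) mod K + g * m) mod K" by (simp add: mod_simps add.commute add.left_commute)
  finally show ?thesis using sigma_eq[OF x] by simp
qed

lemma gK: "g < K" "g dvd K"
  using g by auto

text \<open>Residues modulo \<open>g\<close> represent the darts of the quotient, to which both the
  edge involution and the vertex rotation descend.\<close>

lemma mod_g: "x < K \<Longrightarrow> f (x mod g) mod g = f x mod g" "x < K \<Longrightarrow> \<sigma> (x mod g) mod g = \<sigma> x mod g"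
proof -
  assume x: "x < K"
  have xg: "x mod g < K" using x by (meson le_less_trans mod_less_eq_dividend)
  have e: "(x mod g + g * (x div g)) mod K = x" using x by simp
  have m: "(y + g * m) mod K mod g = y mod g" for y m using gK(2) by (simp add: mod_mod_cancel)
  show "f (x mod g) mod g = f x mod g" using shift_mult[OF xg, of "x div g"] m[of "f (x mod g)" "x div g"] e by simp
  show "\<sigma> (x mod g) mod g = \<sigma> x mod g" using sigma_shift_mult[OF xg, of "x div g"] m[of "\<sigma> (x mod g)" "x div g"] e by simp
qed

lemma card_moved: "card {x. x < K \<and> f x \<noteq> x} = q * card ({x. x < K \<and> f x \<noteq> x} \<inter> {..<g})"
proof (rule card_periodic_set)
  show "{x. x < K \<and> f x \<noteq> x} \<subseteq> {..<q * g}" using g by auto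
  fix x assume "x + g < q * g"
  hence x: "x + g < K" using g by simp
  hence "f (x + g) = (f x + g) mod K" using shift[of x] by simp
  moreover have "(f x + g) mod K = x + g \<longleftrightarrow> f x = x"
  proof
    assume eq: "(f x + g) mod K = x + g"
    have "f x < K" using F(3) x by simp
    thus "f x = x" using eq x gK(1) by (auto simp: mod_if split: if_splits)
  qed (use x in simp)
  ultimately show "x + g \<in> {x. x < K \<and> f x \<noteq> x} \<longleftrightarrow> x \<in> {x. x < K \<and> f x \<noteq> x}" using x by auto
qed

lemma card_moved_eq: "q * card ({x. x < K \<and> f x \<noteq> x} \<inter> {..<g}) + 2 = 4 * n"
  using card_cubic_tree(1)[OF tree n] card_moved by simp

text \<open>The edge involution stays fixed-point-free on the quotient: an edge whose ends become
  equal advances by some \<open>d\<close> with \<open>2 * d\<close> divisible by \<open>K\<close>,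
  so it is a diameter.\<close>

lemma even_moved:
  assumes "diameters = {}" shows "even (card ({x. x < K \<and> f x \<noteq> x} \<inter> {..<g}))"
proof -
  let ?B = "{x. x < K \<and> f x \<noteq> x} \<inter> {..<g}"
  let ?h = "\<lambda>x. if x \<in> ?B then f x mod g else x"
  have "matching_on ?B ?h"
  proof (rule matching_onI)
    fix x assume x: "x \<in> ?B"
    hence xK: "x < K" "x < g" "f x \<noteq> x" "f x < K" using F(3) by auto
    have hK: "f x mod g < K" using g gK by (meson less_trans mod_less_divisor)
    have h1: "f (f x mod g) mod g = x" using mod_g(1)[OF xK(4)] F(2)[of x] xK by simp
    have ne: "f x mod g \<noteq> x"
    proof
      assume m: "f x mod g = x"
      define d where "d = g * (f x div g)"
      have fx: "f x = x + d" unfolding d_def using m by (metis mod_mult_div_eq)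
      have "f ((x + d) mod K) = (f x + d) mod K" unfolding d_def by (rule shift_mult[OF xK(1)])
      hence "(x + d + d) mod K = x" using fx xK(4) F(2)[of x] by simp
      moreover have "0 < d" "d < K" using fx xK by auto
      ultimately have "d = 3 * n" using xK(1) fx xK(4) by (auto simp: mod_if split: if_splits)
      hence "x \<in> diameters" using fx xK unfolding diameters_def by simp
      thus False using assms by simp
    qed
    have "f (f x mod g) \<noteq> f x mod g"
    proof
      assume "f (f x mod g) = f x mod g"
      hence "f x mod g = x" using h1 by simp
      thus False using ne by simp
    qed
    hence "f x mod g \<in> ?B" using hK g by simp
    thus "?h x \<in> ?B" "?h x \<noteq> x" "?h (?h x) = x" using x ne h1 by auto
  qed auto
  thus ?thesis by (rule even_card_matching[rotated]) simp
qed

text \<open>If \<open>\<sigma> x\<close> and \<open>x\<close> agree modulo the period,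
  \<open>\<sigma>\<close> acts around this vertex as a shift by some \<open>d\<close>, and since
  three applications are trivial, \<open>3 * d\<close> is a multiple of
  \<open>6 * n\<close>.\<close>

lemma sigma_center_dist:
  assumes x: "x < g" "\<sigma> x mod g = x"
  shows "\<exists>m. (g * m = 2 * n \<or> g * m = 4 * n) \<and> \<sigma> x = x + g * m"
proof -
  define d where "d = g * (\<sigma> x div g)"
  have xK: "x < K" using x gK by simp
  have s: "\<sigma> x = x + d" unfolding d_def using x(2) by (metis mod_mult_div_eq)
  have sK: "\<sigma> x < K" by (rule sigma_lt[OF xK])
  have "\<sigma> ((x + d) mod K) = (\<sigma> x + d) mod K" unfolding d_def by (rule sigma_shift_mult[OF xK])
  hence s2: "\<sigma> (\<sigma> x) = (x + 2 * d) mod K" using s sK by (simp add: add.assoc mult_2)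
  have "\<sigma> ((x + d * 2) mod K) = (\<sigma> x + d * 2) mod K"
    using sigma_shift_mult[OF xK, of "\<sigma> x div g * 2"] unfolding d_def by (simp only: mult.assoc)
  hence "(x + 3 * d) mod K = x" using F(7)[OF xK] s s2 by (simp add: mult.commute add.assoc)
  moreover have "0 < d" "d < K" using s sK F(6)[OF xK] by auto
  moreover have "x + d < K" using s sK by simp
  ultimately have "d = 2 * n \<or> d = 4 * n" using xK by (auto simp: mod_if split: if_splits)
  thus ?thesis using s unfolding d_def by blast
qed

text \<open>When no vertex is fixed, the vertex rotation still has only 3-cycles on the quotient,
  and they partition the \<open>g\<close> residues.\<close>

lemma three_dvd_period:
  assumes "\<And>x. x < g \<Longrightarrow> \<sigma> x mod g \<noteq> x" shows "3 dvd g"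
proof -
  define h where "h = (\<lambda>x. if x < g then \<sigma> x mod g else x)"
  have h3: "h (h (h x)) = x" for x
  proof (cases "x < g")
    case True
    hence xK: "x < K" using gK by simp
    note s1 = sigma_lt[OF xK] and s2 = sigma_lt[OF sigma_lt[OF xK]]
    have "h (h x) = \<sigma> (\<sigma> x) mod g" using True g mod_g(2)[OF s1] by (simp add: h_def)
    hence "h (h (h x)) = \<sigma> (\<sigma> (\<sigma> x)) mod g" using g(1) mod_g(2)[OF s2] by (simp add: h_def)
    thus ?thesis using F(7)[OF xK] True by simp
  qed (simp add: h_def)
  have "h permutes {..<g}" unfolding permutes_def
  proof (intro conjI allI impI)
    fix y show "\<exists>!x. h x = y" 
    proof (rule ex1I[of _ "h (h y)"])
      fix x assume "h x = y"
      thus "x = h (h y)" using h3[of x] by simp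
    qed (rule h3)
  qed (simp add: h_def)
  hence "3 * card (orbit h ` {..<g}) = card {..<g}"
  proof (rule card_orbits_mult[OF finite_lessThan])
    fix x assume "x \<in> {..<g}"
    hence "h x \<noteq> x" using assms by (simp add: h_def)
    thus "card (orbit h x) = 3" using card_orbit_3[of h x] h3[of x] by blast
  qed
  thus ?thesis by (metis card_lessThan dvd_triv_left)
qed

end

section \<open>Central vertices and the possible symmetries\<close>

context cubic_tree
begin

text \<open>A third of a turn about a vertex takes each of its darts \<open>2 * n\<close> positions
  further, to the next dart there. The vertex rotation is one step beyond \<open>f\<close>, hence
  \<open>2 * n - 1\<close>.\<close>

definition "centers = {z. z < K \<and> f z = (z + (2 * n - 1)) mod K}"

lemma shift_fixed: "rotate_by K r f = f \<Longrightarrow> x < K \<Longrightarrow> f ((x + r) mod K) = (f x + r) mod K"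
  using rotate_by_fixed[of K r f x] F(3) by simp

lemma sigma_centers:
  assumes "x < K" "\<sigma> x = x + 2 * n" shows "x \<in> centers"
proof -
  have "\<sigma> x < K" by (rule sigma_lt[OF assms(1)])
  hence "(f x + 1) mod K = x + 2 * n" "x + 2 * n < K" "f x < K"
    using assms sigma_eq[of x] F(3)[of x] by auto
  hence "f x = x + (2 * n - 1)" using n by (auto simp: mod_if split: if_splits)
  thus ?thesis using assms(1) \<open>x + 2 * n < K\<close> by (simp add: centers_def)
qed

lemma center_rep:
  assumes per: "rotate_by K (2 * n) f = f" and z: "z \<in> centers"
  shows "\<exists>a<2 * n. f a = a + (2 * n - 1) \<and> (z = a \<or> z = a + 2 * n \<or> z = a + 4 * n)"
proof -
  have zK: "z < K" "f z = (z + (2 * n - 1)) mod K" using z by (auto simp: centers_def)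
  have sh: "f ((z + 2 * n * m) mod K) = (f z + 2 * n * m) mod K" for m
    by (rule shift_fixed[OF rotate_by_fixed_mult[OF per] zK(1)])
  consider "z < 2 * n" | "2 * n \<le> z" "z < 4 * n" | "4 * n \<le> z" by linarith
  thus ?thesis
  proof cases
    case 1
    thus ?thesis using zK by (intro exI[of _ z]) simp
  next
    case 2
    have "(z + 2 * n * 2) mod K = z - 2 * n" using 2 by (simp add: mod_if)
    moreover have "f ((z + 2 * n * 2) mod K) = (z + (2 * n - 1) + 2 * n * 2) mod K"
      unfolding sh[of 2] zK(2) by (rule mod_add_left_eq)
    moreover have "(z + (2 * n - 1) + 2 * n * 2) mod K = z - 2 * n + (2 * n - 1)" using 2 n by (simp add: mod_if)
    ultimately show ?thesis using 2 by (intro exI[of _ "z - 2 * n"]) auto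
  next
    case 3
    have "(z + 2 * n * 1) mod K = z - 4 * n" using 3 zK by (simp add: mod_if)
    moreover have "f ((z + 2 * n * 1) mod K) = (z + (2 * n - 1) + 2 * n * 1) mod K"
      unfolding sh[of 1] zK(2) by (rule mod_add_left_eq)
    moreover have "(z + (2 * n - 1) + 2 * n * 1) mod K = z - 4 * n + (2 * n - 1)" using 3 n zK by (simp add: mod_if)
    ultimately show ?thesis using 3 zK by (intro exI[of _ "z - 4 * n"]) auto
  qed
qed

lemma centers_eq:
  assumes per: "rotate_by K (2 * n) f = f" and a: "a < 2 * n" "f a = a + (2 * n - 1)"
  shows "centers = {a, a + 2 * n, a + 4 * n}"
proof
  have aK: "a < K" using a by simp
  have sh: "f ((a + 2 * n * m) mod K) = (a + (2 * n - 1) + 2 * n * m) mod K" for m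
    using shift_fixed[OF rotate_by_fixed_mult[OF per] aK] a(2) by simp
  have "(a + 2 * n * 1) mod K = a + 2 * n" "(a + 2 * n * 2) mod K = a + 4 * n"
    "a + (2 * n - 1) + 2 * n * 1 = a + 2 * n + (2 * n - 1)" "a + (2 * n - 1) + 2 * n * 2 = a + 4 * n + (2 * n - 1)"
    using a by simp_all
  hence "f (a + 2 * n) = (a + 2 * n + (2 * n - 1)) mod K" "f (a + 4 * n) = (a + 4 * n + (2 * n - 1)) mod K"
    using sh[of 1] sh[of 2] by (simp_all only:)
  thus "{a, a + 2 * n, a + 4 * n} \<subseteq> centers"
    using a by (simp add: centers_def)
  show "centers \<subseteq> {a, a + 2 * n, a + 4 * n}"
  proof
    fix z assume "z \<in> centers"
    from center_rep[OF per this] obtain b where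
      b: "b < 2 * n" "f b = b + (2 * n - 1)" "z = b \<or> z = b + 2 * n \<or> z = b + 4 * n" by blast
    have no: False if xy: "x < y" "y < 2 * n" "f x = x + (2 * n - 1)" "f y = y + (2 * n - 1)" for x y
    proof (cases "y < f x")
      case True
      moreover have "f x < f y" using xy by linarith
      ultimately show False using no_crossing[of x y] xy(1) by simp
    next
      \<comment> \<open>The two chords fail to alternate only when \<open>y\<close> is the other end
        of the chord from \<open>x\<close>.\<close>
      case False
      hence xy0: "x = 0" "y = 2 * n - 1" using xy by linarith+
      hence "f x = y" using xy(3) by simp
      hence "f y = 0" using F(2)[of x] xy0(1) by simp
      thus False using xy(1,4) by simp
    qed
    have "a = b" using no[of a b] no[of b a] a b by (cases a b rule: linorder_cases) auto
    thus "z \<in> {a, a + 2 * n, a + 4 * n}" using b by auto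
  qed
qed

lemma card_centers: "rotate_by K (2 * n) f = f \<Longrightarrow> centers \<noteq> {} \<Longrightarrow> card centers = 3"
proof -
  assume per: "rotate_by K (2 * n) f = f" and "centers \<noteq> {}"
  then obtain a where a: "a < 2 * n" "f a = a + (2 * n - 1)" using center_rep by blast
  show ?thesis unfolding centers_eq[OF per a] using n by simp
qed

text \<open>Chords spanning two thirds of the circle would have to occur in all three rotated
  copies, and neighbouring copies cross. So the darts of the central vertex are met in contour
  order.\<close>

lemma no_reversed_center:
  assumes per: "rotate_by K (2 * n) f = f" and a: "a < 2 * n" "f a = a + (4 * n - 1)"
  shows False
proof (cases "a = 0")
  case True
  have "f ((a + 2 * n) mod K) = (f a + 2 * n) mod K" by (rule shift_fixed[OF per]) (use a in simp)
  hence "f (2 * n) = 6 * n - 1" using a True n by (simp add: mod_if split: if_splits)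
  moreover have "f 0 = 4 * n - 1" using a True by simp
  ultimately have "2 * n < f 0" "f 0 < f (2 * n)" using n by linarith+
  thus False using no_crossing[of 0 "2 * n"] n by simp
next
  case False
  have "f ((a + 2 * n) mod K) = (f a + 2 * n) mod K" by (rule shift_fixed[OF per]) (use a in simp)
  hence "f (a + 2 * n) = (a + (4 * n - 1) + 2 * n) mod K" using a by simp
  also have "a + (4 * n - 1) + 2 * n = a - 1 + K" using False n by simp
  also have "(a - 1 + K) mod K = a - 1" using a by simp
  finally have "f (a - 1) = a + 2 * n" using F(2)[of "a + 2 * n"] by simp
  hence "a < f (a - 1)" "f (a - 1) < f a" using n a(2) by linarith+
  thus False using no_crossing[of "a - 1" a] False by simp
qed

text \<open>Pass to the period \<open>g = gcd r K\<close>, of order \<open>q\<close>. If the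
  rotation fixes neither an edge nor a vertex, the quotient has \<open>e\<close> edges and
  \<open>c\<close> vertices with \<open>q * e = 2 * n - 1\<close> and \<open>q * c = 2 * n\<close>,
  so \<open>q\<close> divides 1. A fixed edge or vertex is unique, and \<open>r\<close> has to
  preserve it, which leaves the three listed values.\<close>

lemma symmetry_cases:
  assumes r: "0 < r" "r < K" and fix_r: "rotate_by K r f = f"
  shows "r = 3 * n \<and> diameters \<noteq> {} \<or>
    (r = 2 * n \<or> r = 4 * n) \<and> rotate_by K (2 * n) f = f \<and> centers \<noteq> {}"
proof -
  define g where "g = gcd r K"
  have g0: "g > 0" "g dvd K" "g \<le> r" using r by (auto simp: g_def intro: gcd_le1_nat)
  then obtain q where q: "K = q * g" by (metis dvd_def mult.commute)
  have q1: "q > 1" using q g0 r n by (cases q; cases "q - 1") auto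
  have gper: "rotate_by K g f = f" unfolding g_def by (rule rotate_by_fixed_gcd[OF fix_r _ r(1)]) (use n in simp)
  interpret periodic_cubic_tree n f g q
    by unfold_locales (use g0 q q1 gper in auto)
  show ?thesis
  proof (cases "diameters = {}")
    case False
    then obtain a where a: "a < 3 * n" "f a = a + 3 * n" using diameter_rep by blast
    have "f ((a + r) mod K) = (f a + r) mod K" by (rule shift_fixed[OF fix_r]) (use a in simp)
    moreover have "a + 3 * n + r = a + r + 3 * n" by simp
    ultimately have "f ((a + r) mod K) = ((a + r) mod K + 3 * n) mod K"
      unfolding a(2) mod_add_left_eq by simp
    hence "(a + r) mod K \<in> diameters" using n by (simp add: diameters_def)
    hence "(a + r) mod K = a \<or> (a + r) mod K = a + 3 * n" using diameters_eq[OF a] by simp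
    hence "r = 3 * n" using r a by (auto simp: mod_if split: if_splits)
    thus ?thesis using False by simp
  next
    case nodiam: True
    show ?thesis
    proof (cases "\<exists>x<g. \<sigma> x mod g = x")
      case True
      then obtain x where x: "x < g" "\<sigma> x mod g = x" by blast
      have xK: "x < K" using x gK by simp
      obtain m where m: "g * m = 2 * n \<or> g * m = 4 * n" "\<sigma> x = x + g * m"
        using sigma_center_dist[OF x] by blast
      note pm = rotate_by_fixed_mult[OF gper, of m]
      have per2: "rotate_by K (2 * n) f = f"
      proof (cases "g * m = 2 * n")
        case True thus ?thesis using pm by simp
      next
        case False
        hence "rotate_by K (4 * n) f = f" using m pm by simp
        from rotate_by_fixed_mult[OF this, of 2] have "rotate_by K ((4 * n * 2) mod K) f = f" unfolding rotate_by_mod .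
        moreover have "(4 * n * 2) mod K = 2 * n" using n by (simp add: mod_if)
        ultimately show ?thesis by (simp only:)
      qed
      have "x \<in> centers"
      proof (cases "g * m = 2 * n")
        case True thus ?thesis using sigma_centers[OF xK] m by simp
      next
        case False
        hence s: "\<sigma> x = x + 4 * n" using m by simp
        hence "(f x + 1) mod K = x + 4 * n" "x + 4 * n < K" "f x < K"
          using sigma_eq[OF xK] sigma_lt[OF xK] F(3)[of x] xK by auto
        hence "f x = x + (4 * n - 1)" "x < 2 * n" using n by (auto simp: mod_if split: if_splits)
        thus ?thesis using no_reversed_center[OF per2] by blast
      qed
      then obtain a where a: "a < 2 * n" "f a = a + (2 * n - 1)" using center_rep[OF per2] by blast
      have "f ((a + r) mod K) = (f a + r) mod K" by (rule shift_fixed[OF fix_r]) (use a in simp)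
      moreover have "a + (2 * n - 1) + r = a + r + (2 * n - 1)" by simp
      ultimately have "f ((a + r) mod K) = ((a + r) mod K + (2 * n - 1)) mod K"
        unfolding a(2) mod_add_left_eq by (simp only:)
      hence "(a + r) mod K \<in> centers" using n by (simp add: centers_def)
      hence "(a + r) mod K = a \<or> (a + r) mod K = a + 2 * n \<or> (a + r) mod K = a + 4 * n"
        using centers_eq[OF per2 a] by simp
      hence "r = 2 * n \<or> r = 4 * n" using r a by (auto simp: mod_if split: if_splits)
      thus ?thesis using per2 \<open>x \<in> centers\<close> by blast
    next
      case False
      hence "3 dvd g" by (intro three_dvd_period) blast
      then obtain c where c: "g = 3 * c" by blast
      obtain e where e: "card ({x. x < K \<and> f x \<noteq> x} \<inter> {..<g}) = 2 * e" using even_moved[OF nodiam] by blast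
      have "q * (2 * e) + 2 = 4 * n" using card_moved_eq unfolding e .
      hence "q * e + 1 = 2 * n" by simp
      also have "2 * n = q * c" using q c by simp
      finally have "q dvd 1" by (metis dvd_add_right_iff dvd_triv_left)
      thus ?thesis using q1 by simp
    qed
  qed
qed

end

text \<open>\<open>k\<close> is the number of darts that may be moved to position 0: the
  \<open>2 * n + 2\<close> free darts, the three darts of the central vertex, or the two of the
  central edge. \<open>c\<close> is the partner that position 0 then has in the tree.\<close>

lemma card_fixed_diagrams:
  assumes n: "n \<ge> 1" and s: "s = 0 \<or> s = 2 * n \<or> s = 3 * n"
  defines "c \<equiv> if s = 0 then 0 else if s = 2 * n then 2 * n - 1 else 3 * n"
    and "k \<equiv> if s = 0 then 2 * n + 2 else if s = 2 * n then 3 else 2"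
  shows "k * card {S \<in> diagrams (6 * n). rotate_diagram (6 * n) s S = S} =
    6 * n * card {S \<in> diagrams (6 * n). rotate_diagram (6 * n) s S = S \<and> fst S 0 = c}"
proof -
  let ?K = "6 * n" and ?X = "{S \<in> diagrams (6 * n). rotate_diagram (6 * n) s S = S}"
  have K: "?K > 0" using n by simp
  interpret D: cyclic_action "diagrams ?K" ?K "rotate_diagram ?K" by (rule cyclic_action_diagrams[OF K])
  interpret X: cyclic_action ?X ?K "rotate_diagram ?K"
  proof
    fix r S assume S: "S \<in> ?X"
    have "rotate_diagram ?K s (rotate_diagram ?K r S) = rotate_diagram ?K r (rotate_diagram ?K s S)"
      using S D.act_add[of S s r] D.act_add[of S r s] by (simp add: add.commute[of s r])
    thus "rotate_diagram ?K r S \<in> ?X" using S D.act by simp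
  qed (use D.fin K D.act0 D.actK D.act_add in auto)
  have "k * card ?X = ?K * card {S \<in> ?X. fst S 0 = c}"
  proof (rule X.average)
    fix S assume S: "S \<in> ?X"
    obtain f g where fg: "S = (f, g)" by (cases S)
    have fT: "f \<in> cubic_trees ?K" using S diagramsD(1) by (auto simp: fg)
    have per: "rotate_by ?K s f = f" using S by (simp add: fg rotate_diagram_def)
    interpret cubic_tree n f by unfold_locales (rule n, rule fT)
    have cK: "c < ?K" using n by (simp add: c_def) linarith
    have "card {r. r < ?K \<and> fst (rotate_diagram ?K r S) 0 = c} = card {z. z < ?K \<and> f z = (z + c) mod ?K}"
      using card_rotations_chord[OF F(1) cK] by (simp add: fg rotate_diagram_def)
    also have "\<dots> = k"
    proof -
      consider "s = 0" | "s = 2 * n" | "s = 3 * n" using s by blast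
      thus ?thesis
      proof cases
        case 1
        have "{z. z < ?K \<and> f z = (z + c) mod ?K} = {z. z < ?K \<and> f z = z}" using 1 by (auto simp: c_def)
        thus ?thesis using card_cubic_tree(2)[OF tree n] 1 by (simp add: k_def)
      next
        case 2
        have "rotate_by K (2 * n) f = f" using per 2 by simp
        from symmetry_cases[OF _ _ this] card_centers[OF this] have "card centers = 3" using n by auto
        thus ?thesis using 2 n by (simp add: k_def c_def centers_def)
      next
        case 3
        have "rotate_by K (3 * n) f = f" using per 3 by simp
        from symmetry_cases[OF _ _ this] card_diameters have "card diameters = 2" using n by auto
        thus ?thesis using 3 n by (simp add: k_def c_def diameters_def)
      qed
    qed
    finally show "card {r. r < ?K \<and> fst (rotate_diagram ?K r S) 0 = c} = k" .
  qed
  thus ?thesis by (simp add: conj_assoc)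
qed

definition "rooted_diagrams n s c = {S \<in> diagrams (6 * n). rotate_diagram (6 * n) s S = S \<and> fst S 0 = c}"

text \<open>The three averages have denominators \<open>2 * n + 2\<close>, 2 and 3, cleared by the
  factor \<open>6 * (n + 1)\<close>. The last coefficient contains a 2 because two rotations turn
  about a vertex.\<close>

lemma num_tree_rooted_eq:
  assumes n: "n \<ge> 1"
  shows "3 * (2 * n + 2) * num_tree_rooted n = 3 * card (rooted_diagrams n 0 0)
    + 3 * (n + 1) * card (rooted_diagrams n (3 * n) (3 * n)) + 4 * (n + 1) * card (rooted_diagrams n (2 * n) (2 * n - 1))"
proof -
  let ?K = "6 * n"
  have K: "?K > 0" using n by simp
  interpret D: cyclic_action "diagrams ?K" ?K "rotate_diagram ?K" by (rule cyclic_action_diagrams[OF K])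
  define X where "X r = {S \<in> diagrams ?K. rotate_diagram ?K r S = S}" for r
  have empty: "X r = {}" if r: "r < ?K" "r \<notin> {0, 2 * n, 3 * n, 4 * n}" for r
  proof (rule ccontr)
    assume "X r \<noteq> {}"
    then obtain f g where fg: "(f, g) \<in> diagrams ?K" "rotate_diagram ?K r (f, g) = (f, g)" unfolding X_def by auto
    interpret cubic_tree n f by unfold_locales (rule n, rule diagramsD(1)[OF fg(1)])
    have "rotate_by ?K r f = f" using fg(2) by (simp add: rotate_diagram_def)
    thus False using symmetry_cases[of r] r by auto
  qed
  \<comment> \<open>The two third-turns generate each other: \<open>2 * (4 * n)\<close> exceeds a
    full turn by \<open>2 * n\<close>.\<close>
  have X4: "X (4 * n) = X (2 * n)"
  proof -
    have "rotate_diagram ?K (2 * n) S = S" if "S \<in> diagrams ?K" "rotate_diagram ?K (4 * n) S = S" for S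
    proof -
      have "rotate_diagram ?K ((4 * n * 2) mod ?K) S = S" using D.act_mod[OF that(1), of "4 * n * 2"] D.act_mult[OF that, of 2] by (simp only:)
      moreover have "(4 * n * 2) mod ?K = 2 * n" using n by (simp add: mod_if)
      ultimately show ?thesis by (simp only:)
    qed
    moreover have "rotate_diagram ?K (4 * n) S = S" if "S \<in> diagrams ?K" "rotate_diagram ?K (2 * n) S = S" for S
    proof -
      have "rotate_diagram ?K (2 * n * 2) S = S" by (rule D.act_mult[OF that])
      thus ?thesis by simp
    qed
    ultimately show ?thesis unfolding X_def by blast
  qed
  have "?K * num_tree_rooted n = (\<Sum>r<?K. card (X r))" unfolding X_def by (rule num_tree_rooted_burnside[OF n])
  also have "\<dots> = (\<Sum>r\<in>{0, 2 * n, 3 * n, 4 * n}. card (X r))"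
    by (rule sum.mono_neutral_right) (use empty n in auto)
  also have "\<dots> = card (X 0) + card (X (3 * n)) + 2 * card (X (2 * n))" using n X4 by simp
  finally have t: "?K * num_tree_rooted n = card (X 0) + card (X (3 * n)) + 2 * card (X (2 * n))" .
  have c0: "(2 * n + 2) * card (X 0) = ?K * card (rooted_diagrams n 0 0)"
    using card_fixed_diagrams[OF n, of 0] unfolding X_def rooted_diagrams_def by simp
  have c3: "2 * card (X (3 * n)) = ?K * card (rooted_diagrams n (3 * n) (3 * n))"
    using card_fixed_diagrams[OF n, of "3 * n"] n unfolding X_def rooted_diagrams_def by simp
  have c2: "3 * card (X (2 * n)) = ?K * card (rooted_diagrams n (2 * n) (2 * n - 1))"
    using card_fixed_diagrams[OF n, of "2 * n"] n unfolding X_def rooted_diagrams_def by simp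
  have "?K * (3 * (2 * n + 2) * num_tree_rooted n) = 3 * (2 * n + 2) * (?K * num_tree_rooted n)" by (simp only: ac_simps)
  also have "\<dots> = 3 * ((2 * n + 2) * card (X 0)) + 3 * (n + 1) * (2 * card (X (3 * n))) + 4 * (n + 1) * (3 * card (X (2 * n)))"
    unfolding t by (simp add: algebra_simps)
  also have "\<dots> = ?K * (3 * card (rooted_diagrams n 0 0)
    + 3 * (n + 1) * card (rooted_diagrams n (3 * n) (3 * n)) + 4 * (n + 1) * card (rooted_diagrams n (2 * n) (2 * n - 1)))"
    unfolding c0 c2 c3 by (simp add: algebra_simps)
  finally show ?thesis using K by (simp only: mult_cancel1) simp
qed

section \<open>Catalan numbers and cubic trees\<close>

lemma catalan_fact: "catalan n = fact (2 * n) / (fact n * fact (Suc n))"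
  by (simp add: catalan_def binomial_fact field_simps mult_2[symmetric])

lemma catalan_Suc: "(real n + 2) * catalan (Suc n) = (4 * real n + 2) * catalan n"
proof -
  have "fact (2 * Suc n) = (2 * real n + 2) * (2 * real n + 1) * fact (2 * n)"
    by (simp add: algebra_simps)
  moreover have "fact (Suc n) = (real n + 1) * fact n" "fact (Suc (Suc n)) = (real n + 2) * ((real n + 1) * fact n)"
    by (simp_all add: algebra_simps)
  moreover have "real n + 1 \<noteq> 0" "real n + 2 \<noteq> 0" "(fact n :: real) \<noteq> 0" by auto
  ultimately show ?thesis unfolding catalan_fact by (simp add: divide_simps) (simp add: algebra_simps)
qed

lemma catalan_0: "catalan 0 = 1"
  by (simp add: catalan_def)

text \<open>Weighting the sum by \<open>i + 1\<close> and symmetrising turns it into the same first-order recurrence.\<close>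

lemma catalan_convolution: "(\<Sum>i\<le>n. catalan i * catalan (n - i)) = catalan (Suc n)"
proof (induction n)
  case 0
  show ?case using catalan_Suc[of 0] catalan_0 by simp
next
  case (Suc n)
  \<comment> \<open>Exchanging \<open>i\<close> and \<open>m - i\<close> replaces the weight by its
    average. It is applied with \<open>a = 1\<close> to the sum in question and with
    \<open>a = 1/2\<close> to the weights \<open>4 * i + 2\<close> that the recurrence
    produces.\<close>
  have sym: "2 * (\<Sum>i\<le>m. (real i + a) * (catalan i * catalan (m - i))) = (real m + 2 * a) * (\<Sum>i\<le>m. catalan i * catalan (m - i))" for m a
  proof -
    have "(\<Sum>i\<le>m. (real i + a) * (catalan i * catalan (m - i))) = (\<Sum>i\<le>m. (real (m - i) + a) * (catalan (m - i) * catalan i))"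
      by (rule sum.reindex_bij_witness[of _ "\<lambda>i. m - i" "\<lambda>i. m - i"]) auto
    hence "2 * (\<Sum>i\<le>m. (real i + a) * (catalan i * catalan (m - i))) =
      (\<Sum>i\<le>m. (real i + a) * (catalan i * catalan (m - i)) + (real (m - i) + a) * (catalan (m - i) * catalan i))"
      by (simp add: sum.distrib)
    also have "\<dots> = (\<Sum>i\<le>m. (real m + 2 * a) * (catalan i * catalan (m - i)))"
      by (rule sum.cong[OF refl]) (simp add: of_nat_diff algebra_simps)
    finally show ?thesis by (simp add: sum_distrib_left)
  qed
  let ?S = "\<Sum>i\<le>Suc n. catalan i * catalan (Suc n - i)"
  have "(\<Sum>i\<le>Suc n. (real i + 1) * (catalan i * catalan (Suc n - i))) =
      catalan (Suc n) + (\<Sum>i\<le>n. (real i + 2) * (catalan (Suc i) * catalan (n - i)))"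
    by (subst sum.atMost_Suc_shift) (simp add: catalan_0 add.commute)
  also have "(\<Sum>i\<le>n. (real i + 2) * (catalan (Suc i) * catalan (n - i))) = (\<Sum>i\<le>n. 4 * ((real i + 1/2) * (catalan i * catalan (n - i))))"
  proof (rule sum.cong[OF refl])
    fix i
    have "(real i + 2) * (catalan (Suc i) * catalan (n - i)) = (4 * real i + 2) * catalan i * catalan (n - i)"
      using catalan_Suc[of i] by (simp add: mult.assoc[symmetric])
    thus "(real i + 2) * (catalan (Suc i) * catalan (n - i)) = 4 * ((real i + 1/2) * (catalan i * catalan (n - i)))"
      by (simp add: algebra_simps)
  qed
  also have "\<dots> = 2 * ((real n + 1) * catalan (Suc n))"
    unfolding sum_distrib_left[symmetric] using sym[of "1/2" n] Suc.IH by simp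
  finally have "(real (Suc n) + 2) * ?S = 2 * (catalan (Suc n) + 2 * ((real n + 1) * catalan (Suc n)))"
    using sym[of 1 "Suc n"] by simp
  also have "\<dots> = (4 * real (Suc n) + 2) * catalan (Suc n)" by (simp add: algebra_simps)
  also have "\<dots> = (real (Suc n) + 2) * catalan (Suc (Suc n))" by (rule catalan_Suc[symmetric])
  finally show ?case by simp
qed

datatype btree = Leaf | Node btree btree

primrec nodes :: "btree \<Rightarrow> nat" where
  "nodes Leaf = 0"
| "nodes (Node l r) = Suc (nodes l + nodes r)"

lemma nodes_Suc: "{t. nodes t = Suc n} = (\<Union>i\<le>n. (\<lambda>(l, r). Node l r) ` ({t. nodes t = i} \<times> {t. nodes t = n - i}))"
proof (intro equalityI subsetI)
  fix t assume "t \<in> {t. nodes t = Suc n}"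
  then obtain l r where "t = Node l r" "nodes l + nodes r = n" by (cases t) auto
  thus "t \<in> (\<Union>i\<le>n. (\<lambda>(l, r). Node l r) ` ({t. nodes t = i} \<times> {t. nodes t = n - i}))"
    by (intro UN_I[of "nodes l"]) auto
qed auto

lemma finite_nodes: "finite {t. nodes t = n}"
proof (induction n rule: less_induct)
  case (less n)
  show ?case
  proof (cases n)
    case 0
    have "nodes t = 0 \<longleftrightarrow> t = Leaf" for t by (cases t) auto
    thus ?thesis using 0 by simp
  next
    case (Suc m)
    show ?thesis unfolding Suc nodes_Suc using less Suc by (intro finite_UN_I finite_imageI finite_cartesian_product) auto
  qed
qed

lemma card_nodes: "real (card {t. nodes t = n}) = catalan n"
proof (induction n rule: less_induct)
  case (less n)
  show ?case
  proof (cases n)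
    case 0
    have "nodes t = 0 \<longleftrightarrow> t = Leaf" for t by (cases t) auto
    thus ?thesis using 0 catalan_0 by simp
  next
    case (Suc m)
    let ?A = "\<lambda>i. (\<lambda>(l, r). Node l r) ` ({t. nodes t = i} \<times> {t. nodes t = m - i})"
    have "card (\<Union>i\<le>m. ?A i) = (\<Sum>i\<le>m. card (?A i))"
      by (rule card_UN_disjoint) (auto intro!: finite_nodes)
    also have "\<dots> = (\<Sum>i\<le>m. card {t. nodes t = i} * card {t. nodes t = m - i})"
      by (rule sum.cong[OF refl], subst card_image) (auto simp: inj_on_def card_cartesian_product)
    finally have "real (card {t. nodes t = n}) = (\<Sum>i\<le>m. real (card {t. nodes t = i}) * real (card {t. nodes t = m - i}))"
      unfolding Suc nodes_Suc by simp
    also have "\<dots> = (\<Sum>i\<le>m. catalan i * catalan (m - i))"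
      by (rule sum.cong[OF refl]) (use less Suc in simp)
    finally show ?thesis using catalan_convolution Suc by simp
  qed
qed

text \<open>
  A branch with \<open>N\<close> inner vertices occupies the \<open>3 * N + 1\<close> darts \<open>{a..a + 3 * N}\<close> of the contour.
\<close>

primrec branch :: "btree \<Rightarrow> nat \<Rightarrow> nat \<Rightarrow> nat" where
  "branch Leaf a x = x"
| "branch (Node l r) a x =
    (if x = a then a + 3 * nodes (Node l r) else if x = a + 3 * nodes (Node l r) then a
     else if x < a + 2 + 3 * nodes l then branch l (a + 1) x else branch r (a + 2 + 3 * nodes l) x)"

lemma branch_outside: "x < a \<or> a + 3 * nodes t < x \<Longrightarrow> branch t a x = x"
  by (induction t arbitrary: a x) auto

lemma branch_root: "branch t a a = a + 3 * nodes t"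
  by (cases t) auto

lemma branch_inside: "a \<le> x \<Longrightarrow> x \<le> a + 3 * nodes t \<Longrightarrow> a \<le> branch t a x \<and> branch t a x \<le> a + 3 * nodes t"
proof (induction t arbitrary: a x)
  case (Node l r)
  show ?case
  proof (cases "x < a + 2 + 3 * nodes l")
    case True
    thus ?thesis using Node(1)[of "a + 1" x] Node(3,4) by auto
  next
    case False
    thus ?thesis using Node(2)[of "a + 2 + 3 * nodes l" x] Node(3,4) by auto
  qed
qed simp

lemma branch_involution: "branch t a (branch t a x) = x"
proof (induction t arbitrary: a x)
  case (Node l r)
  let ?m = "a + 2 + 3 * nodes l" and ?e = "a + 3 * nodes (Node l r)"
  consider "x < a \<or> x > ?e" | "x = a" | "x = ?e" "x \<noteq> a" | "a < x" "x < ?m" | "?m \<le> x" "x < ?e" by fastforce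
  thus ?case
  proof cases
    case 1 thus ?thesis using branch_outside[of x a "Node l r"] by simp
  next
    case 4
    have "branch (Node l r) a x = branch l (a + 1) x" using 4 by auto
    moreover have "a + 1 \<le> branch l (a + 1) x \<and> branch l (a + 1) x \<le> a + 1 + 3 * nodes l"
      by (rule branch_inside) (use 4 in auto)
    ultimately show ?thesis using Node(1)[of "a + 1" x] by auto
  next
    case 5
    have "branch (Node l r) a x = branch r ?m x" using 5 by auto
    moreover have "?m \<le> branch r ?m x \<and> branch r ?m x \<le> ?m + 3 * nodes r"
      by (rule branch_inside) (use 5 in auto)
    ultimately show ?thesis using Node(2)[of ?m x] by auto
  qed auto
qed simp

lemma noncrossing_branch: "noncrossing (branch t a)"
proof (induction t arbitrary: a)
  case Leaf
  show ?case by (simp add: noncrossing_def)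
next
  case (Node l r)
  let ?m = "a + 2 + 3 * nodes l" and ?e = "a + 3 * nodes (Node l r)" and ?f = "branch (Node l r) a"
  show ?case unfolding noncrossing_def
  proof (intro allI impI)
    fix x y assume xy: "x < y" "y < ?f x" "?f x < ?f y"
    have ne: "?f x \<noteq> x" "?f y \<noteq> y" using xy by auto
    have in': "a \<le> x" "x \<le> ?e" "a \<le> y" "y \<le> ?e" using ne branch_outside[of x a "Node l r"] branch_outside[of y a "Node l r"] by force+
    have "?f x \<le> ?e" "?f y \<le> ?e" using branch_inside[of a x "Node l r"] branch_inside[of a y "Node l r"] in' by auto
    hence "x \<noteq> a" "y \<noteq> ?e" "y \<noteq> a" "x \<noteq> ?e" using xy in' branch_root[of "Node l r" a] by auto
    note ne' = this
    show False
    proof (cases "x < ?m")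
      case True
      have fx: "?f x = branch l (a + 1) x" using True ne' by auto
      have "branch l (a + 1) x \<le> a + 1 + 3 * nodes l"
        using branch_inside[of "a + 1" x l] True ne' in' by auto
      hence ym: "y < ?m" using xy fx by simp
      hence "?f y = branch l (a + 1) y" using ne' by auto
      thus False using Node(1)[of "a + 1"] xy fx unfolding noncrossing_def by metis
    next
      case False
      hence "?f x = branch r ?m x" "?f y = branch r ?m y" using ne' xy by auto
      thus False using Node(2)[of ?m] xy unfolding noncrossing_def by metis
    qed
  qed
qed

text \<open>The darts after \<open>a\<close> make up the full vertices of the branch. For a
  \<open>Node\<close> the top vertex consists of \<open>a + 1\<close>, the first dart of the right
  subtree and the last dart; \<open>a\<close> itself belongs to the vertex at which the branch is
  attached and is therefore excluded.\<close>

lemma branch_cubic: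
  assumes "a < x" "x \<le> a + 3 * nodes t"
  shows "a < branch t a x + 1" "branch t a x + 1 \<le> a + 3 * nodes t" "branch t a x + 1 \<noteq> x"
    "branch t a (branch t a (branch t a x + 1) + 1) + 1 = x"
proof -
  have "a < branch t a x + 1 \<and> branch t a x + 1 \<le> a + 3 * nodes t \<and> branch t a x + 1 \<noteq> x \<and>
    branch t a (branch t a (branch t a x + 1) + 1) + 1 = x"
    using assms
  proof (induction t arbitrary: a x)
    case (Node l r)
    let ?m = "a + 2 + 3 * nodes l" and ?e = "a + 3 * nodes (Node l r)" and ?f = "branch (Node l r) a"
    have f1: "?f (a + 1) + 1 = ?m" using branch_root[of l "a + 1"] by simp
    have fm: "?f ?m + 1 = ?e" using branch_root[of r ?m] by simp
    have fe: "?f ?e + 1 = a + 1" by simp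
    consider "x = ?e" | "x = a + 1" | "x = ?m" | "a + 1 < x" "x < ?m" | "?m < x" "x < ?e" using Node(3,4) by linarith
    thus ?case
    proof cases
      case 1 thus ?thesis using f1 fm fe by simp
    next
      case 2 thus ?thesis using f1 fm fe by simp
    next
      case 3 thus ?thesis using f1 fm fe by simp
    next
      case 4
      have feq: "?f y = branch l (a + 1) y" if "a + 1 < y" "y \<le> a + 1 + 3 * nodes l" for y using that by auto
      note IH = Node(1)[of "a + 1" x]
      show ?thesis using IH 4 feq[of x] feq[of "?f x + 1"] feq[of "?f (?f x + 1) + 1"]
        Node(1)[of "a + 1" "branch l (a + 1) x + 1"] by auto
    next
      case 5
      have feq: "?f y = branch r ?m y" if "?m < y" "y \<le> ?m + 3 * nodes r" for y using that by auto
      show ?thesis using Node(2)[of ?m x] 5 feq[of x] feq[of "?f x + 1"] feq[of "?f (?f x + 1) + 1"]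
        Node(2)[of ?m "branch r ?m x + 1"] by auto
    qed
  qed simp
  thus "a < branch t a x + 1" "branch t a x + 1 \<le> a + 3 * nodes t" "branch t a x + 1 \<noteq> x"
    "branch t a (branch t a (branch t a x + 1) + 1) + 1 = x" by blast+
qed

text \<open>The tree can be read off: the chord at \<open>a\<close> gives its size, the chord at
  \<open>a + 1\<close> the size of the left subtree, and then recursively.\<close>

lemma branch_inject:
  "(\<And>x. a \<le> x \<Longrightarrow> x \<le> a + 3 * nodes t \<Longrightarrow> branch t a x = branch t' a x) \<Longrightarrow> t = t'"
proof (induction t arbitrary: a t')
  case Leaf
  thus ?case using branch_root[of Leaf a] branch_root[of t' a] by (cases t') auto
next
  case (Node l r)
  let ?N = "nodes (Node l r)"
  have N: "nodes t' = ?N" using Node(3)[of a] branch_root[of t' a] branch_root[of "Node l r" a] by simp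
  then obtain l' r' where t': "t' = Node l' r'" by (cases t') auto
  have "branch (Node l r) a (a + 1) = branch (Node l' r') a (a + 1)" using Node(3)[of "a + 1"] t' by simp
  hence L: "nodes l = nodes l'" using branch_root[of l "a + 1"] branch_root[of l' "a + 1"] by simp
  hence R: "nodes r = nodes r'" using N t' by simp
  have "l = l'"
  proof (rule Node(1)[of "a + 1"])
    fix x assume x: "a + 1 \<le> x" "x \<le> a + 1 + 3 * nodes l"
    thus "branch l (a + 1) x = branch l' (a + 1) x" using Node(3)[of x] t' L R by auto
  qed
  moreover have "r = r'"
  proof (rule Node(2)[of "a + 2 + 3 * nodes l"])
    fix x assume x: "a + 2 + 3 * nodes l \<le> x" "x \<le> a + 2 + 3 * nodes l + 3 * nodes r"
    thus "branch r (a + 2 + 3 * nodes l) x = branch r' (a + 2 + 3 * nodes l) x" using Node(3)[of x] t' L R by auto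
  qed
  ultimately show ?case using t' by simp
qed

context cubic_tree
begin

lemma chord_closed:
  assumes "a \<le> x" "x \<le> f a" shows "a \<le> f x" "f x \<le> f a"
proof -
  have "a \<le> f x \<and> f x \<le> f a"
  proof (cases "x = a \<or> x = f a")
    case True thus ?thesis using F(2)[of a] assms by auto
  next
    case False
    hence x: "a < x" "x < f a" using assms by auto
    have "f x < a \<Longrightarrow> False" using no_crossing[of "f x" a] F(2)[of x] x by simp
    moreover have "f a < f x \<Longrightarrow> False" using no_crossing[of a x] x by simp
    ultimately show ?thesis by fastforce
  qed
  thus "a \<le> f x" "f x \<le> f a" by auto
qed

text \<open>The vertex at the far end \<open>f a\<close> has the darts \<open>f a\<close>,
  \<open>a + 1\<close> and \<open>m\<close>. Degree three makes the branches starting at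
  \<open>a + 1\<close> and \<open>m\<close> fill the interior of the interval, and both are
  shorter.\<close>

lemma branch_exists:
  "a \<le> f a \<Longrightarrow> f a < K \<Longrightarrow> \<exists>t. f a = a + 3 * nodes t \<and> (\<forall>x. a \<le> x \<longrightarrow> x \<le> f a \<longrightarrow> f x = branch t a x)"
proof (induction "f a - a" arbitrary: a rule: less_induct)
  case less
  show ?case
  proof (cases "f a = a")
    case True
    thus ?thesis by (intro exI[of _ Leaf]) auto
  next
    case False
    let ?y = "f a"
    have fy: "f ?y = a" by (rule F(2))
    have ay: "a < ?y" using less(2) False by simp
    have s1: "\<sigma> ?y = a + 1" using fy less ay by (simp add: rotation_simps)
    have "a + 1 \<noteq> ?y" using F(6)[OF less(3)] s1 by simp
    hence a1: "a + 1 < ?y" using ay by simp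
    have c1: "a < f (a + 1)" "f (a + 1) < ?y"
    proof -
      have "f (a + 1) \<noteq> a" "f (a + 1) \<noteq> ?y" using F(2)[of "a + 1"] F(2)[of a] a1 by auto
      thus "a < f (a + 1)" "f (a + 1) < ?y" using chord_closed[of a "a + 1"] a1 by auto
    qed
    define m where "m = f (a + 1) + 1"
    have s2: "\<sigma> (a + 1) = m" unfolding m_def using c1 less by (simp add: rotation_simps)
    have s3: "\<sigma> m = ?y" using F(7)[OF less(3)] s1 s2 by simp
    have "m \<noteq> ?y" using s3 F(6)[OF less(3)] by auto
    hence my: "m < ?y" using c1 by (simp add: m_def)
    have cm: "a < f m" "f m < ?y"
    proof -
      have "f m \<noteq> a" "f m \<noteq> ?y" using F(2)[of m] F(2)[of a] my c1 m_def by auto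
      thus "a < f m" "f m < ?y" using chord_closed[of a m] my c1 m_def by auto
    qed
    have "\<sigma> m = f m + 1" using cm less by (simp add: rotation_simps)
    hence fm: "f m + 1 = ?y" using s3 by simp
    hence mm: "m \<le> f m" using my by simp
    obtain l where l: "f (a + 1) = a + 1 + 3 * nodes l" "\<And>x. a + 1 \<le> x \<Longrightarrow> x \<le> f (a + 1) \<Longrightarrow> f x = branch l (a + 1) x"
    proof -
      have "f (a + 1) - (a + 1) < f a - a" "a + 1 \<le> f (a + 1)" "f (a + 1) < K" using c1 less(3) by auto
      from less(1)[OF this] show thesis using that by blast
    qed
    obtain r where r: "f m = m + 3 * nodes r" "\<And>x. m \<le> x \<Longrightarrow> x \<le> f m \<Longrightarrow> f x = branch r m x"
    proof -
      have "f m - m < f a - a" "f m < K" using mm cm c1 less(3) m_def by auto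
      from less(1)[OF this(1) mm this(2)] show thesis using that by blast
    qed
    have m2: "m = a + 2 + 3 * nodes l" using l(1) m_def by simp
    have y2: "?y = a + 3 * nodes (Node l r)" using fm r(1) m2 by simp
    show ?thesis
    proof (intro exI[of _ "Node l r"] conjI allI impI)
      fix x assume x: "a \<le> x" "x \<le> ?y"
      consider "x = a" | "x = ?y" "x \<noteq> a" | "a < x" "x < m" | "m \<le> x" "x < ?y" using x by linarith
      thus "f x = branch (Node l r) a x"
      proof cases
        case 1 thus ?thesis using y2 by simp
      next
        case 2 thus ?thesis using fy y2 by simp
      next
        case 3 thus ?thesis using l(2)[of x] y2 m2 l(1) my by auto
      next
        case 4 thus ?thesis using r(2)[of x] y2 m2 fm my by auto
      qed
    qed (rule y2)
  qed
qed

end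

section \<open>Trees with a prescribed chord at position 0\<close>

lemma cubic_transfer:
  assumes c: "\<And>y. y \<in> S \<Longrightarrow> s y \<in> S" "\<And>y. y \<in> S \<Longrightarrow> s y \<noteq> y" "\<And>y. y \<in> S \<Longrightarrow> s (s (s y)) = y"
    and inj: "inj_on c S" and eq: "\<And>y. y \<in> S \<Longrightarrow> h (c y) = c (s y)" and x: "x \<in> c ` S"
  shows "h x \<noteq> x \<and> h (h (h x)) = x"
proof -
  obtain y where y: "y \<in> S" "x = c y" using x by auto
  have "h (h (h x)) = c (s (s (s y)))" using y eq c(1) by simp
  moreover have "h x \<noteq> x" using y eq c(2) inj_onD[OF inj _ c(1)[OF y(1)] y(1)] by auto
  ultimately show ?thesis using c(3) y by simp
qed

lemma branch_bounds:
  assumes "a < x" "x < a + 3 * nodes t" shows "a < branch t a x" "branch t a x < a + 3 * nodes t"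
proof -
  note i = branch_involution[of t a x] and b = branch_inside[of a x t] and r = branch_root[of t a]
  have "branch t a x \<noteq> a" using i r assms by auto
  moreover have "branch t a x \<noteq> a + 3 * nodes t"
  proof
    assume "branch t a x = a + 3 * nodes t"
    hence "branch t a (branch t a a) = x" using i r by simp
    thus False using branch_involution[of t a a] assms by simp
  qed
  ultimately show "a < branch t a x" "branch t a x < a + 3 * nodes t" using b assms by auto
qed

lemma rotate_by_eq_self:
  assumes per: "\<And>x. x < K \<Longrightarrow> f ((x + g) mod K) = (f x + g) mod K"
    and f: "\<And>x. x < K \<Longrightarrow> f x < K" "\<And>x. x \<ge> K \<Longrightarrow> f x = x"
  shows "rotate_by K g f = f"
proof (rule rotate_by_eqI)
  fix x show "f ((rotation K ^^ g) x) = (rotation K ^^ g) (f x)"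
    using assms by (cases "x < K") (simp_all add: funpow_rotation rotation_pow_outside)
qed

text \<open>A branch with \<open>2 * n\<close> nodes has \<open>6 * n + 1\<close> darts, and its
  root chord runs from 0 to \<open>6 * n\<close>. Identifying these two ends turns the root chord
  into the free dart 0.\<close>

lemma card_trees_leaf_root:
  assumes n: "n \<ge> 1"
  shows "card {f \<in> cubic_trees (6 * n). f 0 = 0} = card {t. nodes t = 2 * n}"
proof -
  let ?K = "6 * n"
  define b where "b t x = (if 0 < x \<and> x < ?K then branch t 0 x else x)" for t x
  have into: "b t \<in> {f \<in> cubic_trees ?K. f 0 = 0}" if t: "nodes t = 2 * n" for t
  proof -
    let ?F = "branch t 0"
    have bd: "0 < ?F x" "?F x < ?K" if "0 < x" "x < ?K" for x using branch_bounds[of 0 x t] that t by auto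
    have inv: "?F (?F x) = x" for x by (rule branch_involution)
    have F0: "?F ?K = 0" using inv[of 0] branch_root[of t 0] t by simp
    have "matching_on {x. 0 < x \<and> x < ?K \<and> ?F x \<noteq> x} (b t)"
    proof (rule matching_onI)
      fix x assume "x \<in> {x. 0 < x \<and> x < ?K \<and> ?F x \<noteq> x}"
      hence x: "0 < x" "x < ?K" "?F x \<noteq> x" by auto
      hence bx: "b t x = ?F x" "0 < ?F x" "?F x < ?K" using bd[OF x(1,2)] by (simp_all add: b_def)
      hence bbx: "b t (?F x) = x" using inv[of x] by (simp add: b_def)
      show "b t x \<in> {x. 0 < x \<and> x < ?K \<and> ?F x \<noteq> x}" using bx inv[of x] x(3) by auto
      show "b t x \<noteq> x" using bx x by simp
      show "b t (b t x) = x" using bx bbx by simp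
    qed (auto simp: b_def)
    moreover have "{x. 0 < x \<and> x < ?K \<and> ?F x \<noteq> x} \<subseteq> {..<?K}" by auto
    moreover have "noncrossing (b t)" unfolding noncrossing_def
    proof (intro allI impI)
      fix x y assume xy: "x < y" "y < b t x" "b t x < b t y"
      hence "b t x = ?F x" "b t y = ?F y" by (auto simp: b_def split: if_splits)
      thus False using noncrossing_branch[of t 0] xy unfolding noncrossing_def by metis
    qed
    moreover have "rotation ?K (b t x) \<noteq> x \<and> rotation ?K (b t (rotation ?K (b t (rotation ?K (b t x))))) = x"
      if x: "x < ?K" for x
    \<comment> \<open>The vertices of the branch live on the darts 1 to \<open>6 * n\<close>; it is
      \<open>6 * n\<close>, not 0, that represents position 0.\<close>
    proof (rule cubic_transfer[where S = "{0<..?K}" and s = "\<lambda>y. ?F y + 1" and c = "\<lambda>y. y mod ?K" and h = "\<lambda>x. rotation ?K (b t x)"])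
      fix y assume y: "y \<in> {0<..?K}"
      show "?F y + 1 \<in> {0<..?K}" "?F y + 1 \<noteq> y" "?F (?F (?F y + 1) + 1) + 1 = y"
        using branch_cubic[of 0 y t] y t by auto
      show "rotation ?K (b t (y mod ?K)) = (?F y + 1) mod ?K"
      proof (cases "y = ?K")
        case True thus ?thesis using F0 n by (simp add: b_def rotation_def)
      next
        case False thus ?thesis using y bd[of y] by (simp add: b_def rotation_def)
      qed
    next
      show "inj_on (\<lambda>y. y mod ?K) {0<..?K}"
      proof (rule inj_onI)
        fix y z assume "y \<in> {0<..?K}" "z \<in> {0<..?K}" "y mod ?K = z mod ?K"
        thus "y = z" by (cases "y = ?K"; cases "z = ?K") auto
      qed
      show "x \<in> (\<lambda>y. y mod ?K) ` {0<..?K}"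
        using x n by (cases "x = 0") (auto intro: image_eqI[of _ _ ?K] image_eqI[of _ _ x])
    qed
    ultimately show ?thesis unfolding cubic_trees_def by (auto simp: b_def)
  qed
  have inj: "inj_on b {t. nodes t = 2 * n}"
  proof (rule inj_onI)
    fix t u assume t: "t \<in> {t. nodes t = 2 * n}" and u: "u \<in> {t. nodes t = 2 * n}" and eq: "b t = b u"
    show "t = u"
    proof (rule branch_inject[of 0])
      fix x assume x: "0 \<le> x" "x \<le> 0 + 3 * nodes t"
      have r: "branch v 0 0 = ?K" "branch v 0 ?K = 0" if "nodes v = 2 * n" for v
        using branch_root[of v 0] branch_involution[of v 0 0] that by auto
      show "branch t 0 x = branch u 0 x"
        using fun_cong[OF eq, of x] x t u r[of t] r[of u] by (auto simp: b_def split: if_splits)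
    qed
  qed
  have "b ` {t. nodes t = 2 * n} = {f \<in> cubic_trees ?K. f 0 = 0}"
  proof (intro equalityI subsetI)
    fix f assume f: "f \<in> {f \<in> cubic_trees ?K. f 0 = 0}"
    interpret cubic_tree n f by unfold_locales (use n f in auto)
    have f0: "f 0 = 0" using f by simp
    have s0: "\<sigma> 0 = 1" using f0 n by (simp add: rotation_def)
    have pos: "f x \<noteq> 0" if "x \<noteq> 0" for x using F(2)[of x] f0 that by metis
    have f1: "1 \<le> f 1" "f 1 < K" using pos[of 1] F(3)[of 1] n by auto
    define m where "m = f 1 + 1"
    have s3: "\<sigma> (\<sigma> 1) = 0" using F(7)[of 0] s0 n by simp
    have "m \<noteq> K"
    proof
      assume "m = K"
      hence "\<sigma> 1 = 0" using f1 by (simp add: m_def rotation_simps)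
      thus False using s3 s0 by simp
    qed
    hence mK: "m < K" using f1 by (simp add: m_def)
    have "\<sigma> 1 = m" using mK by (simp add: m_def rotation_simps)
    hence sm: "(f m + 1) mod K = 0" using s3 sigma_eq[OF mK] by simp
    have fmK: "f m < K" using F(3) mK by simp
    have fm: "f m + 1 = K"
    proof (rule ccontr)
      assume "f m + 1 \<noteq> K"
      hence "f m + 1 < K" using fmK by simp
      thus False using sm by simp
    qed
    have mm: "m \<le> f m" using fm mK by simp
    obtain l where l: "f 1 = 1 + 3 * nodes l" "\<And>x. 1 \<le> x \<Longrightarrow> x \<le> f 1 \<Longrightarrow> f x = branch l 1 x"
      using branch_exists[OF f1] by blast
    obtain r where r: "f m = m + 3 * nodes r" "\<And>x. m \<le> x \<Longrightarrow> x \<le> f m \<Longrightarrow> f x = branch r m x"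
      using branch_exists[OF mm fmK] by blast
    have m2: "m = 2 + 3 * nodes l" using l(1) m_def by simp
    have N: "nodes (Node l r) = 2 * n" using fm r(1) m2 by simp
    have "b (Node l r) x = f x" for x
    proof -
      consider "x = 0" | "x \<ge> K" | "0 < x" "x < m" | "m \<le> x" "x < K" by linarith
      thus ?thesis
      proof cases
        case 1 thus ?thesis using f0 by (simp add: b_def)
      next
        case 2 thus ?thesis using F(4) by (simp add: b_def)
      next
        case 3 thus ?thesis using l(2)[of x] l(1) N m2 mK by (auto simp: b_def)
      next
        case 4 thus ?thesis using r(2)[of x] fm N m2 by (auto simp: b_def)
      qed
    qed
    thus "f \<in> b ` {t. nodes t = 2 * n}" using N by (intro image_eqI[of _ _ "Node l r"]) auto
  qed (use into in auto)
  thus ?thesis using card_image[OF inj] by simp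
qed

text \<open>The central edge joins 0 and \<open>3 * n\<close>; either half of the tree is a branch
  with \<open>n\<close> nodes whose root chord is that edge, so the copies share both end darts. The
  second copy is the half-turn of the first.\<close>

lemma card_trees_edge_center:
  assumes n: "n \<ge> 1"
  shows "card {f \<in> cubic_trees (6 * n). rotate_by (6 * n) (3 * n) f = f \<and> f 0 = 3 * n} = card {t. nodes t = n}"
proof -
  let ?K = "6 * n"
  define b where "b t x = (if x \<le> 3 * n then branch t 0 x else if x < ?K then branch t 0 (x - 3 * n) + 3 * n else x)" for t x
  have into: "b t \<in> {f \<in> cubic_trees ?K. rotate_by ?K (3 * n) f = f \<and> f 0 = 3 * n}" if t: "nodes t = n" for t
  proof -
    let ?F = "branch t 0"
    have bd: "0 < ?F x" "?F x < 3 * n" if "0 < x" "x < 3 * n" for x using branch_bounds[of 0 x t] that t by auto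
    have inv: "?F (?F x) = x" for x by (rule branch_involution)
    have F0: "?F 0 = 3 * n" "?F (3 * n) = 0" using inv[of 0] branch_root[of t 0] t by auto
    have b1: "b t x = ?F x" "0 < b t x" "b t x < 3 * n" if "0 < x" "x < 3 * n" for x
      using bd[OF that] that by (simp_all add: b_def)
    have b2: "b t x = ?F (x - 3 * n) + 3 * n" "3 * n < b t x" "b t x < ?K" if "3 * n < x" "x < ?K" for x
      using bd[of "x - 3 * n"] that by (simp_all add: b_def)
    have b0: "b t 0 = 3 * n" "b t (3 * n) = 0" using F0 by (simp_all add: b_def)
    have bo: "b t x = x" if "x \<ge> ?K" for x using that n by (simp add: b_def)
    have bK: "b t x < ?K" if "x < ?K" for x
    proof -
      consider "x = 0" | "0 < x" "x < 3 * n" | "x = 3 * n" | "3 * n < x" by linarith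
      thus ?thesis using b0 b1[of x] b2[of x] that n by cases auto
    qed
    have binv: "b t (b t x) = x" for x
    proof -
      consider "x = 0" | "0 < x" "x < 3 * n" | "x = 3 * n" | "3 * n < x" "x < ?K" | "?K \<le> x" by linarith
      thus ?thesis
      proof cases
        case 2 thus ?thesis using b1(1)[of x] b1(1)[of "b t x"] b1(2,3)[of x] inv by simp
      next
        case 4 thus ?thesis using b2(1)[of x] b2(1)[of "b t x"] b2(2,3)[of x] inv by simp
      qed (use b0 bo in auto)
    qed
    have "matching_on {x. x < ?K \<and> b t x \<noteq> x} (b t)"
    proof (rule matching_onI)
      fix x assume "x \<in> {x. x < ?K \<and> b t x \<noteq> x}"
      hence x: "x < ?K" "b t x \<noteq> x" by auto
      show "b t x \<in> {x. x < ?K \<and> b t x \<noteq> x}" using x bK[OF x(1)] binv[of x] by simp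
    qed (use binv bo in \<open>auto simp: not_less[symmetric]\<close>)
    moreover have "{x. x < ?K \<and> b t x \<noteq> x} \<subseteq> {..<?K}" by auto
    moreover have "noncrossing (b t)" unfolding noncrossing_def
    proof (intro allI impI)
      fix x y assume xy: "x < y" "y < b t x" "b t x < b t y"
      have yK: "y < ?K" using xy bo[of y] by (cases "y < ?K") auto
      consider "x = 0" | "0 < x" "x < 3 * n" | "x = 3 * n" | "3 * n < x" "x < ?K" using xy yK by linarith
      thus False
      proof cases
        case 1
        thus False using b0 b1[of y] xy by simp
      next
        case 2
        hence "b t x = ?F x" "b t y = ?F y" using b1[of x] b1[of y] xy by auto
        thus False using noncrossing_branch[of t 0] xy unfolding noncrossing_def by metis
      next
        case 3
        thus False using b0 xy by simp
      next
        case 4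
        hence "b t x = ?F (x - 3 * n) + 3 * n" "b t y = ?F (y - 3 * n) + 3 * n" using b2[of x] b2[of y] xy yK by auto
        hence "x - 3 * n < y - 3 * n" "y - 3 * n < ?F (x - 3 * n)" "?F (x - 3 * n) < ?F (y - 3 * n)" using xy 4 by auto
        thus False using noncrossing_branch[of t 0] unfolding noncrossing_def by metis
      qed
    qed
    moreover have per: "b t ((x + 3 * n) mod ?K) = (b t x + 3 * n) mod ?K" if x: "x < ?K" for x
    proof -
      consider "x = 0" | "0 < x" "x < 3 * n" | "x = 3 * n" | "3 * n < x" by linarith
      thus ?thesis
      proof cases
        case 1 thus ?thesis using b0 n by simp
      next
        case 2
        thus ?thesis using b2(1)[of "x + 3 * n"] b1[of x] by simp
      next
        case 3 thus ?thesis using b0 by simp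
      next
        case 4
        hence "(x + 3 * n) mod ?K = x - 3 * n" using x by (simp add: mod_if)
        moreover have "b t (x - 3 * n) = ?F (x - 3 * n)" "?F (x - 3 * n) < ?K"
        proof -
          have "0 < x - 3 * n" "x - 3 * n < 3 * n" using 4 x by linarith+
          from b1(1,3)[OF this] show "b t (x - 3 * n) = ?F (x - 3 * n)" "?F (x - 3 * n) < ?K" by simp_all
        qed
        moreover have "(b t x + 3 * n) mod ?K = (?F (x - 3 * n) + ?K) mod ?K" using b2(1)[OF 4 x] by simp
        ultimately show ?thesis by simp
      qed
    qed
    moreover have "rotation ?K (b t x) \<noteq> x \<and> rotation ?K (b t (rotation ?K (b t (rotation ?K (b t x))))) = x"
      if x: "x < ?K" for x
    proof -
      have base: "rotation ?K (b t y) = ?F y + 1" if "0 < y" "y \<le> 3 * n" for y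
        using that b1[of y] b0 F0 n by (cases "y = 3 * n") (auto simp: rotation_simps)
      have shifted: "rotation ?K (b t ((y + 3 * n) mod ?K)) = (?F y + 1 + 3 * n) mod ?K" if "0 < y" "y \<le> 3 * n" for y
      proof -
        have yK: "y < ?K" using that n by simp
        have "rotation ?K (b t ((y + 3 * n) mod ?K)) = ((b t y + 3 * n) mod ?K + 1) mod ?K"
          using per[OF yK] n by (simp add: rotation_def)
        also have "\<dots> = (b t y + 3 * n + 1) mod ?K" by (simp add: mod_Suc_eq)
        finally show ?thesis using that by (simp add: b_def)
      qed
      show ?thesis
      proof (cases "0 < x \<and> x \<le> 3 * n")
        case True
        show ?thesis
        proof (rule cubic_transfer[where S = "{0<..3 * n}" and s = "\<lambda>y. ?F y + 1" and c = "\<lambda>y. y" and h = "\<lambda>x. rotation ?K (b t x)"])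
          fix y assume y: "y \<in> {0<..3 * n}"
          show "?F y + 1 \<in> {0<..3 * n}" "?F y + 1 \<noteq> y" "?F (?F (?F y + 1) + 1) + 1 = y"
            using branch_cubic[of 0 y t] y t by auto
          show "rotation ?K (b t y) = ?F y + 1" using base y by simp
        qed (use True in auto)
      next
        case False
        show ?thesis
        proof (rule cubic_transfer[where S = "{0<..3 * n}" and s = "\<lambda>y. ?F y + 1" and c = "\<lambda>y. (y + 3 * n) mod ?K" and h = "\<lambda>x. rotation ?K (b t x)"])
          fix y assume y: "y \<in> {0<..3 * n}"
          show "?F y + 1 \<in> {0<..3 * n}" "?F y + 1 \<noteq> y" "?F (?F (?F y + 1) + 1) + 1 = y"
            using branch_cubic[of 0 y t] y t by auto
          show "rotation ?K (b t ((y + 3 * n) mod ?K)) = (?F y + 1 + 3 * n) mod ?K" using shifted y by simp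
        next
          show "inj_on (\<lambda>y. (y + 3 * n) mod ?K) {0<..3 * n}"
          proof (rule inj_onI)
            fix y z assume "y \<in> {0<..3 * n}" "z \<in> {0<..3 * n}" "(y + 3 * n) mod ?K = (z + 3 * n) mod ?K"
            thus "y = z" by (cases "y = 3 * n"; cases "z = 3 * n") auto
          qed
          show "x \<in> (\<lambda>y. (y + 3 * n) mod ?K) ` {0<..3 * n}"
          proof (cases "x = 0")
            case True thus ?thesis using n by (intro image_eqI[of _ _ "3 * n"]) auto
          next
            case x0: False
            thus ?thesis using False x by (intro image_eqI[of _ _ "x - 3 * n"]) auto
          qed
        qed
      qed
    qed
    ultimately have "b t \<in> cubic_trees ?K" unfolding cubic_trees_def by auto
    moreover have "rotate_by ?K (3 * n) (b t) = b t" by (rule rotate_by_eq_self) (use per bK bo in auto)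
    ultimately show ?thesis using b0 by simp
  qed
  have inj: "inj_on b {t. nodes t = n}"
  proof (rule inj_onI)
    fix t u assume t: "t \<in> {t. nodes t = n}" and eq: "b t = b u"
    show "t = u"
    proof (rule branch_inject[of 0])
      fix x assume x: "0 \<le> x" "x \<le> 0 + 3 * nodes t"
      thus "branch t 0 x = branch u 0 x" using fun_cong[OF eq, of x] t by (auto simp: b_def)
    qed
  qed
  have "b ` {t. nodes t = n} = {f \<in> cubic_trees ?K. rotate_by ?K (3 * n) f = f \<and> f 0 = 3 * n}"
  proof (intro equalityI subsetI)
    fix f assume f: "f \<in> {f \<in> cubic_trees ?K. rotate_by ?K (3 * n) f = f \<and> f 0 = 3 * n}"
    interpret cubic_tree n f by unfold_locales (use n f in auto)
    have f0: "f 0 = 3 * n" and per: "rotate_by ?K (3 * n) f = f" using f by auto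
    obtain t where t: "f 0 = 0 + 3 * nodes t" "\<And>x. 0 \<le> x \<Longrightarrow> x \<le> f 0 \<Longrightarrow> f x = branch t 0 x"
      using branch_exists[of 0] f0 n by auto
    have N: "nodes t = n" using t f0 by simp
    have "b t x = f x" for x
    proof -
      consider "x \<le> 3 * n" | "3 * n < x" "x < K" | "x \<ge> K" by linarith
      thus ?thesis
      proof cases
        case 1 thus ?thesis using t(2)[of x] f0 by (simp add: b_def)
      next
        case 2
        hence y: "x - 3 * n < K" "x - 3 * n + 3 * n = x" "0 < x - 3 * n" "x - 3 * n < 3 * n" by auto
        have "f ((x - 3 * n + 3 * n) mod K) = (f (x - 3 * n) + 3 * n) mod K" by (rule shift_fixed[OF per y(1)])
        moreover have "f (x - 3 * n) = branch t 0 (x - 3 * n)" using t(2)[of "x - 3 * n"] f0 y by simp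
        moreover have "branch t 0 (x - 3 * n) < 3 * n" using branch_bounds[of 0 "x - 3 * n" t] y N by simp
        ultimately show ?thesis using 2 y(2) by (simp add: b_def)
      next
        case 3 thus ?thesis using F(4) n by (simp add: b_def)
      qed
    qed
    thus "f \<in> b ` {t. nodes t = n}" using N by (intro image_eqI[of _ _ t]) auto
  qed (use into in auto)
  thus ?thesis using card_image[OF inj] by simp
qed

text \<open>Three copies of one branch are placed side by side, each on \<open>2 * n\<close> darts,
  and their first darts 0, \<open>2 * n\<close> and \<open>4 * n\<close> form the central vertex.
  The size is given by an equation because it has a solution only for some \<open>n\<close>.\<close>

lemma card_trees_vertex_center:
  assumes n: "n \<ge> 1"
  shows "card {f \<in> cubic_trees (6 * n). rotate_by (6 * n) (2 * n) f = f \<and> f 0 = 2 * n - 1} =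
    card {t. 3 * nodes t + 1 = 2 * n}"
proof -
  let ?K = "6 * n" and ?g = "2 * n"
  have dl: "y div ?g < 3 \<longleftrightarrow> y < ?K" for y using div_less_iff_less_mult[of ?g y 3] n by simp
  define b where "b t x = (if x < ?K then ?g * (x div ?g) + branch t 0 (x mod ?g) else x)" for t x
  have into: "b t \<in> {f \<in> cubic_trees ?K. rotate_by ?K ?g f = f \<and> f 0 = ?g - 1}" if t: "3 * nodes t + 1 = ?g" for t
  proof -
    let ?F = "branch t 0"
    have bd: "?F x < ?g" if "x < ?g" for x using branch_inside[of 0 x t] that t by auto
    have inv: "?F (?F x) = x" for x by (rule branch_involution)
    have g0: "?g > 0" using n by simp
    have bdm: "b t x div ?g = x div ?g" "b t x mod ?g = ?F (x mod ?g)" if "x < ?K" for x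
      using bd[of "x mod ?g"] g0 that by (simp_all add: b_def)
    have bK: "b t x < ?K" if "x < ?K" for x
    proof -
      have "x div ?g < 3" using that by (simp only: dl)
      hence "b t x div ?g < 3" using bdm that by simp
      thus ?thesis by (simp only: dl)
    qed
    have bo: "b t x = x" if "x \<ge> ?K" for x using that by (simp add: b_def)
    have binv: "b t (b t x) = x" for x
    proof (cases "x < ?K")
      case True
      have "b t (b t x) = ?g * (b t x div ?g) + ?F (b t x mod ?g)" using bK[OF True] by (simp add: b_def)
      also have "\<dots> = x" unfolding bdm[OF True] inv by simp
      finally show ?thesis .
    qed (simp add: bo)
    have "matching_on {x. x < ?K \<and> b t x \<noteq> x} (b t)"
    proof (rule matching_onI)
      fix x assume "x \<in> {x. x < ?K \<and> b t x \<noteq> x}"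
      hence x: "x < ?K" "b t x \<noteq> x" by auto
      show "b t x \<in> {x. x < ?K \<and> b t x \<noteq> x}" using x bK[OF x(1)] binv[of x] by simp
    qed (use binv bo in \<open>auto simp: not_less[symmetric]\<close>)
    moreover have "{x. x < ?K \<and> b t x \<noteq> x} \<subseteq> {..<?K}" by auto
    moreover have "noncrossing (b t)" unfolding noncrossing_def
    proof (intro allI impI)
      fix x y assume xy: "x < y" "y < b t x" "b t x < b t y"
      have xK: "x < ?K" "y < ?K" using xy bo[of x] bo[of y] by (cases "x < ?K"; cases "y < ?K"; simp)+
      have "x div ?g \<le> y div ?g" "y div ?g \<le> b t x div ?g" using xy by (auto intro: div_le_mono)
      hence e: "y div ?g = x div ?g" using bdm xK by simp
      let ?c = "?g * (x div ?g)"
      have "x = ?c + x mod ?g" "y = ?c + y mod ?g" by (simp, simp only: e[symmetric] mult_div_mod_eq)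
      moreover have "b t x = ?c + ?F (x mod ?g)" "b t y = ?c + ?F (y mod ?g)" using xK e by (simp_all add: b_def)
      ultimately have "x mod ?g < y mod ?g" "y mod ?g < ?F (x mod ?g)" "?F (x mod ?g) < ?F (y mod ?g)" using xy by linarith+
      thus False using noncrossing_branch[of t 0] unfolding noncrossing_def by metis
    qed
    moreover have per: "b t ((x + ?g) mod ?K) = (b t x + ?g) mod ?K" if x: "x < ?K" for x
    proof (cases "x < 4 * n")
      case True
      hence "b t (x + ?g) = b t x + ?g" using g0 by (simp add: b_def)
      thus ?thesis using True bK[of "x + ?g"] by simp
    next
      case False
      define y where "y = x - 4 * n"
      have y: "x = y + ?g * 2" "y < ?g" using False x by (auto simp: y_def)
      have "(x + ?g) mod ?K = y" using y by (simp add: mod_if)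
      moreover have "b t y = ?F y" using y by (simp add: b_def)
      moreover have "b t x = ?F y + ?g * 2"
      proof -
        have "x div ?g = 2" unfolding y(1) by (subst div_mult_self2) (use y(2) in auto)
        moreover have "x mod ?g = y" unfolding y(1) by (subst mod_mult_self2) (use y(2) in auto)
        ultimately have "x div ?g = 2" "x mod ?g = y" by auto
        thus ?thesis using x by (simp add: b_def)
      qed
      moreover have "?F y < ?K" using bd[OF y(2)] by simp
      ultimately show ?thesis by simp
    qed
    moreover have "rotation ?K (b t x) \<noteq> x \<and> rotation ?K (b t (rotation ?K (b t (rotation ?K (b t x))))) = x"
      if x: "x < ?K" for x
    \<comment> \<open>Multiples of \<open>?g\<close> are the darts of the central vertex; every
      other dart belongs to a vertex inside one copy.\<close>
    proof (cases "x mod ?g = 0")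
      case True
      have F0: "?F 0 = ?g - 1" using branch_root[of t 0] t by simp
      have val: "rotation ?K (b t (?g * j)) = (?g * (j + 1)) mod ?K" if "j < 3" for j
      proof -
        have "?g * j < ?K" using that n by simp
        hence "b t (?g * j) = ?g * j + (?g - 1)" "b t (?g * j) < ?K" using F0 bK[of "?g * j"] g0 by (simp_all add: b_def)
        hence "rotation ?K (b t (?g * j)) = (?g * j + (?g - 1) + 1) mod ?K" by (simp add: rotation_def)
        also have "?g * j + (?g - 1) + 1 = ?g * (j + 1)" using g0 by simp
        finally show ?thesis .
      qed
      have v: "rotation ?K (b t 0) = 2 * n" "rotation ?K (b t (2 * n)) = 4 * n" "rotation ?K (b t (4 * n)) = 0"
        using val[of 0] val[of 1] val[of 2] n by (simp_all add: mult.commute)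
      have "x div ?g < 3" using x by (simp only: dl)
      moreover have "x = ?g * (x div ?g)" using True by (metis add.right_neutral mult_div_mod_eq)
      moreover have "x = 0 \<or> x = 2 * n \<or> x = 4 * n" if "q < 3" "x = ?g * q" for q
      proof -
        have "q = 0 \<or> q = 1 \<or> q = 2" using that(1) by auto
        thus ?thesis using that(2) by auto
      qed
      ultimately have "x = 0 \<or> x = 2 * n \<or> x = 4 * n" by blast

      thus ?thesis using v n by auto
    next
      case False
      let ?c = "?g * (x div ?g)"
      have xc: "x = ?c + x mod ?g" by simp
      show ?thesis
      proof (rule cubic_transfer[where S = "{0<..3 * nodes t}" and s = "\<lambda>y. ?F y + 1" and c = "\<lambda>y. ?c + y" and h = "\<lambda>x. rotation ?K (b t x)"])
        fix y assume y: "y \<in> {0<..3 * nodes t}"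
        show s: "?F y + 1 \<in> {0<..3 * nodes t}" "?F y + 1 \<noteq> y" "?F (?F (?F y + 1) + 1) + 1 = y"
          using branch_cubic[of 0 y t] y by auto
        have j: "x div ?g < 3" using x by (simp only: dl)
        have yg: "y < ?g" "?F y + 1 < ?g" using y s(1) t by auto
        have lt: "?c + z < ?K" if "z < ?g" for z
        proof -
          have "(?c + z) div ?g < 3" using that j g0 by simp
          thus ?thesis by (simp only: dl)
        qed
        have "b t (?c + y) = ?c + ?F y" using lt[OF yg(1)] yg g0 by (simp add: b_def)
        moreover have "?c + ?F y + 1 < ?K" using lt[OF yg(2)] by simp
        ultimately show "rotation ?K (b t (?c + y)) = ?c + (?F y + 1)" by (simp add: rotation_simps)
      next
        have "x mod ?g < ?g" using g0 by simp
        hence "x mod ?g \<le> 3 * nodes t" using t by linarith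
        thus "x \<in> (\<lambda>y. ?c + y) ` {0<..3 * nodes t}" using False xc by (intro image_eqI[of _ _ "x mod ?g"]) auto
      qed (auto intro: inj_onI)
    qed
    ultimately have "b t \<in> cubic_trees ?K" unfolding cubic_trees_def by auto
    moreover have "rotate_by ?K ?g (b t) = b t" by (rule rotate_by_eq_self) (use per bK bo in auto)
    moreover have "b t 0 = ?g - 1" using branch_root[of t 0] t n by (simp add: b_def)
    ultimately show ?thesis by simp
  qed
  have inj: "inj_on b {t. 3 * nodes t + 1 = ?g}"
  proof (rule inj_onI)
    fix t u assume t: "t \<in> {t. 3 * nodes t + 1 = ?g}" and eq: "b t = b u"
    show "t = u"
    proof (rule branch_inject[of 0])
      fix x assume x: "0 \<le> x" "x \<le> 0 + 3 * nodes t"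
      thus "branch t 0 x = branch u 0 x" using fun_cong[OF eq, of x] t by (auto simp: b_def)
    qed
  qed
  have "b ` {t. 3 * nodes t + 1 = ?g} = {f \<in> cubic_trees ?K. rotate_by ?K ?g f = f \<and> f 0 = ?g - 1}"
  proof (intro equalityI subsetI)
    fix f assume f: "f \<in> {f \<in> cubic_trees ?K. rotate_by ?K ?g f = f \<and> f 0 = ?g - 1}"
    interpret cubic_tree n f by unfold_locales (use n f in auto)
    have f0: "f 0 = ?g - 1" and per: "rotate_by ?K ?g f = f" using f by auto
    obtain t where t: "f 0 = 0 + 3 * nodes t" "\<And>x. 0 \<le> x \<Longrightarrow> x \<le> f 0 \<Longrightarrow> f x = branch t 0 x"
    proof -
      have "0 \<le> f 0" "f 0 < K" using f0 n by (simp, linarith)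
      from branch_exists[OF this] show thesis using that by blast
    qed
    have N: "3 * nodes t + 1 = ?g" using t(1) f0 n by linarith
    have "b t x = f x" for x
    proof (cases "x < K")
      case True
      let ?y = "x mod ?g"
      have y: "?y < ?g" "?y < K" using n by (simp, meson True le_less_trans mod_less_eq_dividend)
      have xe: "?y + ?g * (x div ?g) = x" by simp
      have "?y \<le> f 0" "?y \<le> 0 + 3 * nodes t" using f0 N y(1) by linarith+
      hence fy: "f ?y = branch t 0 ?y" and yt: "?y \<le> 0 + 3 * nodes t" using t(2)[of ?y] by auto
      have by': "branch t 0 ?y < ?g" using branch_inside[of 0 ?y t] yt N by linarith
      have "f ((?y + ?g * (x div ?g)) mod K) = (f ?y + ?g * (x div ?g)) mod K"
        by (rule shift_fixed[OF rotate_by_fixed_mult[OF per] y(2)])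
      hence "f x = (branch t 0 ?y + ?g * (x div ?g)) mod K" unfolding xe fy using True by simp
      moreover have "branch t 0 ?y + ?g * (x div ?g) < K"
      proof -
        have "x div ?g < 3" using True by (simp only: dl)
        hence "(branch t 0 ?y + ?g * (x div ?g)) div ?g < 3" using by' n by simp
        thus ?thesis by (simp only: dl)
      qed
      ultimately show ?thesis using True by (simp add: b_def)
    next
      case False thus ?thesis using F(4) by (simp add: b_def)
    qed
    thus "f \<in> b ` {t. 3 * nodes t + 1 = ?g}" using N by (intro image_eqI[of _ _ t]) auto
  qed (use into in auto)
  thus ?thesis using card_image[OF inj] by simp
qed

section \<open>Noncrossing matchings\<close>

definition nc_matchings :: "nat set \<Rightarrow> (nat \<Rightarrow> nat) set" where
  "nc_matchings A = {g. matching_on A g \<and> noncrossing g}"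

lemma finite_nc_matchings: "finite A \<Longrightarrow> finite (nc_matchings A)"
  by (rule finite_subset[of _ "{g. g permutes A}"]) (auto simp: nc_matchings_def matching_on_def finite_permutations)

lemma noncrossing_restrict: "noncrossing g \<Longrightarrow> noncrossing (perm_restrict g B)"
  for g :: "'a::linorder \<Rightarrow> 'a"
  unfolding noncrossing_def
proof (intro allI impI)
  fix x y
  assume nc: "\<forall>x y. x < y \<longrightarrow> y < g x \<longrightarrow> g x < g y \<longrightarrow> False"
    and H: "x < y" "y < perm_restrict g B x" "perm_restrict g B x < perm_restrict g B y"
  have "x \<in> B" "y \<in> B" using H by (auto simp: perm_restrict_def split: if_splits)
  thus False using H nc by (auto simp: perm_restrict_def)
qed

definition glue :: "nat \<Rightarrow> nat \<Rightarrow> (nat \<Rightarrow> nat) \<times> (nat \<Rightarrow> nat) \<Rightarrow> nat \<Rightarrow> nat" where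
  "glue a c = (\<lambda>(p, q) x. if x = a then c else if x = c then a else if x < c then p x else q x)"

text \<open>The chord from the least point separates the enclosed points from those beyond.
  Arbitrary sets of points are allowed because free darts are not consecutive.\<close>

lemma nc_matchings_split:
  assumes a: "a \<in> A" "\<And>x. x \<in> A \<Longrightarrow> a \<le> x" and c: "c \<in> A" "c \<noteq> a"
  shows "bij_betw (glue a c) (nc_matchings {x \<in> A. a < x \<and> x < c} \<times> nc_matchings {x \<in> A. c < x})
    {g \<in> nc_matchings A. g a = c}"
proof -
  let ?A1 = "{x \<in> A. a < x \<and> x < c}" and ?A2 = "{x \<in> A. c < x}"
  have ac: "a < c" using a(2)[OF c(1)] c(2) by simp
  show ?thesis
  proof (rule bij_betw_byWitness[where f' = "\<lambda>g. (perm_restrict g ?A1, perm_restrict g ?A2)"])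
    show "glue a c ` (nc_matchings ?A1 \<times> nc_matchings ?A2) \<subseteq> {g \<in> nc_matchings A. g a = c}"
    proof
      fix h assume "h \<in> glue a c ` (nc_matchings ?A1 \<times> nc_matchings ?A2)"
      then obtain p q where pq: "h = glue a c (p, q)" "matching_on ?A1 p" "noncrossing p" "matching_on ?A2 q" "noncrossing q"
        by (auto simp: nc_matchings_def)
      note P = matching_onD[OF pq(2)] and Q = matching_onD[OF pq(4)]
      have ha: "h a = c" "h c = a" using ac by (simp_all add: pq(1) glue_def)
      have h1: "h x = p x" "p x \<in> ?A1" if "x \<in> ?A1" for x using that P(4)[of x] ac by (auto simp: pq(1) glue_def)
      have h2: "h x = q x" "q x \<in> ?A2" if "x \<in> ?A2" for x using that Q(4)[of x] ac by (auto simp: pq(1) glue_def)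
      have ho: "h x = x" if "x \<notin> A" for x
        using that a(1) c(1) P(5)[of x] Q(5)[of x] by (auto simp: pq(1) glue_def)
      have cs: "x = a \<or> x = c \<or> x \<in> ?A1 \<or> x \<in> ?A2" if "x \<in> A" for x using that a(2)[of x] by auto
      have "matching_on A h"
      proof (rule matching_onI)
        fix x assume x: "x \<in> A"
        show "h x \<in> A" using cs[OF x] ha h1[of x] h2[of x] a(1) c(1) by auto
        show "h x \<noteq> x" using cs[OF x] ha ac h1(1)[of x] h2(1)[of x] P(3)[of x] Q(3)[of x] by auto
        show "h (h x) = x"
          using cs[OF x] ha h1[of x] h2[of x] h1(1)[of "p x"] h2(1)[of "q x"] P(2)[of x] Q(2)[of x] by auto
      qed (rule ho)
      moreover have "noncrossing h" unfolding noncrossing_def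
      proof (intro allI impI)
        fix x y assume xy: "x < y" "y < h x" "h x < h y"
        have xA: "x \<in> A" "y \<in> A" using xy ho[of x] ho[of y] by auto
        show False using cs[OF xA(1)]
        proof (elim disjE)
          assume "x = a"
          hence "y \<in> ?A1" using xy ha xA by auto
          thus False using h1[of y] xy ha \<open>x = a\<close> by auto
        next
          assume "x = c" thus False using xy ha ac by simp
        next
          assume x: "x \<in> ?A1"
          hence "y \<in> ?A1" using xy xA h1[of x] by auto
          thus False using h1(1)[of x] h1(1)[of y] x xy pq(3) unfolding noncrossing_def by metis
        next
          assume x: "x \<in> ?A2"
          hence "y \<in> ?A2" using xy xA by auto
          thus False using h2(1)[of x] h2(1)[of y] x xy pq(5) unfolding noncrossing_def by metis
        qed
      qed
      ultimately show "h \<in> {g \<in> nc_matchings A. g a = c}" using ha by (simp add: nc_matchings_def)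
    qed
  next
    show "\<forall>pq\<in>nc_matchings ?A1 \<times> nc_matchings ?A2.
        (perm_restrict (glue a c pq) ?A1, perm_restrict (glue a c pq) ?A2) = pq"
    proof
      fix pq assume "pq \<in> nc_matchings ?A1 \<times> nc_matchings ?A2"
      then obtain p q where pq: "pq = (p, q)" "matching_on ?A1 p" "matching_on ?A2 q"
        by (auto simp: nc_matchings_def)
      have "perm_restrict (glue a c pq) ?A1 = p"
        using matching_onD(5)[OF pq(2)] ac by (fastforce simp: perm_restrict_def glue_def pq(1))
      moreover have "perm_restrict (glue a c pq) ?A2 = q"
        using matching_onD(5)[OF pq(3)] ac by (fastforce simp: perm_restrict_def glue_def pq(1))
      ultimately show "(perm_restrict (glue a c pq) ?A1, perm_restrict (glue a c pq) ?A2) = pq" using pq(1) by simp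
    qed
  next
    have closed: "(\<forall>x\<in>?A1. g x \<in> ?A1) \<and> (\<forall>x\<in>?A2. g x \<in> ?A2)"
      if "matching_on A g" "noncrossing g" "g a = c" for g
    proof -
      note M = matching_onD[OF that(1)]
      have gc: "g c = a" using M(2)[of a] that(3) by simp
      have 1: "g x \<in> ?A1" if x: "x \<in> ?A1" for x
      proof -
        have "g x \<in> A" using M(4)[of x] x by simp
        moreover have "g x \<noteq> a" "g x \<noteq> c" using M(2)[of x] gc \<open>g a = c\<close> x by auto
        moreover have "\<not> c < g x" using \<open>noncrossing g\<close> x \<open>g a = c\<close> unfolding noncrossing_def by auto
        ultimately show ?thesis using a(2)[of "g x"] by auto
      qed
      have 2: "g x \<in> ?A2" if x: "x \<in> ?A2" for x
      proof -
        have "g x \<in> A" using M(4)[of x] x by simp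
        moreover have "g x \<noteq> a" "g x \<noteq> c" using M(2)[of x] gc \<open>g a = c\<close> x ac by auto
        moreover have "g x \<notin> ?A1"
        proof
          assume "g x \<in> ?A1"
          from 1[OF this] show False using M(2)[of x] x by auto
        qed
        ultimately show ?thesis using a(2)[of "g x"] by auto
      qed
      show ?thesis using 1 2 by blast
    qed
    show "(\<lambda>g. (perm_restrict g ?A1, perm_restrict g ?A2)) ` {g \<in> nc_matchings A. g a = c} \<subseteq> nc_matchings ?A1 \<times> nc_matchings ?A2"
    proof
      fix pq assume "pq \<in> (\<lambda>g. (perm_restrict g ?A1, perm_restrict g ?A2)) ` {g \<in> nc_matchings A. g a = c}"
      then obtain g where g: "pq = (perm_restrict g ?A1, perm_restrict g ?A2)" "matching_on A g" "noncrossing g" "g a = c"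
        by (auto simp: nc_matchings_def)
      note cl = closed[OF g(2-4)]
      have "matching_on ?A1 (perm_restrict g ?A1)" by (rule matching_on_restrict[OF g(2)]) (use cl in auto)
      moreover have "matching_on ?A2 (perm_restrict g ?A2)" by (rule matching_on_restrict[OF g(2)]) (use cl in auto)
      ultimately show "pq \<in> nc_matchings ?A1 \<times> nc_matchings ?A2"
        using noncrossing_restrict[OF g(3)] by (simp add: g(1) nc_matchings_def)
    qed
    show "\<forall>g\<in>{g \<in> nc_matchings A. g a = c}. glue a c (perm_restrict g ?A1, perm_restrict g ?A2) = g"
    proof
      fix g assume "g \<in> {g \<in> nc_matchings A. g a = c}"
      hence g: "matching_on A g" "noncrossing g" "g a = c" by (auto simp: nc_matchings_def)
      note M = matching_onD[OF g(1)]
      have gc: "g c = a" using M(2)[of a] g(3) by simp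
      show "glue a c (perm_restrict g ?A1, perm_restrict g ?A2) = g"
      proof
        fix x
        have "x \<in> A \<Longrightarrow> a \<le> x" by (rule a(2))
        thus "glue a c (perm_restrict g ?A1, perm_restrict g ?A2) x = g x"
          using g(3) gc M(5)[of x] by (auto simp: glue_def perm_restrict_def)
      qed
    qed
  qed
qed

lemma nc_matchings_empty: "nc_matchings {} = {id}"
proof -
  have "matching_on {} g \<longleftrightarrow> g = id" for g :: "nat \<Rightarrow> nat" by (simp add: matching_on_def)
  thus ?thesis by (auto simp: nc_matchings_def noncrossing_def)
qed

lemma card_nc_matchings_odd: "finite A \<Longrightarrow> odd (card A) \<Longrightarrow> nc_matchings A = {}"
  using even_card_matching by (auto simp: nc_matchings_def)

text \<open>Replaces a sum over the points by a sum over their ranks, so that only the number of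
  points matters.\<close>

lemma bij_rank:
  fixes A :: "nat set" assumes "finite A" shows "bij_betw (\<lambda>c. card {x \<in> A. x < c}) A {..<card A}"
proof -
  let ?r = "\<lambda>c. card {x \<in> A. x < c}"
  have less: "?r c < ?r d" if "c \<in> A" "c < d" for c d
    by (rule psubset_card_mono) (use assms that in auto)
  have "inj_on ?r A"
  proof (rule inj_onI)
    fix c d assume "c \<in> A" "d \<in> A" "?r c = ?r d"
    thus "c = d" using less[of c d] less[of d c] by (cases c d rule: linorder_cases) auto
  qed
  moreover have "?r ` A \<subseteq> {..<card A}"
  proof
    fix r assume "r \<in> ?r ` A"
    then obtain c where c: "c \<in> A" "r = ?r c" by auto
    have "?r c < card A" by (rule psubset_card_mono) (use assms c in auto)
    thus "r \<in> {..<card A}" using c by simp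
  qed
  ultimately show ?thesis unfolding bij_betw_def using assms by (simp add: card_image card_subset_eq)
qed

text \<open>Sum over the partner of the least point. If it encloses an odd number of points there is
  no matching; the even cases form the Catalan convolution.\<close>

lemma card_nc_matchings:
  assumes "finite A" "card A = 2 * m" shows "real (card (nc_matchings A)) = catalan m"
  using assms
proof (induction m arbitrary: A rule: less_induct)
  case (less m)
  show ?case
  proof (cases m)
    case 0
    hence "A = {}" using less.prems by simp
    thus ?thesis using 0 by (simp add: nc_matchings_empty catalan_0)
  next
    case (Suc k)
    define a where "a = Min A"
    have "A \<noteq> {}" using less.prems Suc by auto
    hence a: "a \<in> A" "\<And>x. x \<in> A \<Longrightarrow> a \<le> x" using less.prems by (auto simp: a_def)
    let ?B = "A - {a}"
    let ?r = "\<lambda>c. card {x \<in> ?B. x < c}"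
    have finB: "finite ?B" and cB: "card ?B = 2 * k + 1" using less.prems a Suc by auto
    \<comment> \<open>\<open>i\<close> is the number of points enclosed by the chord from
      \<open>a\<close>.\<close>
    let ?w = "\<lambda>i. if even i then catalan (i div 2) * catalan (k - i div 2) else 0"
    have part: "real (card {g \<in> nc_matchings A. g a = c}) = ?w (?r c)" if c: "c \<in> ?B" for c
    proof -
      let ?A1 = "{x \<in> A. a < x \<and> x < c}" and ?A2 = "{x \<in> A. c < x}"
      have fin: "finite ?A1" "finite ?A2" using less.prems by auto
      have eq: "real (card {g \<in> nc_matchings A. g a = c}) = real (card (nc_matchings ?A1)) * real (card (nc_matchings ?A2))"
        using bij_betw_same_card[OF nc_matchings_split[OF a, of c]] c by (simp add: card_cartesian_product flip: of_nat_mult)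
      have A1: "?A1 = {x \<in> ?B. x < c}" using a(2) by (auto simp: le_less)
      have gt: "a < x" if "x \<in> ?B" for x using a(2)[of x] that by auto
      have "?B = ?A1 \<union> ({c} \<union> ?A2)"
      proof (rule set_eqI)
        fix x show "x \<in> ?B \<longleftrightarrow> x \<in> ?A1 \<union> ({c} \<union> ?A2)"
          using gt[of x] gt[OF c] c by (cases x c rule: linorder_cases) auto
      qed
      hence "card ?B = card (?A1 \<union> ({c} \<union> ?A2))" by (rule arg_cong)
      also have "\<dots> = card ?A1 + (1 + card ?A2)" 
      proof -
        have "?A1 \<inter> ({c} \<union> ?A2) = {}" "finite ({c} \<union> ?A2)" "{c} \<inter> ?A2 = {}" using fin by auto
        moreover from this have "card ({c} \<union> ?A2) = 1 + card ?A2" using fin(2) by (subst card_Un_disjoint) auto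
        ultimately show ?thesis using card_Un_disjoint[OF fin(1), of "{c} \<union> ?A2"] by simp
      qed
      finally have cA: "card ?A1 + card ?A2 = 2 * k" using cB by simp
      show ?thesis
      proof (cases "even (?r c)")
        case True
        then obtain i where i: "card ?A1 = 2 * i" unfolding A1 by blast
        hence i2: "card ?A2 = 2 * (k - i)" using cA by simp
        have "i < m" "k - i < m" using i cA Suc by auto
        thus ?thesis using eq less.IH[OF _ fin(1) i] less.IH[OF _ fin(2) i2] True i A1 by simp
      next
        case False
        thus ?thesis using eq card_nc_matchings_odd[OF fin(1)] A1 by simp
      qed
    qed
    have "nc_matchings A = (\<Union>c\<in>?B. {g \<in> nc_matchings A. g a = c})"
    proof -
      have "g a \<in> ?B" if "g \<in> nc_matchings A" for g
        using that matching_onD(3,4)[of A g a] a(1) by (auto simp: nc_matchings_def)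
      thus ?thesis by auto
    qed
    hence "card (nc_matchings A) = card (\<Union>c\<in>?B. {g \<in> nc_matchings A. g a = c})" by (rule arg_cong)
    also have "\<dots> = (\<Sum>c\<in>?B. card {g \<in> nc_matchings A. g a = c})"
      by (rule card_UN_disjoint) (use finB finite_nc_matchings[OF less.prems(1)] in auto)
    finally have "real (card (nc_matchings A)) = (\<Sum>c\<in>?B. ?w (?r c))" using part by simp
    also have "\<dots> = (\<Sum>i<2 * k + 1. ?w i)"
      using sum.reindex_bij_betw[OF bij_rank[OF finB], of ?w] cB by simp
    also have "\<dots> = (\<Sum>i\<in>(\<lambda>i. 2 * i) ` {..k}. ?w i)"
    proof (rule sum.mono_neutral_right)
      show "\<forall>i\<in>{..<2 * k + 1} - (\<lambda>i. 2 * i) ` {..k}. ?w i = 0" by (auto elim!: evenE)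
    qed auto
    also have "\<dots> = (\<Sum>i\<le>k. catalan i * catalan (k - i))"
      by (subst sum.reindex) (auto simp: inj_on_def)
    finally show ?thesis using catalan_convolution[of k] Suc by simp
  qed
qed

section \<open>Matching by heights\<close>

text \<open>
  Openers are up-steps and closers down-steps. An opener is matched with the step at which the height
  first returns. With drift \<open>\<epsilon> = 1\<close> one opener per period never returns; it becomes a diameter.
\<close>

locale height_function =
  fixes h :: "int \<Rightarrow> int" and g \<epsilon> :: int
  assumes g: "g > 0" and eps: "\<epsilon> = 0 \<or> \<epsilon> = 1"
    and step: "\<And>x. \<bar>h (x + 1) - h x\<bar> \<le> 1"
    and per: "\<And>x. h (x + g) = h x + \<epsilon>"
begin

text \<open>Step \<open>x\<close> leads from height \<open>h x\<close> to \<open>h (x + 1)\<close>.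
  The matching step \<open>y\<close> is therefore the one whose end \<open>y + 1\<close> is again at
  height \<open>h x\<close>.\<close>

definition matched :: "int \<Rightarrow> int \<Rightarrow> bool" where
  "matched x y \<longleftrightarrow> x < y \<and> h (y + 1) = h x \<and> (\<forall>z. x < z \<and> z \<le> y \<longrightarrow> h z > h x)"

definition unmatched :: "int \<Rightarrow> bool" where
  "unmatched x \<longleftrightarrow> (\<forall>z>x. h z > h x)"

definition chord :: "int \<Rightarrow> int \<Rightarrow> bool" where
  "chord x y \<longleftrightarrow> matched x y \<or> y = x + g \<and> unmatched x"

lemma step': "h (x + 1) \<le> h x + 1" "h x \<le> h (x + 1) + 1"
  using step[of x] by linarith+

lemma matchedD:
  assumes "matched x y" shows "x < y" "h (y + 1) = h x" "\<And>z. x < z \<Longrightarrow> z \<le> y \<Longrightarrow> h z > h x"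
  using assms by (auto simp: matched_def)

lemma matched_up: "matched x y \<Longrightarrow> h (x + 1) = h x + 1"
  using matchedD[of x y] step'[of x] by (smt (verit))

lemma matched_down: "matched x y \<Longrightarrow> h (y + 1) = h y - 1"
  using matchedD[of x y] step'[of y] by (smt (verit))

lemma unmatched_up: "unmatched x \<Longrightarrow> h (x + 1) = h x + 1"
  using step'[of x] unfolding unmatched_def by (smt (verit))

lemma unmatched_eps: "unmatched x \<Longrightarrow> \<epsilon> = 1"
  using per[of x] g eps unfolding unmatched_def by (smt (verit))

lemma unmatched_not_matched: "unmatched x \<Longrightarrow> \<not> matched x y"
  unfolding unmatched_def using matchedD[of x y] by (smt (verit))

lemma per_shift: "matched (x + g) (y + g) \<longleftrightarrow> matched x y"
proof -
  have e: "(\<forall>z. x + g < z \<and> z \<le> y + g \<longrightarrow> h z > h (x + g)) \<longleftrightarrow> (\<forall>z. x < z \<and> z \<le> y \<longrightarrow> h z > h x)"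
  proof
    assume H: "\<forall>z. x + g < z \<and> z \<le> y + g \<longrightarrow> h z > h (x + g)"
    show "\<forall>z. x < z \<and> z \<le> y \<longrightarrow> h z > h x"
    proof (intro allI impI)
      fix z assume "x < z \<and> z \<le> y"
      thus "h z > h x" using H[rule_format, of "z + g"] per[of z] per[of x] by simp
    qed
  next
    assume H: "\<forall>z. x < z \<and> z \<le> y \<longrightarrow> h z > h x"
    show "\<forall>z. x + g < z \<and> z \<le> y + g \<longrightarrow> h z > h (x + g)"
    proof (intro allI impI)
      fix z assume "x + g < z \<and> z \<le> y + g"
      thus "h z > h (x + g)" using H[rule_format, of "z - g"] per[of "z - g"] per[of x] by simp
    qed
  qed
  have "h (y + g + 1) = h (y + 1) + \<epsilon>" using per[of "y + 1"] by (simp add: algebra_simps)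
  thus ?thesis unfolding matched_def e using per[of x] by simp
qed

lemma unmatched_shift: "unmatched (x + g) \<longleftrightarrow> unmatched x"
proof
  assume H: "unmatched (x + g)"
  show "unmatched x" unfolding unmatched_def
  proof (intro allI impI)
    fix z assume "x < z"
    thus "h z > h x" using H per[of z] per[of x] unfolding unmatched_def by (metis add_less_cancel_right)
  qed
next
  assume H: "unmatched x"
  show "unmatched (x + g)" unfolding unmatched_def
  proof (intro allI impI)
    fix z assume "x + g < z"
    hence "h (z - g) > h x" using H unfolding unmatched_def by simp
    thus "h z > h (x + g)" using per[of "z - g"] per[of x] by simp
  qed
qed

lemma chord_shift: "chord (x + g) (y + g) \<longleftrightarrow> chord x y"
  unfolding chord_def per_shift unmatched_shift by auto

lemma chord_up: "chord x y \<Longrightarrow> h (x + 1) = h x + 1"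
  using matched_up unmatched_up by (auto simp: chord_def)

lemma least_int:
  fixes P :: "int \<Rightarrow> bool"
  assumes "P z0" "z0 > x" shows "\<exists>z>x. P z \<and> (\<forall>w. x < w \<and> w < z \<longrightarrow> \<not> P w)"
proof -
  define k where "k = (LEAST k. P (x + 1 + int k))"
  have "P (x + 1 + int (nat (z0 - x - 1)))" using assms by simp
  hence 1: "P (x + 1 + int k)" unfolding k_def by (rule LeastI)
  moreover have "\<not> P w" if "x < w" "w < x + 1 + int k" for w
  proof
    assume "P w"
    hence "P (x + 1 + int (nat (w - x - 1)))" using that by simp
    hence "k \<le> nat (w - x - 1)" unfolding k_def by (rule Least_le)
    thus False using that by linarith
  qed
  ultimately show ?thesis by (intro exI[of _ "x + 1 + int k"]) auto
qed

text \<open>Heights change by at most one, so the first place at or below \<open>h x\<close> lies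
  exactly at \<open>h x\<close>; the step into it is the partner.\<close>

lemma chord_exists:
  assumes up: "h (x + 1) = h x + 1" shows "\<exists>y. chord x y"
proof (cases "unmatched x")
  case False
  then obtain z0 where "z0 > x" "h z0 \<le> h x" unfolding unmatched_def by force
  then obtain z where z: "z > x" "h z \<le> h x" "\<And>w. x < w \<Longrightarrow> w < z \<Longrightarrow> h w > h x"
    using least_int[of "\<lambda>z. h z \<le> h x" z0 x] by force
  have "z \<noteq> x + 1" using up z(2) by auto
  hence zx: "x < z - 1" using z(1) by simp
  have "h (z - 1) > h x" using z(3)[of "z - 1"] zx by simp
  hence "h z = h x" using step'(2)[of "z - 1"] z(2) by simp
  hence "matched x (z - 1)" unfolding matched_def using zx z(3) by auto
  thus ?thesis by (auto simp: chord_def)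
qed (auto simp: chord_def)

text \<open>A down-step always has a partner: the drift is not negative, so one period earlier the
  height was no larger, and the search to the left ends. The reflection \<open>- z\<close> reduces
  it to a least element.\<close>

lemma matched_exists:
  assumes down: "h (y + 1) = h y - 1" shows "\<exists>x. matched x y"
proof -
  have "h (y + 1 - g) \<le> h (y + 1)" using per[of "y + 1 - g"] eps by auto
  moreover have "- (y + 1 - g) > - y - 1" using g by simp
  ultimately obtain z where z: "z > - y - 1" "h (- z) \<le> h (y + 1)" "\<And>w. - y - 1 < w \<Longrightarrow> w < z \<Longrightarrow> h (- w) > h (y + 1)"
    using least_int[of "\<lambda>z. h (- z) \<le> h (y + 1)" "- (y + 1 - g)" "- y - 1"] by (force simp: not_le)
  define x where "x = - z"
  have x: "x \<le> y" "h x \<le> h (y + 1)" using z(1,2) by (auto simp: x_def)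
  have gt: "h w > h (y + 1)" if "x < w" "w \<le> y" for w using z(3)[of "- w"] that by (auto simp: x_def)
  have "x \<noteq> y" using x(2) down by auto
  hence xy: "x < y" using x(1) by simp
  have "h (x + 1) > h (y + 1)" using gt[of "x + 1"] xy by simp
  hence "h x = h (y + 1)" using step'(1)[of x] x(2) by simp
  hence "matched x y" unfolding matched_def using xy gt by auto
  thus ?thesis by blast
qed

lemma matched_unique_right: "matched x y \<Longrightarrow> matched x y' \<Longrightarrow> y = y'"
proof (rule ccontr)
  assume m: "matched x y" "matched x y'" and "y \<noteq> y'"
  have no: False if "matched x a" "matched x b" "a < b" for a b
    using matchedD[OF that(1)] matchedD(3)[OF that(2), of "a + 1"] that(3) by simp
  show False using no[of y y'] no[of y' y] m \<open>y \<noteq> y'\<close> by linarith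
qed

lemma matched_unique_left: "matched x y \<Longrightarrow> matched x' y \<Longrightarrow> x = x'"
proof (rule ccontr)
  assume m: "matched x y" "matched x' y" and "x \<noteq> x'"
  have no: False if "matched a y" "matched b y" "a < b" for a b
    using matchedD[OF that(1)] matchedD[OF that(2)] that(3) by (smt (verit))
  show False using no[of x x'] no[of x' x] m \<open>x \<noteq> x'\<close> by linarith
qed

text \<open>Were the chord longer, one period before its end the height would already be at most
  \<open>h x\<close>.\<close>

lemma matched_short: "matched x y \<Longrightarrow> y < x + g"
proof (rule ccontr)
  assume m: "matched x y" and "\<not> y < x + g"
  hence "h (y + 1 - g) > h x" using g by (intro matchedD(3)[OF m]) auto
  thus False using per[of "y + 1 - g"] eps matchedD(2)[OF m] by auto
qed

lemma chord_unique: "chord x y \<Longrightarrow> chord x y' \<Longrightarrow> y = y'"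
  using matched_unique_right unmatched_not_matched by (auto simp: chord_def)

lemma chord_bounds: "chord x y \<Longrightarrow> x < y \<and> y \<le> x + g"
  using matched_short[of x y] matchedD(1)[of x y] g by (auto simp: chord_def)

text \<open>Behind \<open>x'\<close> and up to \<open>y'\<close> all heights exceed
  \<open>h x'\<close>, which exceeds \<open>h x\<close>. But \<open>h (y + 1) = h x\<close> if the
  first chord is matched, and \<open>h y = h x + 1\<close> if it spans a whole period; neither is
  high enough.\<close>

lemma chord_noncrossing:
  assumes c: "chord x y" "chord x' y'" and lt: "x < x'" "x' < y" "y < y'"
  shows False
proof -
  have m': "h z > h x'" if "x' < z" "z \<le> y'" for z
    using c(2) that matchedD(3)[of x' y' z] unfolding chord_def unmatched_def by blast
  show False
  proof (cases "unmatched x")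
    case True
    hence "y = x + g" using c(1) unmatched_not_matched by (auto simp: chord_def)
    hence "h y = h x + 1" using per[of x] unmatched_eps[OF True] by simp
    moreover have "h x' > h x" using True lt unfolding unmatched_def by simp
    ultimately show False using m'[of y] lt by simp
  next
    case False
    hence m: "matched x y" using c(1) by (simp add: chord_def)
    have "h (y + 1) > h x'" using m'[of "y + 1"] lt by simp
    moreover have "h x' > h x" using matchedD(3)[OF m, of x'] lt by simp
    ultimately show False using matchedD(2)[OF m] by simp
  qed
qed

text \<open>Not an involution on the integers: an unmatched opener goes one period forward, and its
  image again. It becomes one modulo two periods.\<close>

definition partner :: "int \<Rightarrow> int" where
  "partner x = (if \<exists>y. chord x y then THE y. chord x y else if \<exists>y. matched y x then THE y. matched y x else x)"

lemma partner_chord: "chord x y \<Longrightarrow> partner x = y"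
  unfolding partner_def using chord_unique by (auto intro!: the_equality)

lemma partner_matched: "matched y x \<Longrightarrow> partner x = y"
proof -
  assume m: "matched y x"
  have "\<not> (\<exists>z. chord x z)" using chord_up[of x] matched_down[OF m] by auto
  thus ?thesis unfolding partner_def using m matched_unique_left by (auto intro!: the_equality)
qed

lemma partner_level: "h (x + 1) = h x \<Longrightarrow> partner x = x"
  unfolding partner_def using chord_up[of x] matched_down[of _ x] by force

lemma step_cases: "h (x + 1) = h x + 1 \<or> h (x + 1) = h x - 1 \<or> h (x + 1) = h x"
  using step[of x] by linarith

lemma partner_cases:
  obtains (up) y where "h (x + 1) = h x + 1" "chord x y" "partner x = y"
  | (down) y where "h (x + 1) = h x - 1" "matched y x" "partner x = y"
  | (level) "h (x + 1) = h x" "partner x = x"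
  using step_cases[of x] chord_exists[of x] matched_exists[of x] partner_chord partner_matched partner_level
  by metis

lemma partner_shift: "partner (x + g) = partner x + g"
proof (cases x rule: partner_cases)
  case (up y)
  thus ?thesis using partner_chord[of "x + g" "y + g"] chord_shift by simp
next
  case (down y)
  thus ?thesis using partner_matched[of "y + g" "x + g"] per_shift by simp
next
  case level
  have "h (x + g + 1) = h (x + g)" using level per[of x] per[of "x + 1"] by (simp add: algebra_simps)
  thus ?thesis using partner_level[of "x + g"] level by simp
qed

lemma partner_bounds: "x - g < partner x \<and> partner x \<le> x + g"
proof (cases x rule: partner_cases)
  case (up y)
  thus ?thesis using chord_bounds g by fastforce
next
  case (down y)
  thus ?thesis using matched_short[of y x] matchedD(1)[of y x] g by auto
qed (use g in auto)

lemma partner_less_iff: "partner x < x \<longleftrightarrow> h (x + 1) = h x - 1"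
proof (cases x rule: partner_cases)
  case (up y)
  thus ?thesis using chord_bounds by fastforce
next
  case (down y)
  thus ?thesis using matchedD(1)[of y x] by auto
qed auto

lemma partner_eq_iff: "partner x = x \<longleftrightarrow> h (x + 1) = h x"
proof (cases x rule: partner_cases)
  case (up y)
  thus ?thesis using chord_bounds by fastforce
next
  case (down y)
  thus ?thesis using matchedD(1)[of y x] by auto
qed auto

lemma partner_partner: "partner (partner x) = x \<or> \<epsilon> = 1 \<and> partner (partner x) = x + 2 * g"
proof (cases x rule: partner_cases)
  case (up y)
  show ?thesis
  proof (cases "matched x y")
    case True thus ?thesis using partner_matched up by simp
  next
    case False
    hence "unmatched x" "y = x + g" using up by (auto simp: chord_def)
    hence "partner y = y + g" using partner_chord[of y "y + g"] unmatched_shift[of x] by (simp add: chord_def)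
    thus ?thesis using unmatched_eps[OF \<open>unmatched x\<close>] up \<open>y = x + g\<close> by simp
  qed
next
  case (down y)
  thus ?thesis using partner_chord[of y x] by (auto simp: chord_def)
qed auto

lemma partner_moved: "partner x \<noteq> x \<Longrightarrow> partner (partner x) \<noteq> partner x"
proof (cases x rule: partner_cases)
  case (up y)
  have "partner y \<noteq> y"
  proof (cases "matched x y")
    case True thus ?thesis using partner_matched matchedD(1) by force
  next
    case False
    hence "unmatched (x + g)" "y = x + g" using up unmatched_shift by (auto simp: chord_def)
    thus ?thesis using partner_chord[of y "y + g"] g by (simp add: chord_def)
  qed
  thus ?thesis using up by simp
next
  case (down y)
  thus ?thesis using partner_chord[of y x] matchedD(1)[of y x] by (auto simp: chord_def)
qed auto

end

section \<open>Symmetric noncrossing matchings\<close>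

text \<open>An odd number of points per period leaves one whose partner is its own translate by
  \<open>g\<close>. Such a pairing is an involution on the circle for \<open>d = 2\<close> but not
  for \<open>d = 3\<close>, hence the evenness assumption.\<close>

locale periodic_set =
  fixes K d g :: nat and L :: "nat set"
  assumes Kd: "K = d * g" and d: "d = 2 \<or> d = 3" and g: "g > 0" and LK: "L \<subseteq> {..<K}"
    and per: "\<And>x. x < K \<Longrightarrow> (x + g) mod K \<in> L \<longleftrightarrow> x \<in> L"
    and ev: "d = 3 \<Longrightarrow> even (card (L \<inter> {..<g}))"
begin

text \<open>The circle is unrolled to the integers; \<open>pos\<close> is the covering map.\<close>

definition pos :: "int \<Rightarrow> nat" where
  "pos x = nat (x mod int K)"

lemma K: "K > 0" "2 * g \<le> K" "g < K"
  using Kd d g by auto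

lemma pos_lt: "pos x < K"
  using K by (simp add: pos_def nat_less_iff)

lemma int_pos: "int (pos x) = x mod int K"
  using K by (simp add: pos_def)

lemma pos_int: "i < K \<Longrightarrow> pos (int i) = i"
  by (simp add: pos_def nat_mod_as_int[symmetric])

lemma pos_eq_iff: "pos x = pos y \<longleftrightarrow> x mod int K = y mod int K"
  by (simp add: int_pos[symmetric])

lemma pos_add_K: "pos (x + int K * m) = pos x" "pos (x + int K) = pos x" "pos (x - int K) = pos x"
proof -
  show "pos (x + int K * m) = pos x" by (simp add: pos_def)
  show "pos (x + int K) = pos x" by (simp add: pos_def)
  show "pos (x - int K) = pos x" by (simp add: pos_def)
qed

lemma pos_add_g: "pos (x + int g) = (pos x + g) mod K"
proof -
  have "int ((pos x + g) mod K) = (x mod int K + int g) mod int K" by (simp add: zmod_int int_pos)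
  also have "\<dots> = int (pos (x + int g))" by (simp add: int_pos mod_add_left_eq)
  finally show ?thesis by simp
qed

lemma int_shift_iff:
  assumes "\<And>x::int. P (x + int g) \<longleftrightarrow> P x" shows "P (x + int g * m) \<longleftrightarrow> P x"
proof (induction m rule: int_induct[of _ 0])
  case (step1 i)
  thus ?case using assms[of "x + int g * i"] by (simp add: algebra_simps)
next
  case (step2 i)
  thus ?case using assms[of "x + int g * (i - 1)"] by (simp add: algebra_simps)
qed simp

lemma in_L_shift: "pos (x + int g) \<in> L \<longleftrightarrow> pos x \<in> L"
  unfolding pos_add_g using per pos_lt by simp

lemma in_L_shift_mult: "pos (x + int g * m) \<in> L \<longleftrightarrow> pos x \<in> L"
  by (rule int_shift_iff) (rule in_L_shift)

lemma window_unique: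
  assumes "pos y = pos y'" "x - int g < y" "y \<le> x + int g" "x - int g < y'" "y' \<le> x + int g"
  shows "y = y'"
proof -
  have "int K dvd y - y'" using assms(1) unfolding pos_eq_iff by (rule mod_eq_dvd_iff[THEN iffD1])
  moreover have "\<bar>y - y'\<bar> < int K" using assms(2-5) K by linarith
  ultimately show ?thesis using dvd_imp_le_int[of "y - y'" "int K"] by fastforce
qed

definition sym_matchings :: "(nat \<Rightarrow> nat) set" where
  "sym_matchings = {p. matching_on L p \<and> noncrossing p \<and> rotate_by K g p = p}"

text \<open>The lift of the partner that is nearest to \<open>x\<close>. The window is half-open
  because for \<open>d = 2\<close> the points \<open>x - g\<close> and \<open>x + g\<close> coincide
  on the circle; a diameter is thus always lifted forwards.\<close>

definition short :: "(nat \<Rightarrow> nat) \<Rightarrow> int \<Rightarrow> int" where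
  "short p x = (THE y. x - int g < y \<and> y \<le> x + int g \<and> p (pos x) = pos y)"

definition closers :: "(nat \<Rightarrow> nat) \<Rightarrow> nat set" where
  "closers p = {i. i < g \<and> short p (int i) < int i}"

lemma short_eqI:
  assumes "x - int g < y" "y \<le> x + int g" "p (pos x) = pos y" shows "short p x = y"
  unfolding short_def
proof (rule the_equality)
  fix z assume z: "x - int g < z \<and> z \<le> x + int g \<and> p (pos x) = pos z"
  hence "pos z = pos y" using assms(3) by metis
  thus "z = y" by (rule window_unique[where x = x]) (use z assms in auto)
qed (use assms in blast)

end

section \<open>The unrolled form of a symmetric matching\<close>

locale sym_matching = periodic_set +
  fixes p :: "nat \<Rightarrow> nat"
  assumes p: "p \<in> sym_matchings"
begin

lemma p_match: "matching_on L p" and nc: "noncrossing p" and rot: "rotate_by K g p = p"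
  using p by (auto simp: sym_matchings_def)

lemmas P = matching_onD[OF p_match]

lemma p_lt: "p x < K \<longleftrightarrow> x < K"
  using P(4)[of x] P(5)[of x] LK by (cases "x \<in> L") auto

definition joined :: "int \<Rightarrow> int \<Rightarrow> bool" where
  "joined x y \<longleftrightarrow> p (pos x) = pos y"

lemma joined_sym: "joined x y \<Longrightarrow> joined y x"
  unfolding joined_def using P(2) by metis

lemma joined_cong: "pos x = pos x' \<Longrightarrow> pos y = pos y' \<Longrightarrow> joined x y \<longleftrightarrow> joined x' y'"
  by (simp add: joined_def)

lemma joined_g: "joined x y \<Longrightarrow> joined (x + int g) (y + int g)"
  unfolding joined_def pos_add_g using rotate_by_fixed[OF rot pos_lt] p_lt pos_lt by simp

text \<open>After a translation that puts \<open>x\<close> into the first copy of the circle, some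
  of the four points may lie beyond the cut. Bringing them back rotates the cyclic order, in which
  the chords still alternate.\<close>

lemma joined_noncrossing:
  assumes j: "joined x y" "joined x' y'" and lt: "x < x'" "x' < y" "y < y'" "y' < x + int K"
  shows False
proof -
  let ?q = "x div int K"
  define rx where "rx = x - int K * ?q"
  have rx: "0 \<le> rx" "rx < int K" using K by (simp_all add: rx_def minus_mult_div_eq_mod)
  have no: False if "joined a b" "joined a' b'" "0 \<le> a" "a < a'" "a' < b" "b < b'" "b' < int K" for a b a' b'
  proof -
    have "pos a = nat a" "pos b = nat b" "pos a' = nat a'" "pos b' = nat b'" using that by (simp_all add: pos_def)
    hence "p (nat a) = nat b" "p (nat a') = nat b'" using that(1,2) by (simp_all add: joined_def)
    moreover have "nat a < nat a'" "nat a' < nat b" "nat b < nat b'" using that by auto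
    ultimately show False using nc unfolding noncrossing_def by metis
  qed
  have sh: "joined (a + int K * m) (b + int K * l) \<longleftrightarrow> joined a b" for a b m l
    by (rule joined_cong) (simp_all add: pos_add_K)
  define k where "k z = z - int K * ?q" for z
  have jk: "joined (k a) (k b) \<longleftrightarrow> joined a b" for a b using sh[of a "- ?q" b "- ?q"] by (simp add: k_def)
  have jk1: "joined (k a - int K) (k b) \<longleftrightarrow> joined a b" "joined (k a) (k b - int K) \<longleftrightarrow> joined a b"
    "joined (k a - int K) (k b - int K) \<longleftrightarrow> joined a b" for a b
    using sh[of "k a" "-1" "k b" 0] sh[of "k a" 0 "k b" "-1"] sh[of "k a" "-1" "k b" "-1"] jk[of a b] by simp_all
  have o: "0 \<le> k x" "k x < int K" "k x < k x'" "k x' < k y" "k y < k y'" "k y' < k x + int K"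
    using rx lt by (simp_all add: k_def rx_def)
  \<comment> \<open>According to how many of the four points lie beyond the cut: none, one, two or
    three.\<close>
  have cs: "k y' < int K \<or> int K \<le> k y' \<and> k y < int K \<or> int K \<le> k y \<and> k x' < int K \<or> int K \<le> k x'" by linarith
  note j' = j joined_sym[OF j(1)] joined_sym[OF j(2)]
  from cs show False
  proof (elim disjE conjE)
    assume c: "k y' < int K"
    show False by (rule no[of "k x" "k y" "k x'" "k y'"]) (use j' o c in \<open>simp_all add: jk\<close>)
  next
    assume c: "int K \<le> k y'" "k y < int K"
    show False by (rule no[of "k y' - int K" "k x'" "k x" "k y"]) (use j' o c in \<open>simp_all add: jk jk1\<close>)
  next
    assume c: "int K \<le> k y" "k x' < int K"
    show False by (rule no[of "k y - int K" "k x" "k y' - int K" "k x'"]) (use j' o c in \<open>simp_all add: jk jk1\<close>)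
  next
    assume c: "int K \<le> k x'"
    show False by (rule no[of "k x' - int K" "k y' - int K" "k y - int K" "k x"]) (use j' o c in \<open>simp_all add: jk jk1\<close>)
  qed
qed

text \<open>A chord longer than \<open>g\<close> in both directions would cross its own translate by
  \<open>g\<close>. The exception \<open>y + g = x + K\<close> is a chord that also joins
  \<open>x\<close> to \<open>x + g\<close>.\<close>

lemma short_exists: "\<exists>y. x - int g < y \<and> y \<le> x + int g \<and> joined x y"
proof (cases "pos x \<in> L")
  case False
  thus ?thesis using g P(5) by (intro exI[of _ x]) (auto simp: joined_def)
next
  case True
  define y0 where "y0 = int (p (pos x))"
  define y where "y = x + (y0 - x) mod int K"
  have "pos y0 = p (pos x)" using pos_int[of "p (pos x)"] p_lt[of "pos x"] pos_lt[of x] by (simp add: y0_def)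
  moreover have "pos y = pos y0" unfolding pos_eq_iff y_def by (simp add: mod_simps)
  ultimately have jy: "joined x y" by (simp add: joined_def)
  have "pos x \<noteq> pos y" using jy P(3)[OF True] by (auto simp: joined_def)
  hence "y \<noteq> x" by auto
  moreover have "x \<le> y" "y < x + int K" using K by (simp_all add: y_def)
  ultimately have y: "x < y" "y < x + int K" by auto
  consider "y \<le> x + int g" | "y > x + int K - int g" | "x + int g < y" "y \<le> x + int K - int g" by linarith
  thus ?thesis
  proof cases
    case 1 thus ?thesis using y jy g by (intro exI[of _ y]) auto
  next
    case 2
    have "joined x (y - int K)" using jy by (simp add: joined_def pos_add_K)
    thus ?thesis using 2 y by (intro exI[of _ "y - int K"]) auto
  next
    case 3
    have j2: "joined (x + int g) (y + int g)" by (rule joined_g[OF jy])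
    have "\<not> y + int g < x + int K" using joined_noncrossing[OF jy j2] 3 g by auto
    hence yK: "y + int g = x + int K" using 3 by simp
    hence "pos (y + int g) = pos x" using pos_add_K(2) by simp
    hence "joined (x + int g) x" using j2 by (simp add: joined_def)
    hence "joined x (x + int g)" by (rule joined_sym)
    thus ?thesis using g by (intro exI[of _ "x + int g"]) auto
  qed
qed

lemma short: "x - int g < short p x" "short p x \<le> x + int g" "joined x (short p x)"
proof -
  obtain y where y: "x - int g < y" "y \<le> x + int g" "joined x y" using short_exists by blast
  hence "short p x = y" by (intro short_eqI) (auto simp: joined_def)
  thus "x - int g < short p x" "short p x \<le> x + int g" "joined x (short p x)" using y by auto
qed

lemma p_pos: "p (pos x) = pos (short p x)"
  using short(3)[of x] by (simp add: joined_def)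

lemma short_shift: "short p (x + int g) = short p x + int g"
  by (rule short_eqI) (use short[of x] joined_g[OF short(3)[of x]] in \<open>auto simp: joined_def\<close>)

lemma short_shift_mult: "short p (x + int g * m) = short p x + int g * m"
proof -
  have "short p (x + int g * m) - (x + int g * m) = short p x - x"
  proof (induction m rule: int_induct[of _ 0])
    case (step1 i)
    thus ?case using short_shift[of "x + int g * i"] by (simp add: algebra_simps)
  next
    case (step2 i)
    thus ?case using short_shift[of "x + int g * (i - 1)"] by (simp add: algebra_simps)
  qed simp
  thus ?thesis by simp
qed

lemma short_eq_iff: "short p x = x \<longleftrightarrow> pos x \<notin> L"
proof
  assume "short p x = x"
  hence "p (pos x) = pos x" using p_pos[of x] by simp
  thus "pos x \<notin> L" using P(3) by blast
next
  assume "pos x \<notin> L"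
  thus "short p x = x" using P(5) g by (intro short_eqI) auto
qed

lemma short_short: "short p x \<noteq> x + int g \<Longrightarrow> short p (short p x) = x"
  by (rule short_eqI) (use short[of x] joined_sym[OF short(3)[of x]] in \<open>auto simp: joined_def\<close>)

lemma short_noncrossing:
  assumes "x < x'" "x' < short p x" "short p x < short p x'" shows False
  using joined_noncrossing[OF short(3)[of x] short(3)[of x']] assms short(2)[of x] short(2)[of x'] K by linarith

lemma closers_iff: "short p x < x \<longleftrightarrow> nat (x mod int g) \<in> closers p"
proof -
  have m: "0 \<le> x mod int g" "x mod int g < int g" using g by auto
  have e: "x mod int g + int g * (x div int g) = x" by simp
  have "short p (x mod int g + int g * (x div int g)) = short p (x mod int g) + int g * (x div int g)"
    by (rule short_shift_mult)
  hence "short p x < x \<longleftrightarrow> short p (x mod int g) < x mod int g" unfolding e using e by linarith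
  thus ?thesis using m by (simp add: closers_def nat_less_iff)
qed

lemma closers_subset: "closers p \<subseteq> L \<inter> {..<g}"
proof
  fix i assume "i \<in> closers p"
  hence i: "i < g" "short p (int i) \<noteq> int i" by (auto simp: closers_def)
  hence "pos (int i) \<in> L" using short_eq_iff by blast
  thus "i \<in> L \<inter> {..<g}" using i pos_int[of i] K by simp
qed

text \<open>Taking the partner modulo \<open>g\<close> exchanges closers with those openers that are
  not diameters. At most one diameter remains per period, as two would cross; this is the rounding
  in \<open>div 2\<close>.\<close>

lemma card_closers: "card (closers p) = card (L \<inter> {..<g}) div 2"
proof -
  let ?s = "short p"
  let ?D = "closers p" and ?U = "{i. i < g \<and> int i < ?s (int i) \<and> ?s (int i) < int i + int g}"
  let ?E = "{i. i < g \<and> ?s (int i) = int i + int g}"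
  let ?f = "\<lambda>i. nat (?s (int i) mod int g)"
  \<comment> \<open>Reduced to the fundamental period, the partner has the opposite displacement, so
    openers and closers are exchanged.\<close>
  have f: "?s (int (?f i)) - int (?f i) = int i - ?s (int i)" "?f (?f i) = i" "?f i < g"
    if i: "i < g" "?s (int i) \<noteq> int i + int g" for i
  proof -
    let ?y = "?s (int i)"
    have gi: "int g > 0" using g by simp
    have fi: "int (?f i) = ?y + int g * (- (?y div int g))" 
    proof -
      have "int (?f i) = ?y mod int g" using gi by simp
      also have "\<dots> = ?y - int g * (?y div int g)" by (simp only: minus_mult_div_eq_mod)
      finally show ?thesis by simp
    qed
    have s1: "?s (int (?f i)) = int i + int g * (- (?y div int g))"
      unfolding fi short_shift_mult using short_short[OF i(2)] by simp
    thus "?s (int (?f i)) - int (?f i) = int i - ?y" unfolding fi by simp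
    show "?f i < g" using gi by (simp add: nat_less_iff)
    show "?f (?f i) = i" unfolding s1 using i(1) by (simp add: mod_diff_right_eq[symmetric])
  qed
  have "bij_betw ?f ?U ?D"
  proof (rule bij_betw_byWitness[where f' = ?f])
    show "?f ` ?U \<subseteq> ?D"
    proof
      fix k assume "k \<in> ?f ` ?U"
      then obtain i where i: "i \<in> ?U" "k = ?f i" by blast
      thus "k \<in> ?D" using f[of i] by (simp add: closers_def)
    qed
    show "?f ` ?D \<subseteq> ?U"
    proof
      fix k assume "k \<in> ?f ` ?D"
      then obtain i where i: "i \<in> ?D" "k = ?f i" by blast
      thus "k \<in> ?U" using f[of i] short(1)[of "int i"] by (simp add: closers_def)
    qed
  qed (use f in \<open>auto simp: closers_def\<close>)
  hence UD: "card ?U = card ?D" by (rule bij_betw_same_card)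
  have E: "card ?E \<le> 1"
  proof (rule ccontr)
    assume "\<not> card ?E \<le> 1"
    then obtain i k where ik: "i \<in> ?E" "k \<in> ?E" "i \<noteq> k"
      by (metis (no_types, lifting) One_nat_def card_le_Suc0_iff_eq finite_nat_set_iff_bounded mem_Collect_eq)
    have no: False if "i \<in> ?E" "k \<in> ?E" "i < k" for i k
      using short_noncrossing[of "int i" "int k"] that by simp
    show False using no[of i k] no[of k i] ik by linarith
  qed
  have fin: "finite ?D" "finite ?U" "finite ?E" by (auto simp: closers_def)
  have "L \<inter> {..<g} = ?D \<union> ?U \<union> ?E"
  proof (rule set_eqI)
    fix i
    have "i < g \<Longrightarrow> i \<in> L \<longleftrightarrow> ?s (int i) \<noteq> int i" using short_eq_iff[of "int i"] pos_int[of i] K by simp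
    thus "i \<in> L \<inter> {..<g} \<longleftrightarrow> i \<in> ?D \<union> ?U \<union> ?E"
      using short(2)[of "int i"] by (auto simp: closers_def)
  qed
  moreover have "card (?D \<union> ?U \<union> ?E) = card (?D \<union> ?U) + card ?E"
    by (rule card_Un_disjoint) (use fin in \<open>auto simp: closers_def\<close>)
  moreover have "card (?D \<union> ?U) = card ?D + card ?U"
    by (rule card_Un_disjoint) (use fin in \<open>auto simp: closers_def\<close>)
  ultimately show ?thesis using UD E by simp
qed

end

section \<open>Uniqueness of the matching with given closers\<close>

context periodic_set
begin

text \<open>The closers determine the matching: an opener on which two matchings disagree yields one inside a shorter chord.\<close>

lemma opener_descent:
  assumes p: "p \<in> sym_matchings" and q: "q \<in> sym_matchings" and eq: "closers p = closers q"
    and x: "x < short p x" "short p x < short q x"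
  shows "\<exists>x'. x' < short p x' \<and> x' < short q x' \<and> short p x' \<noteq> short q x' \<and> short q x' - x' < short p x - x"
proof -
  interpret P: sym_matching K d g L p by unfold_locales (rule p)
  interpret Q: sym_matching K d g L q by unfold_locales (rule q)
  define y where "y = short p x"
  have ys: "short p y = x" unfolding y_def by (rule P.short_short) (use x Q.short(2)[of x] in linarith)
  have "short q y < y" using P.closers_iff[of y] Q.closers_iff[of y] eq ys x by (simp add: y_def)
  define x' where "x' = short q y"
  have x'y: "x' < y" unfolding x'_def by fact
  have qx': "short q x' = y" unfolding x'_def by (rule Q.short_short) (use \<open>short q y < y\<close> g in linarith)
  have "x' \<noteq> x" using qx' x(2) by (auto simp: y_def)
  moreover have "\<not> x' < x" using Q.short_noncrossing[of x' x] qx' x by (auto simp: y_def)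
  ultimately have xx': "x < x'" by simp
  have "\<not> short p x' < x'" using P.closers_iff[of x'] Q.closers_iff[of x'] eq qx' x'y by simp
  moreover have "short p x' \<noteq> x'" using P.short_eq_iff[of x'] Q.short_eq_iff[of x'] qx' x'y by auto
  ultimately have up: "x' < short p x'" by simp
  have "short p x' \<noteq> y"
  proof
    assume "short p x' = y"
    moreover from this have "short p (short p x') = x'"
      using x'y Q.short(2)[of x'] P.short(1)[of y] ys xx' by (intro P.short_short) linarith
    ultimately show False using ys xx' by simp
  qed
  thus ?thesis using up qx' x'y xx' by (intro exI[of _ x']) (auto simp: y_def)
qed

text \<open>Infinite descent on the shorter of the two chords. Either matching may have the shorter
  one, so the induction is over all pairs \<open>p\<close>, \<open>q\<close>.\<close>

lemma openers_agree:
  assumes p: "p \<in> sym_matchings" and q: "q \<in> sym_matchings" and eq: "closers p = closers q"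
    and x: "x < short p x" "x < short q x"
  shows "short p x = short q x"
proof (rule ccontr)
  have "False" if "p \<in> sym_matchings" "q \<in> sym_matchings" "closers p = closers q"
    "x < short p x" "x < short q x" "short p x \<noteq> short q x" for p q x
    using that
  proof (induction "nat (min (short p x) (short q x) - x)" arbitrary: p q x rule: less_induct)
    case less
    show ?case
    proof (cases "short p x < short q x")
      case True
      from opener_descent[OF less(2,3,4,5) True] obtain x' where
        x': "x' < short p x'" "x' < short q x'" "short p x' \<noteq> short q x'" "short q x' - x' < short p x - x" by blast
      have "nat (min (short p x') (short q x') - x') < nat (min (short p x) (short q x) - x)"
        using x' True less(5) by auto
      thus False using less(1)[OF _ less(2,3,4) x'(1-3)] by blast
    next
      case False
      hence lt: "short q x < short p x" using less(7) by simp
      from opener_descent[OF less(3,2) less(4)[symmetric] less(6) lt] obtain x' where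
        x': "x' < short q x'" "x' < short p x'" "short q x' \<noteq> short p x'" "short p x' - x' < short q x - x" by blast
      have "nat (min (short p x') (short q x') - x') < nat (min (short p x) (short q x) - x)"
        using x' lt less(6) by auto
      thus False using less(1)[OF _ less(2,3,4) x'(2,1)] x'(3) by auto
    qed
  qed
  moreover assume "short p x \<noteq> short q x"
  ultimately show False using assms by blast
qed

lemma inj_closers: "inj_on closers sym_matchings"
proof (rule inj_onI)
  fix p q assume p: "p \<in> sym_matchings" and q: "q \<in> sym_matchings" and eq: "closers p = closers q"
  interpret P: sym_matching K d g L p by unfold_locales (rule p)
  interpret Q: sym_matching K d g L q by unfold_locales (rule q)
  have down: "short p x < x \<longleftrightarrow> short q x < x" for x using P.closers_iff Q.closers_iff eq by simp
  have level: "short p x = x \<longleftrightarrow> short q x = x" for x using P.short_eq_iff Q.short_eq_iff by simp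
  have s: "short p x = short q x" for x
  proof -
    consider "short p x = x" | "x < short p x" | "short p x < x" by linarith
    thus ?thesis
    proof cases
      case 1 thus ?thesis using level by metis
    next
      case 2
      hence "x < short q x" using down[of x] level[of x] by linarith
      thus ?thesis by (rule openers_agree[OF p q eq 2])
    next
      case 3
      \<comment> \<open>A closer inherits agreement from the opener at the other end; that chord is
        shorter than a period, as the window omits \<open>x - g\<close>.\<close>
      define y where "y = short p x"
      have py: "short p y = x" unfolding y_def by (rule P.short_short) (use 3 g in linarith)
      have yx: "y < x" using 3 by (simp add: y_def)
      have "y < short q y" using down[of y] level[of y] py yx by linarith
      hence "short q y = x" using openers_agree[OF p q eq, of y] py yx by simp
      moreover have "x \<noteq> y + int g" using P.short(1)[of x] by (simp add: y_def)
      ultimately have "short q x = y" using Q.short_short[of y] by simp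
      thus ?thesis by (simp add: y_def)
    qed
  qed
  show "p = q"
  proof
    fix i show "p i = q i"
    proof (cases "i < K")
      case True
      thus ?thesis using P.p_pos[of "int i"] Q.p_pos[of "int i"] s pos_int by simp
    next
      case False
      hence "i \<notin> L" using LK by auto
      thus ?thesis using P.P(5) Q.P(5) by simp
    qed
  qed
qed

section \<open>Existence of a matching with given closers\<close>

context
  fixes U
  assumes U: "U \<subseteq> L \<inter> {..<g}" "card U = card (L \<inter> {..<g}) div 2"
begin

definition slope :: "int \<Rightarrow> int" where
  "slope x = (if pos x \<notin> L then 0 else if nat (x mod int g) \<in> U then -1 else 1)"

definition drift :: int where
  "drift = int (card (L \<inter> {..<g})) - 2 * int (card U)"

text \<open>The partial sums of \<open>slope\<close>, written with quotient and remainder so that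
  negative arguments are covered; each complete period contributes \<open>drift\<close>.\<close>

definition height :: "int \<Rightarrow> int" where
  "height x = (\<Sum>i<nat (x mod int g). slope (int i)) + x div int g * drift"

lemma slope_mod: "slope (int (nat (x mod int g))) = slope x"
proof -
  have gi: "int g > 0" using g by simp
  have "int (nat (x mod int g)) = x mod int g" using gi by simp
  moreover have "pos (x mod int g + int g * (x div int g)) \<in> L \<longleftrightarrow> pos (x mod int g) \<in> L" by (rule in_L_shift_mult)
  ultimately show ?thesis by (simp add: slope_def)
qed

lemma sum_slope: "(\<Sum>i<g. slope (int i)) = drift"
proof -
  have fin: "finite (L \<inter> {..<g})" by simp
  have "slope (int i) = (if i \<in> L then 1 else 0) - 2 * (if i \<in> U then 1 else 0)" if "i < g" for i
  proof -
    have "pos (int i) = i" using that K by (intro pos_int) simp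
    thus ?thesis using that U(1) by (auto simp: slope_def)
  qed
  hence "(\<Sum>i<g. slope (int i)) = (\<Sum>i<g. (if i \<in> L then 1 else 0) - 2 * (if i \<in> U then 1 else 0))" by simp
  also have "\<dots> = (\<Sum>i<g. if i \<in> L then 1 else 0) - 2 * (\<Sum>i<g. if i \<in> U then 1 else 0)"
    by (simp add: sum_subtractf sum_distrib_left)
  also have "(\<Sum>i<g. if i \<in> L then 1 else 0 :: int) = int (card (L \<inter> {..<g}))"
    by (simp add: sum.If_cases Int_commute)
  also have "(\<Sum>i<g. if i \<in> U then 1 else 0 :: int) = int (card U)"
    using U(1) by (simp add: sum.If_cases Int_absorb1 inf.absorb2)
  finally show ?thesis by (simp add: drift_def)
qed

lemma height_step: "height (x + 1) = height x + slope x"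
proof -
  define r q where "r = nat (x mod int g)" and "q = x div int g"
  have gi: "int g > 0" using g by simp
  have x: "x = int g * q + int r" "r < g" using gi by (simp_all add: r_def q_def nat_less_iff)
  have hx: "height x = (\<Sum>i<r. slope (int i)) + q * drift" by (simp add: height_def r_def q_def)
  have sx: "slope (int r) = slope x" unfolding r_def by (rule slope_mod)
  show ?thesis
  proof (cases "Suc r = g")
    case True
    have "int r + 1 = int g" using True by simp
    hence "x + 1 = int g * q + int g" using x(1) by linarith
    also have "\<dots> = int g * (q + 1)" by (simp only: distrib_left mult_1_right)
    finally have "x + 1 = int g * (q + 1)" .
    hence "height (x + 1) = (q + 1) * drift" using gi by (simp add: height_def)
    also have "drift = (\<Sum>i<r. slope (int i)) + slope (int r)" using sum_slope True by (metis sum.lessThan_Suc)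
    hence "(q + 1) * drift = q * drift + ((\<Sum>i<r. slope (int i)) + slope (int r))" by (simp add: algebra_simps)
    finally show ?thesis using hx sx by simp
  next
    case False
    hence r1: "Suc r < g" using x(2) by simp
    have e: "x + 1 = int (Suc r) + int g * q" using x(1) by simp
    have lt: "0 \<le> int (Suc r)" "int (Suc r) < int g" using r1 by simp_all
    have "(x + 1) mod int g = int (Suc r)"
      unfolding e mod_mult_self2 by (rule mod_pos_pos_trivial[OF lt])
    moreover have "(x + 1) div int g = q"
      using div_mult_self2[of "int g" "int (Suc r)" q] div_pos_pos_trivial[OF lt] gi unfolding e by simp
    ultimately have "(x + 1) mod int g = int (Suc r)" "(x + 1) div int g = q" .
    hence "height (x + 1) = (\<Sum>i<Suc r. slope (int i)) + q * drift" by (simp only: height_def nat_int)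
    thus ?thesis using hx sx by simp
  qed
qed

text \<open>With an odd number of points per period, possible for \<open>d = 2\<close> only,
  rounding down leaves one opener more than closers.\<close>

lemma drift: "drift = 0 \<or> drift = 1 \<and> d = 2"
  using d ev U(2) by (cases "even (card (L \<inter> {..<g}))") (auto simp: drift_def elim!: evenE oddE)

lemma height_function: "height_function height (int g) drift"
proof
  fix x
  show "\<bar>height (x + 1) - height x\<bar> \<le> 1" using height_step[of x] by (simp add: slope_def)
  show "height (x + int g) = height x + drift" using g by (simp add: height_def algebra_simps)
qed (use g drift in auto)

interpretation H: height_function height "int g" drift by (rule height_function)

definition sym_partner :: "nat \<Rightarrow> nat" where
  "sym_partner i = (if i < K then pos (H.partner (int i)) else i)"

lemma partner_shift_mult: "H.partner (x + int g * m) = H.partner x + int g * m"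
proof -
  have "H.partner (x + int g * m) - (x + int g * m) = H.partner x - x"
  proof (induction m rule: int_induct[of _ 0])
    case (step1 i)
    thus ?case using H.partner_shift[of "x + int g * i"] by (simp add: algebra_simps)
  next
    case (step2 i)
    thus ?case using H.partner_shift[of "x + int g * (i - 1)"] by (simp add: algebra_simps)
  qed simp
  thus ?thesis by simp
qed

lemma sym_partner_pos: "sym_partner (pos x) = pos (H.partner x)"
proof -
  have "x = int (pos x) + int K * (x div int K)" by (simp add: int_pos)
  also have "\<dots> = int (pos x) + int g * (int d * (x div int K))" using Kd by simp
  finally have "H.partner x = H.partner (int (pos x)) + int g * (int d * (x div int K))"
    using partner_shift_mult by metis
  also have "\<dots> = H.partner (int (pos x)) + int K * (x div int K)" using Kd by simp
  finally show ?thesis using pos_lt[of x] pos_add_K(1) by (simp add: sym_partner_def)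
qed

lemma level_iff: "height (x + 1) = height x \<longleftrightarrow> pos x \<notin> L"
  using height_step[of x] by (simp add: slope_def)

lemma partner_in_L: "pos (H.partner x) \<in> L \<longleftrightarrow> pos x \<in> L"
proof -
  have "H.partner x = x \<longleftrightarrow> pos x \<notin> L" for x using H.partner_eq_iff level_iff by simp
  thus ?thesis using H.partner_moved[of x] by metis
qed

lemma sym_partner_matching: "matching_on L sym_partner"
proof (rule matching_onI)
  fix i assume i: "i \<in> L"
  hence iK: "i < K" using LK by auto
  have pi: "pos (int i) = i" by (rule pos_int[OF iK])
  have si: "sym_partner i = pos (H.partner (int i))" using iK by (simp add: sym_partner_def)
  show "sym_partner i \<in> L" unfolding si using partner_in_L pi i by simp
  have ne: "H.partner (int i) \<noteq> int i" using H.partner_eq_iff level_iff pi i by simp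
  show "sym_partner i \<noteq> i"
  proof
    assume "sym_partner i = i"
    hence "pos (H.partner (int i)) = pos (int i)" using si pi by simp
    hence "H.partner (int i) = int i"
      by (rule window_unique[where x = "int i"]) (use H.partner_bounds[of "int i"] g in auto)
    thus False using ne by simp
  qed
  have "sym_partner (sym_partner i) = pos (H.partner (H.partner (int i)))" unfolding si by (rule sym_partner_pos)
  also have "\<dots> = pos (int i)"
  proof (cases "H.partner (H.partner (int i)) = int i")
    \<comment> \<open>The pair is a diameter: drift 1 forces \<open>d = 2\<close>, so two periods
      forward are one full turn.\<close>
    case False
    hence "drift = 1" "H.partner (H.partner (int i)) = int i + 2 * int g" using H.partner_partner by auto
    moreover from this have "int i + 2 * int g = int i + int K" using drift Kd by simp
    ultimately show ?thesis using pos_add_K(2) by simp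
  qed simp
  finally show "sym_partner (sym_partner i) = i" using pi by simp
next
  fix i assume i: "i \<notin> L"
  show "sym_partner i = i"
  proof (cases "i < K")
    case True
    hence "H.partner (int i) = int i" using H.partner_eq_iff level_iff pos_int i by simp
    thus ?thesis using True pos_int by (simp add: sym_partner_def)
  qed (simp add: sym_partner_def)
qed

text \<open>If the partner of \<open>i\<close> lies to its right on the circle, the lifted chord
  either starts at \<open>i\<close> and stays before the cut, or starts at the partner and passes
  the cut to end at \<open>i + K\<close>.\<close>

lemma sym_partner_chord:
  assumes i: "i < K" "i < sym_partner i"
  shows "H.chord (int i) (int (sym_partner i)) \<or> H.chord (int (sym_partner i)) (int i + int K)"
proof -
  let ?y = "H.partner (int i)"
  have s: "sym_partner i = pos ?y" using i(1) by (simp add: sym_partner_def)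
  show ?thesis
  proof (cases "int i" rule: H.partner_cases)
    case (up y)
    have b: "int i < y" "y \<le> int i + int g" using H.chord_bounds[OF up(2)] by auto
    have "y < int K"
    proof (rule ccontr)
      assume "\<not> y < int K"
      moreover have "y < 2 * int K" using b i K by linarith
      ultimately have "(y - int K) mod int K = y - int K" by (intro mod_pos_pos_trivial) linarith+
      hence "pos (y - int K) = nat (y - int K)" by (simp only: pos_def)
      hence "sym_partner i = nat (y - int K)" using s up(3) pos_add_K(3) by simp
      thus False using i(2) b K by linarith
    qed
    hence "pos y = nat y" using b by (simp add: pos_def)
    thus ?thesis using s up b by simp
  next
    case (down y)
    have m: "y < int i" "int i < y + int g" using H.matchedD(1)[OF down(2)] H.matched_short[OF down(2)] by auto
    have "y < 0"
    proof (rule ccontr)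
      assume "\<not> y < 0"
      hence "pos y = nat y" using m i by (simp add: pos_def)
      hence "sym_partner i = nat y" using s down(3) by simp
      thus False using i(2) m \<open>\<not> y < 0\<close> by linarith
    qed
    hence "(y + int K) mod int K = y + int K" using m K by (intro mod_pos_pos_trivial) linarith+
    hence "pos (y + int K) = nat (y + int K)" by (simp only: pos_def)
    hence e: "int (sym_partner i) = y + int K" using s down(3) pos_add_K(2) m K by simp
    have "H.partner (y + int K) = int i + int K"
    proof -
      have "H.partner y = int i" using H.partner_chord[of y "int i"] down(2) by (simp add: H.chord_def)
      thus ?thesis using partner_shift_mult[of y "int d"] Kd by (simp add: mult.commute)
    qed
    moreover have "H.chord (y + int K) (H.partner (y + int K))"
    proof (cases "y + int K" rule: H.partner_cases)
      case (up z) thus ?thesis by simp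
    next
      case (down z)
      thus ?thesis using H.matchedD(1)[OF down(2)] calculation m by simp
    next
      case level thus ?thesis using calculation m by simp
    qed
    ultimately show ?thesis using e by simp
  next
    case level
    thus ?thesis using s i pos_int by simp
  qed
qed

text \<open>In each of the four combinations of lifted chords, after a translation by
  \<open>K\<close> if necessary, the two intervals overlap without nesting, which chords of a height
  function never do.\<close>

lemma sym_partner_noncrossing: "noncrossing sym_partner"
  unfolding noncrossing_def
proof (intro allI impI)
  fix a b assume ab: "a < b" "b < sym_partner a" "sym_partner a < sym_partner b"
  have bK: "b < K" using ab by (cases "b < K") (auto simp: sym_partner_def)
  hence aK: "a < K" using ab by simp
  have sK: "sym_partner b < K" using bK pos_lt by (simp add: sym_partner_def)
  let ?A = "int (sym_partner a)" and ?B = "int (sym_partner b)"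
  have sh: "H.chord (x + int K) (y + int K) \<longleftrightarrow> H.chord x y" for x y
  proof -
    have "H.chord (x + int g * int m) (y + int g * int m) \<longleftrightarrow> H.chord x y" for m
    proof (induct m)
      case (Suc m)
      thus ?case using H.chord_shift[of "x + int g * int m" "y + int g * int m"] by (simp add: algebra_simps)
    qed simp
    from this[of d] show ?thesis using Kd by (simp add: mult.commute)
  qed
  have o: "int a < int b" "int b < ?A" "?A < ?B" "?B < int K" "0 \<le> int a" using ab sK by auto
  from sym_partner_chord[OF aK] sym_partner_chord[OF bK] ab
  have cs: "H.chord (int a) ?A \<or> H.chord ?A (int a + int K)" "H.chord (int b) ?B \<or> H.chord ?B (int b + int K)" by auto
  from cs show False
  proof (elim disjE)
    assume "H.chord (int a) ?A" "H.chord (int b) ?B"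
    thus False using H.chord_noncrossing o by blast
  next
    assume "H.chord (int a) ?A" "H.chord ?B (int b + int K)"
    hence "H.chord (int a + int K) (?A + int K)" "H.chord ?B (int b + int K)" using sh by auto
    from H.chord_noncrossing[OF this(2,1)] show False using o by linarith
  next
    assume c: "H.chord ?A (int a + int K)" "H.chord (int b) ?B"
    from H.chord_noncrossing[OF c(2,1)] show False using o by linarith
  next
    assume c: "H.chord ?A (int a + int K)" "H.chord ?B (int b + int K)"
    from H.chord_noncrossing[OF c] show False using o by linarith
  qed
qed

lemma sym_partner_in: "sym_partner \<in> sym_matchings" and closers_sym_partner: "closers sym_partner = U"
proof -
  have "rotate_by K g sym_partner = sym_partner"
  proof (rule rotate_by_eq_self)
    fix x assume x: "x < K"
    have "sym_partner ((x + g) mod K) = sym_partner (pos (int x + int g))" using pos_add_g[of "int x"] pos_int[OF x] by simp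
    also have "\<dots> = pos (H.partner (int x) + int g)" unfolding sym_partner_pos H.partner_shift ..
    also have "\<dots> = (sym_partner x + g) mod K" unfolding pos_add_g using x by (simp add: sym_partner_def)
    finally show "sym_partner ((x + g) mod K) = (sym_partner x + g) mod K" .
  qed (auto simp: sym_partner_def pos_lt)
  thus "sym_partner \<in> sym_matchings"
    using sym_partner_matching sym_partner_noncrossing by (simp add: sym_matchings_def)
  have "short sym_partner x = H.partner x" for x
    by (rule short_eqI) (use H.partner_bounds[of x] sym_partner_pos in auto)
  hence "closers sym_partner = {i. i < g \<and> slope (int i) = -1}"
    using H.partner_less_iff height_step by (auto simp: closers_def)
  also have "\<dots> = U"
  proof -
    have "slope (int i) = -1 \<longleftrightarrow> i \<in> U" if "i < g" for i
      using that U(1) pos_int[of i] K by (auto simp: slope_def)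
    thus ?thesis using U(1) by auto
  qed
  finally show "closers sym_partner = U" .
qed

end

lemma card_sym_matchings: "card sym_matchings = card (L \<inter> {..<g}) choose (card (L \<inter> {..<g}) div 2)"
proof -
  let ?S = "{U. U \<subseteq> L \<inter> {..<g} \<and> card U = card (L \<inter> {..<g}) div 2}"
  have "closers ` sym_matchings = ?S"
  proof (intro equalityI subsetI)
    fix U assume "U \<in> closers ` sym_matchings"
    then obtain q where q: "q \<in> sym_matchings" "U = closers q" by auto
    interpret sym_matching K d g L q by unfold_locales (rule q(1))
    show "U \<in> ?S" using closers_subset card_closers q(2) by simp
  next
    fix U assume "U \<in> ?S"
    hence U: "U \<subseteq> L \<inter> {..<g}" "card U = card (L \<inter> {..<g}) div 2" by auto
    show "U \<in> closers ` sym_matchings"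
      using sym_partner_in[OF U] closers_sym_partner[OF U] by (intro image_eqI[of _ _ "sym_partner U"]) simp_all
  qed
  hence "card sym_matchings = card ?S" using card_image[OF inj_closers] by simp
  also have "\<dots> = card (L \<inter> {..<g}) choose (card (L \<inter> {..<g}) div 2)" by (rule n_subsets) simp
  finally show ?thesis .
qed

end

section \<open>The count\<close>

text \<open>The number of matchings does not vary with the tree, so the sum over trees becomes a
  product.\<close>

lemma card_rooted_diagrams:
  assumes "\<And>f. f \<in> cubic_trees (6 * n) \<Longrightarrow> rotate_by (6 * n) s f = f \<Longrightarrow> f 0 = c \<Longrightarrow>
    card {g. matching_on {x. x < 6 * n \<and> f x = x} g \<and> noncrossing g \<and> rotate_by (6 * n) s g = g} = N"
  shows "card (rooted_diagrams n s c) = card {f \<in> cubic_trees (6 * n). rotate_by (6 * n) s f = f \<and> f 0 = c} * N"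
proof -
  let ?F = "{f \<in> cubic_trees (6 * n). rotate_by (6 * n) s f = f \<and> f 0 = c}"
  let ?G = "\<lambda>f. {g. matching_on {x. x < 6 * n \<and> f x = x} g \<and> noncrossing g \<and> rotate_by (6 * n) s g = g}"
  have "finite ?F"
    by (rule finite_subset[of _ "{f. f permutes {..<6 * n}}"]) (auto intro: cubic_treesD(1) finite_permutations)
  moreover have "finite (?G f)" for f
    by (rule finite_subset[of _ "nc_matchings {x. x < 6 * n \<and> f x = x}"])
      (auto simp: nc_matchings_def intro: finite_nc_matchings[unfolded nc_matchings_def])
  moreover have "rooted_diagrams n s c = Sigma ?F ?G"
    by (auto simp: rooted_diagrams_def diagrams_def rotate_diagram_def)
  ultimately have "card (rooted_diagrams n s c) = (\<Sum>f\<in>?F. card (?G f))" by (simp add: card_SigmaI)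
  also have "\<dots> = (\<Sum>f\<in>?F. N)" by (rule sum.cong[OF refl]) (use assms in blast)
  finally show ?thesis by simp
qed

lemma card_rooted_leaf:
  assumes n: "n \<ge> 1"
  shows "real (card (rooted_diagrams n 0 0)) = catalan (n + 1) * catalan (2 * n)"
proof -
  let ?C = "card {t. nodes t = n + 1}"
  have "card {g. matching_on {x. x < 6 * n \<and> f x = x} g \<and> noncrossing g \<and> rotate_by (6 * n) 0 g = g} = ?C"
    if f: "f \<in> cubic_trees (6 * n)" for f
  proof -
    have "card {x. x < 6 * n \<and> f x = x} = 2 * (n + 1)" using card_cubic_tree(2)[OF f n] by simp
    hence "real (card (nc_matchings {x. x < 6 * n \<and> f x = x})) = real ?C"
      unfolding card_nodes by (intro card_nc_matchings) simp_all
    thus ?thesis by (simp add: nc_matchings_def rotate_by_0)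
  qed
  hence "card (rooted_diagrams n 0 0) = card {f \<in> cubic_trees (6 * n). rotate_by (6 * n) 0 f = f \<and> f 0 = 0} * ?C"
    by (intro card_rooted_diagrams) blast
  also have "card {f \<in> cubic_trees (6 * n). rotate_by (6 * n) 0 f = f \<and> f 0 = 0} = card {t. nodes t = 2 * n}"
    using card_trees_leaf_root[OF n] by (simp add: rotate_by_0)
  finally show ?thesis using card_nodes[of "n + 1"] card_nodes[of "2 * n"] by simp
qed

text \<open>\<open>j\<close> is the number of free darts per period. For \<open>d = 3\<close> the
  equation \<open>2 * n + 2 = 3 * j\<close> makes \<open>j\<close> even, as the symmetric count
  demands.\<close>

lemma card_symmetric_matchings:
  assumes n: "n \<ge> 1" and f: "f \<in> cubic_trees (6 * n)" "rotate_by (6 * n) g f = f"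
    and dg: "6 * n = d * g" "d = 2 \<or> d = 3" and j: "2 * n + 2 = d * j"
  shows "card {p. matching_on {x. x < 6 * n \<and> f x = x} p \<and> noncrossing p \<and> rotate_by (6 * n) g p = p} = j choose (j div 2)"
proof -
  let ?L = "{x. x < 6 * n \<and> f x = x}"
  note F = cubic_treesD[OF f(1)]
  have g: "g > 0" "g < 6 * n" using dg n by auto
  have per: "(x + g) mod (6 * n) \<in> ?L \<longleftrightarrow> x \<in> ?L" if x: "x < 6 * n" for x
  proof -
    have fx: "f x < 6 * n" using F(3) x by simp
    have "f ((x + g) mod (6 * n)) = (f x + g) mod (6 * n)" by (rule rotate_by_fixed[OF f(2) x fx])
    moreover have "(f x + g) mod (6 * n) = (x + g) mod (6 * n) \<longleftrightarrow> f x = x"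
    proof
      assume e: "(f x + g) mod (6 * n) = (x + g) mod (6 * n)"
      thus "f x = x" using fx x g by (auto simp: mod_if split: if_splits)
    qed simp
    ultimately show ?thesis using x n by simp
  qed
  have "card ?L = d * card (?L \<inter> {..<g})"
  proof (rule card_periodic_set)
    fix x assume "x + g < d * g"
    hence "x + g < 6 * n" using dg by simp
    thus "x + g \<in> ?L \<longleftrightarrow> x \<in> ?L" using per[of x] by simp
  qed (use dg in auto)
  hence "d * card (?L \<inter> {..<g}) = d * j" using card_cubic_tree(2)[OF f(1) n] j by simp
  hence cj: "card (?L \<inter> {..<g}) = j" using dg(2) by auto
  have ev: "even j" if "d = 3"
  proof -
    have "even (3 * j)" using j that by (metis dvd_add_right_iff dvd_triv_left dvd_refl)
    thus ?thesis by simp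
  qed
  interpret periodic_set "6 * n" d g ?L
    by unfold_locales (use dg g per ev cj in auto)
  show ?thesis using card_sym_matchings unfolding cj sym_matchings_def by simp
qed

lemma card_rooted_edge:
  assumes n: "n \<ge> 1"
  shows "real (card (rooted_diagrams n (3 * n) (3 * n))) = catalan n * real ((n + 1) choose ((n + 1) div 2))"
proof -
  have "card (rooted_diagrams n (3 * n) (3 * n)) =
      card {f \<in> cubic_trees (6 * n). rotate_by (6 * n) (3 * n) f = f \<and> f 0 = 3 * n} * ((n + 1) choose ((n + 1) div 2))"
    by (rule card_rooted_diagrams, rule card_symmetric_matchings[OF n, where d = 2]) auto
  thus ?thesis using card_trees_edge_center[OF n] card_nodes[of n] by simp
qed

text \<open>Here \<open>2 * n + 2 = 3 * (2 * m)\<close>, so there are \<open>2 * m\<close> free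
  darts per period, and \<open>3 * nodes t + 1 = 2 * n = 6 * m - 2\<close> gives a branch of
  \<open>2 * m - 1\<close> nodes.\<close>

lemma card_rooted_vertex:
  assumes n: "n \<ge> 1" and m: "n + 1 = 3 * m"
  shows "real (card (rooted_diagrams n (2 * n) (2 * n - 1))) = catalan (2 * m - 1) * real ((2 * m) choose m)"
proof -
  have "2 * n + 2 = 3 * (2 * m)" using m by simp
  hence "card (rooted_diagrams n (2 * n) (2 * n - 1)) =
      card {f \<in> cubic_trees (6 * n). rotate_by (6 * n) (2 * n) f = f \<and> f 0 = 2 * n - 1} * ((2 * m) choose ((2 * m) div 2))"
    by (intro card_rooted_diagrams card_symmetric_matchings[OF n, where d = 3]) auto
  moreover have "{t. 3 * nodes t + 1 = 2 * n} = {t. nodes t = 2 * m - 1}"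
  proof (rule Collect_cong)
    fix t show "3 * nodes t + 1 = 2 * n \<longleftrightarrow> nodes t = 2 * m - 1" using m n by linarith
  qed
  ultimately show ?thesis using card_trees_vertex_center[OF n] card_nodes[of "2 * m - 1"] by simp
qed

text \<open>The size equation of a branch at a central vertex is solvable only if
  \<open>2 * n\<close> is 1 modulo 3, that is, if 3 divides \<open>n + 1\<close>.\<close>

lemma card_rooted_vertex_0:
  assumes n: "n \<ge> 1" and m: "\<not> 3 dvd (n + 1)"
  shows "card (rooted_diagrams n (2 * n) (2 * n - 1)) = 0"
proof -
  have "{t. 3 * nodes t + 1 = 2 * n} = {}"
  proof (rule equals0I)
    fix t assume "t \<in> {t. 3 * nodes t + 1 = 2 * n}"
    hence "3 * nodes t + 1 = 2 * n" by simp
    thus False using m by presburger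
  qed
  hence "card {f \<in> cubic_trees (6 * n). rotate_by (6 * n) (2 * n) f = f \<and> f 0 = 2 * n - 1} = 0"
    using card_trees_vertex_center[OF n] by simp
  moreover have "finite {f \<in> cubic_trees (6 * n). rotate_by (6 * n) (2 * n) f = f \<and> f 0 = 2 * n - 1}"
    by (rule finite_subset[of _ "{f. f permutes {..<6 * n}}"]) (auto intro: cubic_treesD(1) finite_permutations)
  ultimately have e: "{f \<in> cubic_trees (6 * n). rotate_by (6 * n) (2 * n) f = f \<and> f 0 = 2 * n - 1} = {}" by simp
  have "card (rooted_diagrams n (2 * n) (2 * n - 1)) =
      card {f \<in> cubic_trees (6 * n). rotate_by (6 * n) (2 * n) f = f \<and> f 0 = 2 * n - 1} * 0"
    by (rule card_rooted_diagrams) (use e in blast)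
  thus ?thesis by simp
qed

lemma num_tree_rooted_formula:
  assumes n: "n \<ge> 1"
  shows "(2 * real n + 2) * real (num_tree_rooted n) = catalan (n + 1) * catalan (2 * n)
    + (real n + 1) * catalan n * real ((n + 1) choose ((n + 1) div 2))
    + 4 / 3 * (real n + 1) * real (card (rooted_diagrams n (2 * n) (2 * n - 1)))"
proof -
  have "real (3 * (2 * n + 2) * num_tree_rooted n) = real (3 * card (rooted_diagrams n 0 0)
    + 3 * (n + 1) * card (rooted_diagrams n (3 * n) (3 * n)) + 4 * (n + 1) * card (rooted_diagrams n (2 * n) (2 * n - 1)))"
    by (rule arg_cong[OF num_tree_rooted_eq[OF n]])
  hence "3 * (2 * real n + 2) * real (num_tree_rooted n) = 3 * real (card (rooted_diagrams n 0 0))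
    + 3 * (real n + 1) * real (card (rooted_diagrams n (3 * n) (3 * n)))
    + 4 * (real n + 1) * real (card (rooted_diagrams n (2 * n) (2 * n - 1)))"
    by (simp add: add.commute)
  thus ?thesis unfolding card_rooted_leaf[OF n] card_rooted_edge[OF n] by (simp add: field_simps)
qed

text \<open>Pascal's rule and symmetry. For odd \<open>n + 1\<close> it turns the middle coefficient
  into the central one of the next row, the origin of the factor \<open>1 / 2\<close>.\<close>

lemma half_central_binomial:
  assumes "k \<ge> 1" shows "real ((2 * k - 1) choose (k - 1)) = 1 / 2 * real ((2 * k) choose k)"
proof -
  obtain i where i: "k = Suc i" using assms by (cases k) auto
  have "(2 * k) choose k = (Suc (2 * i) choose i) + (Suc (2 * i) choose Suc i)" by (simp add: i)
  moreover have "Suc (2 * i) choose Suc i = Suc (2 * i) choose i" using binomial_symmetric[of "Suc i" "Suc (2 * i)"] by simp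
  ultimately show ?thesis by (simp add: i)
qed

theorem theorem4p1:
  fixes n :: nat
  assumes "n \<ge> 1"
  shows "(\<forall>k::nat. k \<ge> 1 \<and> n + 1 = 2 * k - 1 \<and> (\<forall>l::nat. l \<ge> 1 \<longrightarrow> n + 1 \<noteq> 3 * l) \<longrightarrow>
            (2 * real n + 2) * real (num_tree_rooted n) =
              catalan (n + 1) * catalan (2 * n)
              + 1 / 2 * (real n + 1) * catalan n * real ((2 * k) choose k))
       \<and> (\<forall>k::nat. k \<ge> 1 \<and> n + 1 = 2 * k \<and> (\<forall>l::nat. l \<ge> 1 \<longrightarrow> n + 1 \<noteq> 3 * l) \<longrightarrow>
            (2 * real n + 2) * real (num_tree_rooted n) =
              catalan (n + 1) * catalan (2 * n)
              + (real n + 1) * catalan n * real ((2 * k) choose k))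
       \<and> (\<forall>k::nat. k \<ge> 1 \<and> n + 1 = 3 * (2 * k - 1) \<longrightarrow>
            (2 * real n + 2) * real (num_tree_rooted n) =
              catalan (n + 1) * catalan (2 * n)
              + 4 * (2 * real k - 1) * catalan (4 * k - 3) * real ((4 * k - 2) choose (2 * k - 1))
              + 1 / 2 * (real n + 1) * catalan n * real ((6 * k - 2) choose (3 * k - 1)))
       \<and> (\<forall>k::nat. k \<ge> 1 \<and> n + 1 = 6 * k \<longrightarrow>
            (2 * real n + 2) * real (num_tree_rooted n) =
              catalan (n + 1) * catalan (2 * n)
              + 8 * real k * catalan (4 * k - 1) * real ((4 * k) choose (2 * k))
              + (real n + 1) * catalan n * real ((6 * k) choose (3 * k)))"
proof (intro conjI allI impI; elim conjE)
  note formula = num_tree_rooted_formula[OF assms]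
  have no3: "\<not> 3 dvd (n + 1)" if "\<forall>l::nat. l \<ge> 1 \<longrightarrow> n + 1 \<noteq> 3 * l"
  proof
    assume "3 dvd (n + 1)"
    then obtain l where l: "n + 1 = 3 * l" by blast
    hence "l \<ge> 1" by (cases l) auto
    thus False using that l by blast
  qed
  have odd_case: "real ((n + 1) choose ((n + 1) div 2)) = 1 / 2 * real ((2 * k) choose k)"
    if "k \<ge> 1" "n + 1 = 2 * k - 1" for k
  proof -
    have "(n + 1) div 2 = k - 1" using that by linarith
    thus ?thesis using half_central_binomial[OF that(1)] that(2) by simp
  qed
  {
    fix k :: nat
    assume k: "k \<ge> 1" "n + 1 = 2 * k - 1" and no: "\<forall>l::nat. l \<ge> 1 \<longrightarrow> n + 1 \<noteq> 3 * l"
    show "(2 * real n + 2) * real (num_tree_rooted n) = catalan (n + 1) * catalan (2 * n)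
        + 1 / 2 * (real n + 1) * catalan n * real ((2 * k) choose k)"
      unfolding formula odd_case[OF k] card_rooted_vertex_0[OF assms no3[OF no]] by simp
  next
    fix k :: nat
    assume k: "k \<ge> 1" "n + 1 = 2 * k" and no: "\<forall>l::nat. l \<ge> 1 \<longrightarrow> n + 1 \<noteq> 3 * l"
    have "(n + 1) div 2 = k" using k by simp
    thus "(2 * real n + 2) * real (num_tree_rooted n) = catalan (n + 1) * catalan (2 * n)
        + (real n + 1) * catalan n * real ((2 * k) choose k)"
      unfolding formula card_rooted_vertex_0[OF assms no3[OF no]] by (simp add: k(2)[simplified])
  next
    fix k :: nat
    assume k: "k \<ge> 1" "n + 1 = 3 * (2 * k - 1)"
    \<comment> \<open>The odd case applies with \<open>3 * k - 1\<close> in place of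
      \<open>k\<close>, and the central vertex with \<open>m = 2 * k - 1\<close>; then
      \<open>4 / 3 * (n + 1)\<close> is \<open>4 * (2 * k - 1)\<close>.\<close>
    have e: "n + 1 = 2 * (3 * k - 1) - 1" "3 * k - 1 \<ge> 1" "2 * (3 * k - 1) = 6 * k - 2"
      "2 * (2 * k - 1) = 4 * k - 2" "4 * k - 2 - 1 = 4 * k - 3" using k by linarith+
    have "n + 4 = 6 * k" using k by linarith
    hence "real (n + 4) = real (6 * k)" by (rule arg_cong)
    hence r: "real n + 1 = 3 * (2 * real k - 1)" by simp
    show "(2 * real n + 2) * real (num_tree_rooted n) = catalan (n + 1) * catalan (2 * n)
        + 4 * (2 * real k - 1) * catalan (4 * k - 3) * real ((4 * k - 2) choose (2 * k - 1))
        + 1 / 2 * (real n + 1) * catalan n * real ((6 * k - 2) choose (3 * k - 1))"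
      unfolding formula odd_case[OF e(2,1)] card_rooted_vertex[OF assms k(2)] e(3,4,5) r by simp
  next
    fix k :: nat
    assume k: "k \<ge> 1" "n + 1 = 6 * k"
    \<comment> \<open>Now \<open>m = 2 * k\<close>, and \<open>4 / 3 * (n + 1)\<close> is
      \<open>8 * k\<close>.\<close>
    have e: "n + 1 = 3 * (2 * k)" "(n + 1) div 2 = 3 * k" "2 * (2 * k) = 4 * k" using k by simp_all
    have "real (n + 1) = real (6 * k)" by (rule arg_cong[OF k(2)])
    hence r: "real n + 1 = 6 * real k" by simp
    show "(2 * real n + 2) * real (num_tree_rooted n) = catalan (n + 1) * catalan (2 * n)
        + 8 * real k * catalan (4 * k - 1) * real ((4 * k) choose (2 * k))
        + (real n + 1) * catalan n * real ((6 * k) choose (3 * k))"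
      unfolding formula card_rooted_vertex[OF assms e(1)] e(2,3) k(2) using r by simp
  }
qed

end
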